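(* Let $(A,m,\Delta)$ and $(A,m,\delta)$ be cointeracting bialgebras over $\mathbb{Q}$, such that $(A,m,\Delta)$ is a graded connected Hopf algebra $A=\bigoplus_{n\geq0}A_n$. Denote by $\varepsilon'$ the counit of the coalgebra $(A,\delta)$, and for each character $\alpha$ of $A$ let $\Phi_\alpha:(A,m,\Delta)\to(\mathrm{QSym},m,\Delta)$ be the unique homogeneous Hopf algebra morphism such that $\varepsilon'_{\mathrm{QSym}}\circ\Phi_\alpha=\alpha$. \begin{enumerate} \item There exists a morphism $\Phi_1:A\to\mathrm{QSym}$ such that \begin{enumerate} \item $\Phi_1:(A,m,\Delta)\to(\mathrm{QSym},m,\Delta)$ is a homogeneous morphism of Hopf algebras, \item $\Phi_1:(A,m,\delta)\to(\mathrm{QSym},m,\delta)$ is a morphism of bialgebras, \end{enumerate} if, and only if, $$\forall n\in\mathbb{N},\qquad\delta(A_n)\subseteq A_n\otimes A+\ker(\Phi_{\varepsilon'})\otimes A+A\otimes\ker(\Phi_{\varepsilon'}).$$ Moreover, if this holds, then $\Phi_1=\Phi_{\varepsilon'}$, and the unique map $\phi_1:A\to\mathbb{Q}[X]$ which is both a Hopf algebra morphism from $(A,m,\Delta)$ to $(\mathbb{Q}[X],m,\Delta)$ and a bialgebra morphism from $(A,m,\delta)$ to $(\mathbb{Q}[X],m,\delta)$ is $H\circ\Phi_1$. \item If $$\forall n\in\mathbb{N},\qquad\delta(A_n)\subseteq A_n\otimes A+\ker(\Phi_{\varepsilon'})\otimes A,$$ then for any character $\alpha$ of $A$, $\Phi_\alpha=\Phi_{\varepsilon'}\leftarrow\alpha$,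 where $\Phi_{\varepsilon'}\leftarrow\alpha=(\Phi_{\varepsilon'}\otimes\alpha)\circ\delta$. \end{enumerate}
   Context: Cointeraction: two bialgebras $(A,m,\Delta)$ (counit $\varepsilon$) and $(A,m,\delta)$ with the same underlying algebra are in cointeraction if $\delta(1)=1\otimes1$, $\delta(ab)=\delta(a)\delta(b)$, $(\varepsilon\otimes\mathrm{Id})\circ\delta(a)=\varepsilon(a)1$ for all $a,b\in A$, and $m_{1,3,24}\circ(\delta\otimes\delta)\circ\Delta=(\Delta\otimes\mathrm{Id})\circ\delta$, where $m_{1,3,24}(a_1\otimes b_1\otimes a_2\otimes b_2)=a_1\otimes a_2\otimes b_1b_2$. Graded connected means that $m$ and $\Delta$ are homogeneous for the grading and $A_0=\mathbb{Q}1$. A character of $A$ is a unital algebra morphism $A\to\mathbb{Q}$. Bialgebra morphisms preserve units and counits. $\mathrm{QSym}$ is the $\mathbb{Q}$-vector space with basis $(M_u)$ indexed by compositions $u$ (finite, possibly empty, sequences of positive integers), graded by the sum $|u|$ of the letters of $u$. Its product $m$ is the quasi-shuffle product, i.e. the product such that, for an infinite totally ordered alphabet $\mathbf{X}$ of commuting variables, the linear map $M_{u_1,\ldots,u_n}\mapsto\sum_{x_1<\cdots<x_n\text{ in }\mathbf{X}}x_1^{u_1}\cdots x_n^{u_n}$ is an (injective) algebra morphism to formal power series; unit $M_\emptyset=1$. The coproduct $\Delta$ is deconcatenation: $\Delta(M_w)=\sum_{uv=w}M_u\otimes M_v$. The second coproduct is $\delta(1)=1\otimes1$ and, for $w$ of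 length $n\geq1$, $\delta(M_w)=\sum_{k=1}^n\sum_{w=w_1\cdots w_k}M_{|w_1|,\ldots,|w_k|}\otimes M_{w_1}\cdots M_{w_k}$, over factorizations into nonempty compositions. $(\mathrm{QSym},m,\Delta)$ is a graded connected Hopf algebra, $(\mathrm{QSym},m,\delta)$ is a bialgebra with counit $\varepsilon'_{\mathrm{QSym}}$ (also denoted $\varepsilon'$) sending $M_u$ to $1$ if $u$ has at most one letter and to $0$ otherwise. Known theorem (Aguiar–Bergeron–Sottile), giving the existence and uniqueness of $\Phi_\alpha$: for $a\in A$, $$\Phi_\alpha(a)=\varepsilon(a)1+\sum_{k\geq1}\sum_{u_1,\ldots,u_k>0}\alpha^{\otimes k}\circ(\pi_{u_1}\otimes\cdots\otimes\pi_{u_k})\circ\Delta^{(k-1)}(a)\,M_{u_1,\ldots,u_k},$$ where $\pi_j$ is the canonical projection of $A$ onto $A_j$ and $\Delta^{(k-1)}$ is the iterated coproduct. On $\mathbb{Q}[X]$, $m$ is the usual product, and $\Delta,\delta$ are the algebra morphisms with $\Delta(X)=X\otimes1+1\otimes X$, $\delta(X)=X\otimes X$, with counits $P\mapsto P(0)$ and $P\mapsto P(1)$. $H:\mathrm{QSym}\to\mathbb{Q}[X]$ is the linear map $H(M_{u_1,\ldots,u_k})=\frac{X(X-1)\cdots(X-k+1)}{k!}$. *)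

theory Defs
  imports
    Complex_Main
    "HOL-Library.Poly_Mapping"
    "HOL-Library.Set_Algebras"
    "HOL-Computational_Algebra.Polynomial"
begin

section \<open>Vector spaces and unital associative algebras over the rationals\<close>

class rat_vector = ab_group_add +
  fixes scaleQ :: "rat \<Rightarrow> 'a \<Rightarrow> 'a" (infixr \<open>*\<^sub>Q\<close> 75)
  assumes scaleQ_add_right: "a *\<^sub>Q (x + y) = a *\<^sub>Q x + a *\<^sub>Q y"
    and scaleQ_add_left: "(a + b) *\<^sub>Q x = a *\<^sub>Q x + b *\<^sub>Q x"
    and scaleQ_scaleQ: "a *\<^sub>Q (b *\<^sub>Q x) = (a * b) *\<^sub>Q x"
    and scaleQ_one: "1 *\<^sub>Q x = x"

class rat_algebra_1 = rat_vector + ring_1 +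
  assumes scaleQ_mult_left: "(a *\<^sub>Q x) * y = a *\<^sub>Q (x * y)"
    and scaleQ_mult_right: "x * (a *\<^sub>Q y) = a *\<^sub>Q (x * y)"

global_interpretation Q: vector_space "scaleQ :: rat \<Rightarrow> 'a \<Rightarrow> 'a::rat_vector"
  by unfold_locales (auto intro: scaleQ_add_right scaleQ_add_left scaleQ_scaleQ scaleQ_one)

abbreviation linearQ :: "('a::rat_vector \<Rightarrow> 'b::rat_vector) \<Rightarrow> bool"
  where "linearQ \<equiv> Vector_Spaces.linear (*\<^sub>Q) (*\<^sub>Q)"

lemma linearQ_iff:
  "linearQ f \<longleftrightarrow> (\<forall>x y. f (x + y) = f x + f y) \<and> (\<forall>c x. f (c *\<^sub>Q x) = c *\<^sub>Q f x)"
  unfolding Vector_Spaces.linear_def module_hom_def module_hom_axioms_def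
  by (auto intro: Q.vector_space_axioms Q.module_axioms)

lemma linearQI:
  "(\<And>x y. f (x + y) = f x + f y) \<Longrightarrow> (\<And>c x. f (c *\<^sub>Q x) = c *\<^sub>Q f x) \<Longrightarrow> linearQ f"
  by (simp add: linearQ_iff)

lemma linearQ_add: "linearQ f \<Longrightarrow> f (x + y) = f x + f y"
  and linearQ_scale: "linearQ f \<Longrightarrow> f (c *\<^sub>Q x) = c *\<^sub>Q f x"
  by (simp_all add: linearQ_iff)

lemma linearQ_zero: "linearQ f \<Longrightarrow> f 0 = 0"
  using linearQ_scale[of f 0 0] by simp

lemma linearQ_diff: "linearQ f \<Longrightarrow> f (x - y) = f x - f y"
  using linearQ_add[of f "x - y" y] by (simp add: algebra_simps)

instantiation rat :: rat_algebra_1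
begin
definition scaleQ_rat :: "rat \<Rightarrow> rat \<Rightarrow> rat" where "scaleQ_rat c x = c * x"
instance by standard (simp_all add: scaleQ_rat_def algebra_simps)
end

instantiation poly :: (field_char_0) rat_algebra_1
begin
definition scaleQ_poly :: "rat \<Rightarrow> 'a poly \<Rightarrow> 'a poly"
  where "scaleQ_poly c p = smult (of_rat c) p"
instance
  by standard
    (simp_all add: scaleQ_poly_def smult_add_right smult_add_left of_rat_add of_rat_mult)
end

instantiation poly_mapping :: (type, rat_vector) rat_vector
begin
lift_definition scaleQ_poly_mapping :: "rat \<Rightarrow> ('a \<Rightarrow>\<^sub>0 'b) \<Rightarrow> 'a \<Rightarrow>\<^sub>0 'b"
  is "\<lambda>c f k. c *\<^sub>Q f k"
  by (erule rev_finite_subset) auto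
instance
  by standard (transfer; simp add: fun_eq_iff scaleQ_add_right scaleQ_add_left scaleQ_scaleQ)+
end

lemma lookup_scaleQ [simp]: "Poly_Mapping.lookup (c *\<^sub>Q p) k = c *\<^sub>Q Poly_Mapping.lookup p k"
  by transfer simp

lemma rat_scaleQ_eq [simp]: "(c::rat) *\<^sub>Q x = c * x"
  by (simp add: scaleQ_rat_def)


section \<open>Linear extension from the basis of a free vector space\<close>

definition lin_ext :: "('b \<Rightarrow> 'c::rat_vector) \<Rightarrow> ('b \<Rightarrow>\<^sub>0 rat) \<Rightarrow> 'c"
  where "lin_ext f p = (\<Sum>b \<in> Poly_Mapping.keys p. Poly_Mapping.lookup p b *\<^sub>Q f b)"

lemma lin_ext_superset:
  assumes "finite S" "Poly_Mapping.keys p \<subseteq> S"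
  shows "lin_ext f p = (\<Sum>b\<in>S. Poly_Mapping.lookup p b *\<^sub>Q f b)"
  unfolding lin_ext_def
  by (rule sum.mono_neutral_left) (use assms in \<open>auto simp: in_keys_iff\<close>)

lemma linearQ_lin_ext: "linearQ (lin_ext f)"
proof (rule linearQI)
  fix p q :: "'a \<Rightarrow>\<^sub>0 rat" and c :: rat
  let ?S = "Poly_Mapping.keys p \<union> Poly_Mapping.keys q"
  have "lin_ext f (p + q) = (\<Sum>b\<in>?S. Poly_Mapping.lookup (p + q) b *\<^sub>Q f b)"
    by (rule lin_ext_superset) (use Poly_Mapping.keys_add[of p q] in auto)
  also have "\<dots> = lin_ext f p + lin_ext f q"
    by (simp add: lin_ext_superset[of ?S] lookup_add scaleQ_add_left sum.distrib)
  finally show "lin_ext f (p + q) = lin_ext f p + lin_ext f q" .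
  have "lin_ext f (c *\<^sub>Q p) = (\<Sum>b\<in>Poly_Mapping.keys p. Poly_Mapping.lookup (c *\<^sub>Q p) b *\<^sub>Q f b)"
    by (rule lin_ext_superset) (auto simp: in_keys_iff)
  also have "\<dots> = c *\<^sub>Q lin_ext f p"
    by (simp add: lin_ext_def Q.scale_sum_right scaleQ_scaleQ)
  finally show "lin_ext f (c *\<^sub>Q p) = c *\<^sub>Q lin_ext f p" .
qed

lemma lin_ext_single [simp]: "lin_ext f (Poly_Mapping.single b c) = c *\<^sub>Q f b"
  by (subst lin_ext_superset[of "{b}"]) (auto split: if_splits)

lemmas lin_ext_add [simp] = linearQ_add[OF linearQ_lin_ext]
  and lin_ext_scale [simp] = linearQ_scale[OF linearQ_lin_ext]
  and lin_ext_zero [simp] = linearQ_zero[OF linearQ_lin_ext]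
  and lin_ext_diff [simp] = linearQ_diff[OF linearQ_lin_ext]

lemma lin_ext_fun_add: "lin_ext (\<lambda>u. f u + g u) p = lin_ext f p + lin_ext g p"
  by (simp add: lin_ext_def scaleQ_add_right sum.distrib)

lemma lin_ext_fun_scale: "lin_ext (\<lambda>u. c *\<^sub>Q f u) p = c *\<^sub>Q lin_ext f p"
  by (simp add: lin_ext_def Q.scale_sum_right Q.scale_left_commute[of c] del: Q.scale_scale)

lemma free_expand: "p = (\<Sum>b\<in>Poly_Mapping.keys p. Poly_Mapping.lookup p b *\<^sub>Q Poly_Mapping.single b 1)"
proof (rule poly_mapping_eqI)
  fix k
  show "Poly_Mapping.lookup p k
      = Poly_Mapping.lookup (\<Sum>b\<in>Poly_Mapping.keys p. Poly_Mapping.lookup p b *\<^sub>Q Poly_Mapping.single b 1) k"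
    by (auto simp: Poly_Mapping.lookup_sum lookup_single when_def if_distrib sum.delta in_keys_iff cong: if_cong)
qed

lemma linearQ_sum: "linearQ f \<Longrightarrow> f (sum g S) = (\<Sum>x\<in>S. f (g x))"
  by (induction S rule: infinite_finite_induct) (auto simp: linearQ_zero linearQ_add)

lemma linearQ_free_eq:
  assumes "linearQ f" "linearQ g" "\<And>b. f (Poly_Mapping.single b 1) = g (Poly_Mapping.single b 1)"
  shows "f (p :: 'b \<Rightarrow>\<^sub>0 rat) = g p"
  by (subst (1 2) free_expand) (simp add: linearQ_sum linearQ_scale assms)


section \<open>Tensor products\<close>

definition bilinearQ :: "('a::rat_vector \<Rightarrow> 'b::rat_vector \<Rightarrow> 'c::rat_vector) \<Rightarrow> bool"
  where "bilinearQ f \<longleftrightarrow> (\<forall>y. linearQ (\<lambda>x. f x y)) \<and> (\<forall>x. linearQ (f x))"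

definition tensor_relators :: "('a::rat_vector \<times> 'b::rat_vector \<Rightarrow>\<^sub>0 rat) set" where
  "tensor_relators =
     {Poly_Mapping.single (x + x', y) 1 - Poly_Mapping.single (x, y) 1 - Poly_Mapping.single (x', y) 1 | x x' y. True}
   \<union> {Poly_Mapping.single (x, y + y') 1 - Poly_Mapping.single (x, y) 1 - Poly_Mapping.single (x, y') 1 | x y y'. True}
   \<union> {Poly_Mapping.single (c *\<^sub>Q x, y) 1 - c *\<^sub>Q Poly_Mapping.single (x, y) 1 | c x y. True}
   \<union> {Poly_Mapping.single (x, c *\<^sub>Q y) 1 - c *\<^sub>Q Poly_Mapping.single (x, y) 1 | c x y. True}"

definition tensor_eq :: "('a::rat_vector \<times> 'b::rat_vector \<Rightarrow>\<^sub>0 rat) \<Rightarrow> ('a \<times> 'b \<Rightarrow>\<^sub>0 rat) \<Rightarrow> bool"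
  where "tensor_eq p q \<longleftrightarrow> p - q \<in> Q.span tensor_relators"

lemma equivp_tensor_eq: "equivp tensor_eq"
proof (rule equivpI)
  show "reflp tensor_eq" by (auto intro!: reflpI simp: tensor_eq_def Q.span_zero)
  show "symp tensor_eq"
    unfolding symp_def tensor_eq_def by (auto dest: Q.span_neg)
  show "transp tensor_eq"
    unfolding transp_def tensor_eq_def by (auto dest: Q.span_add)
qed

quotient_type (overloaded) ('a, 'b) tensor (infixr \<open>\<otimes>\<close> 75)
  = "('a::rat_vector \<times> 'b::rat_vector) \<Rightarrow>\<^sub>0 rat" / tensor_eq
  by (rule equivp_tensor_eq)

instantiation tensor :: (rat_vector, rat_vector) rat_vector
begin

lift_definition zero_tensor :: "'a \<otimes> 'b" is 0 .

lift_definition plus_tensor :: "'a \<otimes> 'b \<Rightarrow> 'a \<otimes> 'b \<Rightarrow> 'a \<otimes> 'b" is "(+)"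
  unfolding tensor_eq_def by (simp only: add_diff_add Q.span_add)

lift_definition uminus_tensor :: "'a \<otimes> 'b \<Rightarrow> 'a \<otimes> 'b" is uminus
  unfolding tensor_eq_def by (simp only: minus_diff_minus Q.span_neg)

lift_definition minus_tensor :: "'a \<otimes> 'b \<Rightarrow> 'a \<otimes> 'b \<Rightarrow> 'a \<otimes> 'b" is "(-)"
  unfolding tensor_eq_def by (drule (1) Q.span_diff) (simp add: algebra_simps)

lift_definition scaleQ_tensor :: "rat \<Rightarrow> 'a \<otimes> 'b \<Rightarrow> 'a \<otimes> 'b" is "(*\<^sub>Q)"
  unfolding tensor_eq_def by (simp only: Q.span_scale flip: Q.scale_right_diff_distrib)

instance
  by standard
    (transfer; simp add: tensor_eq_def Q.span_zero algebra_simps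
      scaleQ_add_right scaleQ_add_left scaleQ_scaleQ scaleQ_one)+

end

lift_definition tens :: "'a::rat_vector \<Rightarrow> 'b::rat_vector \<Rightarrow> 'a \<otimes> 'b" (infixr \<open>\<otimes>\<close> 75)
  is "\<lambda>x y. Poly_Mapping.single (x, y) 1" .

lemma tens_add_left: "(x + x') \<otimes> y = x \<otimes> y + x' \<otimes> y"
  by transfer
    (unfold tensor_eq_def diff_diff_eq[symmetric], rule Q.span_base, unfold tensor_relators_def, blast)

lemma tens_add_right: "x \<otimes> (y + y') = x \<otimes> y + x \<otimes> y'"
  by transfer
    (unfold tensor_eq_def diff_diff_eq[symmetric], rule Q.span_base, unfold tensor_relators_def, blast)

lemma tens_scale_left: "(c *\<^sub>Q x) \<otimes> y = c *\<^sub>Q (x \<otimes> y)"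
  by transfer (unfold tensor_eq_def, rule Q.span_base, unfold tensor_relators_def, blast)

lemma tens_scale_right: "x \<otimes> (c *\<^sub>Q y) = c *\<^sub>Q (x \<otimes> y)"
  by transfer (unfold tensor_eq_def, rule Q.span_base, unfold tensor_relators_def, blast)

lemma bilinearQ_tens: "bilinearQ (\<otimes>)"
  by (simp add: bilinearQ_def linearQ_iff tens_add_left tens_add_right tens_scale_left tens_scale_right)

lemma bilinearQ_relators:
  assumes f: "bilinearQ f" and p: "p \<in> Q.span tensor_relators"
  shows "lin_ext (\<lambda>(x, y). f x y) p = 0"
  using p
proof (induction rule: Q.span_induct_alt)
  case base
  then show ?case by simp
next
  case (step c r q)
  from step(1) f have "lin_ext (\<lambda>(x, y). f x y) r = 0"
    unfolding tensor_relators_def bilinearQ_def linearQ_iff by (auto simp: scaleQ_one)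
  with step(2) show ?case by simp
qed

text \<open>
  The linear map on the tensor product induced by a bilinear map (universal property); the value
  for maps that are not bilinear is irrelevant.
\<close>
lift_definition tensor_lift ::
  "('a::rat_vector \<Rightarrow> 'b::rat_vector \<Rightarrow> 'c::rat_vector) \<Rightarrow> 'a \<otimes> 'b \<Rightarrow> 'c"
  is "\<lambda>f p. if bilinearQ f then lin_ext (\<lambda>(x, y). f x y) p else 0"
  unfolding tensor_eq_def by (metis bilinearQ_relators lin_ext_diff right_minus_eq)

lemma tensor_lift_tens: "bilinearQ f \<Longrightarrow> tensor_lift f (x \<otimes> y) = f x y"
  by transfer (simp add: scaleQ_one)

lemma linearQ_tensor_lift: "linearQ (tensor_lift f)"
  by (rule linearQI; transfer; simp)

lemmas tensor_lift_add = linearQ_add[OF linearQ_tensor_lift]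
  and tensor_lift_scale = linearQ_scale[OF linearQ_tensor_lift]
  and tensor_lift_zero = linearQ_zero[OF linearQ_tensor_lift]

lemma tensor_induct [case_names tens add, induct type: tensor]:
  fixes P :: "'a::rat_vector \<otimes> 'b::rat_vector \<Rightarrow> bool"
  assumes tens: "\<And>x y. P (x \<otimes> y)" and add: "\<And>s t. P s \<Longrightarrow> P t \<Longrightarrow> P (s + t)"
  shows "P t"
proof -
  have zero: "P 0"
    using tens[of 0 0] tens_scale_left[of 0 "0 :: 'a" "0 :: 'b"] by simp
  have "P (abs_tensor (\<Sum>b\<in>S. c b *\<^sub>Q Poly_Mapping.single b 1))" for S :: "('a \<times> 'b) set" and c
  proof (induction S rule: infinite_finite_induct)
    case (insert b S)
    have "abs_tensor (c b *\<^sub>Q Poly_Mapping.single b 1) = (c b *\<^sub>Q fst b) \<otimes> snd b"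
      unfolding tens_scale_left by (simp add: tens.abs_eq scaleQ_tensor.abs_eq)
    with insert show ?case
      by (simp add: plus_tensor.abs_eq[symmetric] add tens)
  qed (use zero in \<open>simp_all add: zero_tensor_def\<close>)
  from this[of "\<lambda>b. Poly_Mapping.lookup (rep_tensor t) b" "Poly_Mapping.keys (rep_tensor t)"]
  have "P (abs_tensor (rep_tensor t))"
    by (simp flip: free_expand)
  then show ?thesis by (metis Quotient3_abs_rep Quotient3_tensor)
qed

lemma tensor_eqI:
  assumes "linearQ f" "linearQ g" "\<And>x y. f (x \<otimes> y) = g (x \<otimes> y)"
  shows "f t = g t"
  by (induction t) (auto simp: assms linearQ_add)

lemma bilinearQ_tensor_lift:
  assumes "\<And>a b. bilinearQ (F a b)" "\<And>c d. bilinearQ (\<lambda>a b. F a b c d)"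
  shows "bilinearQ (\<lambda>a b. tensor_lift (F a b) t)"
proof (induction t)
  case (tens x y)
  show ?case by (simp add: tensor_lift_tens assms)
next
  case (add s t)
  then show ?case
    by (simp add: bilinearQ_def linearQ_iff tensor_lift_add algebra_simps scaleQ_add_right)
qed

lemma linearQ_compose: "linearQ f \<Longrightarrow> linearQ g \<Longrightarrow> linearQ (\<lambda>x. f (g x))"
  by (simp add: linearQ_iff)

definition tensor_map ::
  "('a::rat_vector \<Rightarrow> 'c::rat_vector) \<Rightarrow> ('b::rat_vector \<Rightarrow> 'd::rat_vector) \<Rightarrow> 'a \<otimes> 'b \<Rightarrow> 'c \<otimes> 'd"
  where "tensor_map f g = tensor_lift (\<lambda>x y. f x \<otimes> g y)"

lemma tensor_map_tens: "linearQ f \<Longrightarrow> linearQ g \<Longrightarrow> tensor_map f g (x \<otimes> y) = f x \<otimes> g y"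
  unfolding tensor_map_def
  by (rule tensor_lift_tens)
    (simp add: bilinearQ_def linearQ_iff tens_add_left tens_add_right tens_scale_left tens_scale_right)

definition tensor_assoc ::
  "('a::rat_vector \<otimes> 'b::rat_vector) \<otimes> 'c::rat_vector \<Rightarrow> 'a \<otimes> 'b \<otimes> 'c"
  where "tensor_assoc = tensor_lift (\<lambda>s z. tensor_lift (\<lambda>x y. x \<otimes> y \<otimes> z) s)"

lemma tensor_assoc_tens:
  fixes x :: "'a::rat_vector" and y :: "'b::rat_vector" and z :: "'c::rat_vector"
  shows "tensor_assoc ((x \<otimes> y) \<otimes> z) = x \<otimes> y \<otimes> z"
proof -
  have 1: "bilinearQ (\<lambda>(x::'a) (y::'b). x \<otimes> y \<otimes> z)" for z :: 'c
    by (simp add: bilinearQ_def linearQ_iff tens_add_left tens_add_right tens_scale_left tens_scale_right)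
  have "bilinearQ (\<lambda>(s::'a \<otimes> 'b) (z::'c). tensor_lift (\<lambda>x y. x \<otimes> y \<otimes> z) s)"
    unfolding bilinearQ_def
  proof (intro conjI allI linearQ_tensor_lift)
    fix s :: "'a \<otimes> 'b"
    show "linearQ (\<lambda>z :: 'c. tensor_lift (\<lambda>x y. x \<otimes> y \<otimes> z) s)"
      by (induction s)
        (simp_all add: linearQ_iff tensor_lift_tens[OF 1] tensor_lift_add
          tens_add_left tens_add_right tens_scale_left tens_scale_right scaleQ_add_right algebra_simps)
  qed
  then show ?thesis
    by (simp add: tensor_assoc_def tensor_lift_tens 1)
qed

text \<open>The canonical isomorphisms from \<open>\<rat> \<otimes> V\<close> and \<open>V \<otimes> \<rat>\<close> to \<open>V\<close>.\<close>

definition unit_left :: "rat \<otimes> 'a::rat_vector \<Rightarrow> 'a"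
  where "unit_left = tensor_lift (\<lambda>c x. c *\<^sub>Q x)"

definition unit_right :: "'a::rat_vector \<otimes> rat \<Rightarrow> 'a"
  where "unit_right = tensor_lift (\<lambda>x c. c *\<^sub>Q x)"

lemma unit_left_tens: "unit_left (c \<otimes> x) = c *\<^sub>Q x"
  and unit_right_tens: "unit_right (x \<otimes> c) = c *\<^sub>Q x"
  unfolding unit_left_def unit_right_def
  by (subst tensor_lift_tens;
      simp add: bilinearQ_def linearQ_iff scaleQ_add_right scaleQ_add_left scaleQ_scaleQ mult.commute)+

definition tensor_set :: "'a::rat_vector set \<Rightarrow> 'b::rat_vector set \<Rightarrow> ('a \<otimes> 'b) set"
  where "tensor_set U V = Q.span {x \<otimes> y | x y. x \<in> U \<and> y \<in> V}"


subsection \<open>The tensor product of two algebras\<close>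

lemma exists_functional: "\<exists>g :: 'a::rat_algebra_1 \<Rightarrow> rat. linearQ g \<and> g 1 = 1"
proof -
  interpret P: vector_space_pair "scaleQ :: rat \<Rightarrow> 'a \<Rightarrow> 'a" "scaleQ :: rat \<Rightarrow> rat \<Rightarrow> rat"
    by unfold_locales
  show ?thesis
    using P.linear_independent_extend[of "{1}" "\<lambda>_. 1"] by auto
qed

instantiation tensor :: (rat_algebra_1, rat_algebra_1) rat_algebra_1
begin

definition one_tensor :: "'a \<otimes> 'b" where "one_tensor = 1 \<otimes> 1"

definition times_tensor :: "'a \<otimes> 'b \<Rightarrow> 'a \<otimes> 'b \<Rightarrow> 'a \<otimes> 'b" where
  "times_tensor s t = tensor_lift (\<lambda>a b. tensor_lift (\<lambda>c d. (a * c) \<otimes> (b * d)) t) s"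

lemma bilinearQ_mult_tens:
  fixes a c :: 'a and b d :: 'b
  shows "bilinearQ (\<lambda>c d. (a * c) \<otimes> (b * d))" "bilinearQ (\<lambda>a b. (a * c) \<otimes> (b * d))"
  by (simp_all add: bilinearQ_def linearQ_iff algebra_simps scaleQ_mult_left scaleQ_mult_right
        tens_add_left tens_add_right tens_scale_left tens_scale_right)

lemma tens_mult_tens: "(a \<otimes> b) * (c \<otimes> d) = ((a * c) \<otimes> (b * d) :: 'a \<otimes> 'b)"
  unfolding times_tensor_def
  by (subst tensor_lift_tens)
    (auto intro!: bilinearQ_tensor_lift bilinearQ_mult_tens simp: tensor_lift_tens[OF bilinearQ_mult_tens(1)])

lemma tensor_mult_linear:
  fixes s t :: "'a \<otimes> 'b"
  shows "linearQ (\<lambda>s. s * t)" "linearQ (\<lambda>t. s * t)"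
proof -
  show "linearQ (\<lambda>s. s * t)"
    unfolding times_tensor_def by (rule linearQ_tensor_lift)
  show "linearQ (\<lambda>t. s * t)"
  proof (induction s)
    case (tens x y)
    have "x \<otimes> y * t = tensor_lift (\<lambda>c d. (x * c) \<otimes> (y * d)) t" for t
      unfolding times_tensor_def
      by (rule tensor_lift_tens) (intro bilinearQ_tensor_lift bilinearQ_mult_tens)
    then show ?case by (simp add: linearQ_tensor_lift)
  next
    case (add s t)
    have "(s + t) * u = s * u + t * u" for u
      unfolding times_tensor_def by (rule tensor_lift_add)
    with add show ?case by (simp add: linearQ_iff algebra_simps scaleQ_add_right)
  qed
qed

instance
proof
  fix s t u :: "'a \<otimes> 'b" and c :: rat
  show add_l: "(s + t) * u = s * u + t * u" for s t u :: "'a \<otimes> 'b"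
    by (rule linearQ_add[OF tensor_mult_linear(1)])
  show add_r: "s * (t + u) = s * t + s * u" for s t u :: "'a \<otimes> 'b"
    by (rule linearQ_add[OF tensor_mult_linear(2)])
  show "c *\<^sub>Q s * t = c *\<^sub>Q (s * t)"
    by (rule linearQ_scale[OF tensor_mult_linear(1)])
  show "s * c *\<^sub>Q t = c *\<^sub>Q (s * t)"
    by (rule linearQ_scale[OF tensor_mult_linear(2)])
  show "1 * s = s" "s * 1 = s"
    by (induction s; simp add: one_tensor_def tens_mult_tens add_l add_r)+
  have 1: "(a \<otimes> b) * (c \<otimes> d) * u = (a \<otimes> b) * ((c \<otimes> d) * u)" for a c :: 'a and b d :: 'b and u
    by (induction u) (simp_all add: tens_mult_tens mult.assoc add_r)
  have 2: "(a \<otimes> b) * t * u = (a \<otimes> b) * (t * u)" for a :: 'a and b :: 'b and t u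
    by (induction t) (simp_all add: 1 add_r add_l)
  show "s * t * u = s * (t * u)"
    by (induction s) (simp_all add: 2 add_l)
  show "(0 :: 'a \<otimes> 'b) \<noteq> 1"
  proof
    assume *: "(0 :: 'a \<otimes> 'b) = 1"
    obtain g :: "'a \<Rightarrow> rat" and h :: "'b \<Rightarrow> rat"
      where g: "linearQ g" "g 1 = 1" and h: "linearQ h" "h 1 = 1"
      using exists_functional by metis
    have "bilinearQ (\<lambda>x y. g x * h y)"
      using g(1) h(1) by (simp add: bilinearQ_def linearQ_iff algebra_simps)
    from tensor_lift_tens[OF this, of 1 1] have "tensor_lift (\<lambda>x y. g x * h y) 1 = 1"
      using g h by (simp add: one_tensor_def)
    with * show False
      by (metis tensor_lift_zero zero_neq_one)
  qed
qed

end


section \<open>Bialgebras, Hopf algebras, gradings and cointeraction\<close>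

text \<open>
  The algebra structure of a bialgebra is the one given by \<^class>\<open>rat_algebra_1\<close>: associative and
  unital, not necessarily commutative.
\<close>

definition algebra_morphism :: "('a::rat_algebra_1 \<Rightarrow> 'b::rat_algebra_1) \<Rightarrow> bool" where
  "algebra_morphism f \<longleftrightarrow> linearQ f \<and> f 1 = 1 \<and> (\<forall>x y. f (x * y) = f x * f y)"

abbreviation character :: "('a::rat_algebra_1 \<Rightarrow> rat) \<Rightarrow> bool"
  where "character \<equiv> algebra_morphism"

definition coalgebra :: "('a::rat_vector \<Rightarrow> 'a \<otimes> 'a) \<Rightarrow> ('a \<Rightarrow> rat) \<Rightarrow> bool" where
  "coalgebra \<Delta> \<epsilon> \<longleftrightarrow> linearQ \<Delta> \<and> linearQ \<epsilon> \<and>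
     tensor_assoc \<circ> tensor_map \<Delta> id \<circ> \<Delta> = tensor_map id \<Delta> \<circ> \<Delta> \<and>
     unit_left \<circ> tensor_map \<epsilon> id \<circ> \<Delta> = id \<and>
     unit_right \<circ> tensor_map id \<epsilon> \<circ> \<Delta> = id"

definition bialgebra :: "('a::rat_algebra_1 \<Rightarrow> 'a \<otimes> 'a) \<Rightarrow> ('a \<Rightarrow> rat) \<Rightarrow> bool" where
  "bialgebra \<Delta> \<epsilon> \<longleftrightarrow> coalgebra \<Delta> \<epsilon> \<and> algebra_morphism \<Delta> \<and> algebra_morphism \<epsilon>"

definition hopf_algebra :: "('a::rat_algebra_1 \<Rightarrow> 'a \<otimes> 'a) \<Rightarrow> ('a \<Rightarrow> rat) \<Rightarrow> bool" where
  "hopf_algebra \<Delta> \<epsilon> \<longleftrightarrow> bialgebra \<Delta> \<epsilon> \<and>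
     (\<exists>S. linearQ S \<and>
        (\<forall>a. tensor_lift (*) (tensor_map S id (\<Delta> a)) = \<epsilon> a *\<^sub>Q 1) \<and>
        (\<forall>a. tensor_lift (*) (tensor_map id S (\<Delta> a)) = \<epsilon> a *\<^sub>Q 1))"

definition coalgebra_morphism ::
  "('a::rat_vector \<Rightarrow> 'a \<otimes> 'a) \<Rightarrow> ('a \<Rightarrow> rat) \<Rightarrow>
   ('b::rat_vector \<Rightarrow> 'b \<otimes> 'b) \<Rightarrow> ('b \<Rightarrow> rat) \<Rightarrow> ('a \<Rightarrow> 'b) \<Rightarrow> bool" where
  "coalgebra_morphism \<Delta> \<epsilon> \<Delta>' \<epsilon>' f \<longleftrightarrow>
     linearQ f \<and> \<Delta>' \<circ> f = tensor_map f f \<circ> \<Delta> \<and> \<epsilon>' \<circ> f = \<epsilon>"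

text \<open>
  A morphism of Hopf algebras is a morphism between the underlying bialgebras; it automatically
  commutes with the antipodes.
\<close>
definition bialgebra_morphism ::
  "('a::rat_algebra_1 \<Rightarrow> 'a \<otimes> 'a) \<Rightarrow> ('a \<Rightarrow> rat) \<Rightarrow>
   ('b::rat_algebra_1 \<Rightarrow> 'b \<otimes> 'b) \<Rightarrow> ('b \<Rightarrow> rat) \<Rightarrow> ('a \<Rightarrow> 'b) \<Rightarrow> bool" where
  "bialgebra_morphism \<Delta> \<epsilon> \<Delta>' \<epsilon>' f \<longleftrightarrow>
     algebra_morphism f \<and> coalgebra_morphism \<Delta> \<epsilon> \<Delta>' \<epsilon>' f"

definition direct_sum_decomposition :: "(nat \<Rightarrow> 'a::rat_vector set) \<Rightarrow> bool" where
  "direct_sum_decomposition A \<longleftrightarrow> (\<forall>n. Q.subspace (A n)) \<and>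
     (\<forall>a. \<exists>!f. (\<forall>n. f n \<in> A n) \<and> finite {n. f n \<noteq> 0} \<and> a = (\<Sum>n | f n \<noteq> 0. f n))"

definition graded_connected ::
  "(nat \<Rightarrow> 'a::rat_algebra_1 set) \<Rightarrow> ('a \<Rightarrow> 'a \<otimes> 'a) \<Rightarrow> bool" where
  "graded_connected A \<Delta> \<longleftrightarrow> direct_sum_decomposition A \<and>
     (\<forall>i j. \<forall>x\<in>A i. \<forall>y\<in>A j. x * y \<in> A (i + j)) \<and>
     (\<forall>n. \<Delta> ` A n \<subseteq> Q.span (\<Union>i\<le>n. tensor_set (A i) (A (n - i)))) \<and>
     A 0 = range (\<lambda>c. c *\<^sub>Q 1)"

definition homogeneous :: "(nat \<Rightarrow> 'a set) \<Rightarrow> (nat \<Rightarrow> 'b set) \<Rightarrow> ('a \<Rightarrow> 'b) \<Rightarrow> bool"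
  where "homogeneous A B f \<longleftrightarrow> (\<forall>n. f ` A n \<subseteq> B n)"

text \<open>The map \<open>a\<^sub>1 \<otimes> b\<^sub>1 \<otimes> a\<^sub>2 \<otimes> b\<^sub>2 \<mapsto> a\<^sub>1 \<otimes> a\<^sub>2 \<otimes> b\<^sub>1b\<^sub>2\<close>, with bracketing as forced by the types.\<close>
definition m_1_3_24 ::
  "('a::rat_algebra_1 \<otimes> 'a) \<otimes> ('a \<otimes> 'a) \<Rightarrow> ('a \<otimes> 'a) \<otimes> 'a" where
  "m_1_3_24 = tensor_lift (\<lambda>s t.
     tensor_lift (\<lambda>a\<^sub>1 b\<^sub>1. tensor_lift (\<lambda>a\<^sub>2 b\<^sub>2. (a\<^sub>1 \<otimes> a\<^sub>2) \<otimes> (b\<^sub>1 * b\<^sub>2)) t) s)"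

lemma m_1_3_24_tens:
  fixes a\<^sub>1 b\<^sub>1 a\<^sub>2 b\<^sub>2 :: "'a::rat_algebra_1"
  shows "m_1_3_24 ((a\<^sub>1 \<otimes> b\<^sub>1) \<otimes> (a\<^sub>2 \<otimes> b\<^sub>2)) = (a\<^sub>1 \<otimes> a\<^sub>2) \<otimes> (b\<^sub>1 * b\<^sub>2)"
proof -
  have 1: "bilinearQ (\<lambda>(a\<^sub>2::'a) b\<^sub>2. (a\<^sub>1 \<otimes> a\<^sub>2) \<otimes> (b\<^sub>1 * b\<^sub>2))"
    and 2: "bilinearQ (\<lambda>(a\<^sub>1::'a) b\<^sub>1. (a\<^sub>1 \<otimes> a\<^sub>2) \<otimes> (b\<^sub>1 * b\<^sub>2))" for a\<^sub>1 b\<^sub>1 a\<^sub>2 b\<^sub>2 :: 'a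
    by (simp_all add: bilinearQ_def linearQ_iff algebra_simps scaleQ_mult_left scaleQ_mult_right
        tens_add_left tens_add_right tens_scale_left tens_scale_right)
  have 3: "bilinearQ (\<lambda>(a\<^sub>1::'a) b\<^sub>1. tensor_lift (\<lambda>a\<^sub>2 b\<^sub>2. (a\<^sub>1 \<otimes> a\<^sub>2) \<otimes> (b\<^sub>1 * b\<^sub>2)) t)" for t :: "'a \<otimes> 'a"
    by (intro bilinearQ_tensor_lift 1 2)
  have "bilinearQ (\<lambda>s (t :: 'a \<otimes> 'a). tensor_lift
      (\<lambda>(a\<^sub>1::'a) b\<^sub>1. tensor_lift (\<lambda>a\<^sub>2 b\<^sub>2. (a\<^sub>1 \<otimes> a\<^sub>2) \<otimes> (b\<^sub>1 * b\<^sub>2)) t) s)"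
    unfolding bilinearQ_def
  proof (intro conjI allI linearQ_tensor_lift)
    fix s :: "'a \<otimes> 'a"
    show "linearQ (\<lambda>t :: 'a \<otimes> 'a. tensor_lift
        (\<lambda>(a\<^sub>1::'a) b\<^sub>1. tensor_lift (\<lambda>a\<^sub>2 b\<^sub>2. (a\<^sub>1 \<otimes> a\<^sub>2) \<otimes> (b\<^sub>1 * b\<^sub>2)) t) s)"
    proof (induction s)
      case (tens x y)
      show ?case by (simp only: tensor_lift_tens[OF 3] linearQ_tensor_lift)
    next
      case (add s t)
      then show ?case by (simp add: linearQ_iff tensor_lift_add[of _ s t] scaleQ_add_right add_ac)
    qed
  qed
  then show ?thesis
    by (simp add: m_1_3_24_def tensor_lift_tens 1 3)
qed

definition cointeraction ::
  "('a::rat_algebra_1 \<Rightarrow> 'a \<otimes> 'a) \<Rightarrow> ('a \<Rightarrow> rat) \<Rightarrow> ('a \<Rightarrow> 'a \<otimes> 'a) \<Rightarrow> bool" where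
  "cointeraction \<Delta> \<epsilon> \<delta> \<longleftrightarrow>
     \<delta> 1 = 1 \<otimes> 1 \<and>
     (\<forall>a b. \<delta> (a * b) = \<delta> a * \<delta> b) \<and>
     (\<forall>a. unit_left (tensor_map \<epsilon> id (\<delta> a)) = \<epsilon> a *\<^sub>Q 1) \<and>
     m_1_3_24 \<circ> tensor_map \<delta> \<delta> \<circ> \<Delta> = tensor_map \<Delta> id \<circ> \<delta>"


section \<open>Quasi-symmetric functions\<close>

definition cons_word :: "nat \<Rightarrow> (nat list \<Rightarrow>\<^sub>0 rat) \<Rightarrow> nat list \<Rightarrow>\<^sub>0 rat"
  where "cons_word a = lin_ext (\<lambda>w. Poly_Mapping.single (a # w) 1)"

fun quasi_shuffle :: "nat list \<Rightarrow> nat list \<Rightarrow> nat list \<Rightarrow>\<^sub>0 rat" where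
  "quasi_shuffle [] v = Poly_Mapping.single v 1"
| "quasi_shuffle (a # u) [] = Poly_Mapping.single (a # u) 1"
| "quasi_shuffle (a # u) (b # v) =
     cons_word a (quasi_shuffle u (b # v)) +
     cons_word b (quasi_shuffle (a # u) v) +
     cons_word (a + b) (quasi_shuffle u v)"

definition quasi_shuffle_ext ::
  "(nat list \<Rightarrow>\<^sub>0 rat) \<Rightarrow> (nat list \<Rightarrow>\<^sub>0 rat) \<Rightarrow> nat list \<Rightarrow>\<^sub>0 rat" (infixl \<open>\<star>\<close> 70)
  where "p \<star> q = lin_ext (\<lambda>u. lin_ext (\<lambda>v. quasi_shuffle u v) q) p"

lemma cons_word_simps [simp]:
  "cons_word a (Poly_Mapping.single w 1) = Poly_Mapping.single (a # w) 1"
  "cons_word a (p + q) = cons_word a p + cons_word a q"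
  "cons_word a (c *\<^sub>Q p) = c *\<^sub>Q cons_word a p"
  by (simp_all add: cons_word_def)

lemma star_single [simp]: "Poly_Mapping.single u 1 \<star> Poly_Mapping.single v 1 = quasi_shuffle u v"
  by (simp add: quasi_shuffle_ext_def)

lemma star_add_left: "(p + p') \<star> q = p \<star> q + p' \<star> q"
  and star_scale_left: "(c *\<^sub>Q p) \<star> q = c *\<^sub>Q (p \<star> q)"
  by (simp_all add: quasi_shuffle_ext_def)

lemma star_add_right: "p \<star> (q + q') = p \<star> q + p \<star> q'"
  and star_scale_right: "p \<star> (c *\<^sub>Q q) = c *\<^sub>Q (p \<star> q)"
  by (simp_all add: quasi_shuffle_ext_def lin_ext_fun_add lin_ext_fun_scale)

lemmas star_simps = star_add_left star_scale_left star_add_right star_scale_right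

lemma star_bilinear_eqI:
  assumes "\<And>q. linearQ (\<lambda>p. F p q)" "\<And>p. linearQ (F p)" "\<And>q. linearQ (\<lambda>p. G p q)" "\<And>p. linearQ (G p)"
    and "\<And>u v. F (Poly_Mapping.single u 1) (Poly_Mapping.single v 1)
             = G (Poly_Mapping.single u 1) (Poly_Mapping.single v 1)"
  shows "F (p :: 'b \<Rightarrow>\<^sub>0 rat) (q :: 'c \<Rightarrow>\<^sub>0 rat) = G p q"
proof -
  have *: "F (Poly_Mapping.single u 1) q = G (Poly_Mapping.single u 1) q" for u
    by (rule linearQ_free_eq) (fact assms)+
  show ?thesis
    by (rule linearQ_free_eq[of "\<lambda>p. F p q" "\<lambda>p. G p q"]) (fact assms *)+
qed

lemma cons_star_cons:
  "cons_word a p \<star> cons_word b q =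
     cons_word a (p \<star> cons_word b q) + cons_word b (cons_word a p \<star> q) + cons_word (a + b) (p \<star> q)"
  by (rule star_bilinear_eqI)
    (simp_all add: linearQ_iff star_simps Q.scale_right_distrib add_ac)

lemma star_Nil_left: "Poly_Mapping.single [] 1 \<star> p = p"
  by (rule linearQ_free_eq) (simp_all add: linearQ_iff star_simps)

lemma quasi_shuffle_Nil_right [simp]: "quasi_shuffle u [] = Poly_Mapping.single u 1"
  by (cases u) simp_all

lemma star_Nil_right: "p \<star> Poly_Mapping.single [] 1 = p"
  by (rule linearQ_free_eq[of "\<lambda>p. p \<star> _" "\<lambda>p. p"]) (simp_all add: linearQ_iff star_simps)

lemma star_assoc_single:
  "(Poly_Mapping.single u 1 \<star> Poly_Mapping.single v 1) \<star> Poly_Mapping.single w 1 =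
   Poly_Mapping.single u 1 \<star> (Poly_Mapping.single v 1 \<star> Poly_Mapping.single w 1)"
proof (induction "length u + length v + length w" arbitrary: u v w rule: less_induct)
  case less
  show ?case
  proof (cases "u = [] \<or> v = [] \<or> w = []")
    case True
    then show ?thesis by (auto simp: star_Nil_left star_Nil_right simp del: star_single)
  next
    case False
    then obtain a u' b v' c w' where eq: "u = a # u'" "v = b # v'" "w = c # w'"
      by (meson neq_Nil_conv)
    let ?S = "\<lambda>u. Poly_Mapping.single u (1::rat)"
    define p q r where "p = ?S u'" and "q = ?S v'" and "r = ?S w'"
    define P Q R where "P = cons_word a p" and "Q = cons_word b q" and "R = cons_word c r"
    have PQR: "?S u = P" "?S v = Q" "?S w = R"
      by (simp_all add: eq p_def q_def r_def P_def Q_def R_def)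
    have IH: "(p \<star> Q) \<star> R = p \<star> (Q \<star> R)" "(p \<star> Q) \<star> r = p \<star> (Q \<star> r)"
      "(P \<star> q) \<star> R = P \<star> (q \<star> R)" "(P \<star> q) \<star> r = P \<star> (q \<star> r)"
      "(p \<star> q) \<star> R = p \<star> (q \<star> R)" "(p \<star> q) \<star> r = p \<star> (q \<star> r)"
      "(P \<star> Q) \<star> r = P \<star> (Q \<star> r)"
      unfolding p_def q_def r_def PQR[symmetric]
      by (rule less; simp add: eq)+
    have PQ: "P \<star> Q = cons_word a (p \<star> Q) + cons_word b (P \<star> q) + cons_word (a + b) (p \<star> q)"
      unfolding P_def Q_def by (rule cons_star_cons)
    have QR: "Q \<star> R = cons_word b (q \<star> R) + cons_word c (Q \<star> r) + cons_word (b + c) (q \<star> r)"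
      unfolding Q_def R_def by (rule cons_star_cons)
    have cR: "cons_word d x \<star> R
        = cons_word d (x \<star> R) + cons_word c (cons_word d x \<star> r) + cons_word (d + c) (x \<star> r)" for d x
      unfolding R_def by (rule cons_star_cons)
    have Pc: "P \<star> cons_word d x
        = cons_word a (p \<star> cons_word d x) + cons_word d (P \<star> x) + cons_word (a + d) (p \<star> x)" for d x
      unfolding P_def by (rule cons_star_cons)
    have "(P \<star> Q) \<star> R =
        cons_word a ((p \<star> Q) \<star> R) + cons_word b ((P \<star> q) \<star> R) + cons_word (a + b) ((p \<star> q) \<star> R)
      + cons_word c ((P \<star> Q) \<star> r)
      + cons_word (a + c) ((p \<star> Q) \<star> r) + cons_word (b + c) ((P \<star> q) \<star> r) + cons_word (a + b + c) ((p \<star> q) \<star> r)"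
      by (subst (1 2) PQ) (simp add: star_simps cR)
    also have "\<dots> = P \<star> (Q \<star> R)"
      unfolding IH by (simp add: star_simps Pc QR add_ac)
    finally show ?thesis unfolding PQR .
  qed
qed

lemma star_assoc: "(p \<star> q) \<star> r = p \<star> (q \<star> r)"
proof -
  have *: "(p \<star> q) \<star> Poly_Mapping.single w 1 = p \<star> (q \<star> Poly_Mapping.single w 1)" for w
    by (rule star_bilinear_eqI[where F = "\<lambda>p q. (p \<star> q) \<star> _"])
      (simp_all only: linearQ_iff star_simps star_assoc_single simp_thms)
  show ?thesis
    by (rule linearQ_free_eq[of "\<lambda>r. (p \<star> q) \<star> r" "\<lambda>r. p \<star> (q \<star> r)"])
      (simp_all only: linearQ_iff star_simps * simp_thms)
qed

lemma keys_lin_ext: "Poly_Mapping.keys (lin_ext f p) \<subseteq> (\<Union>b\<in>Poly_Mapping.keys p. Poly_Mapping.keys (f b))"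
proof
  fix k assume "k \<in> Poly_Mapping.keys (lin_ext f p)"
  then obtain b where "b \<in> Poly_Mapping.keys p" "k \<in> Poly_Mapping.keys (Poly_Mapping.lookup p b *\<^sub>Q f b)"
    unfolding lin_ext_def using Poly_Mapping.keys_sum by fast
  then show "k \<in> (\<Union>b\<in>Poly_Mapping.keys p. Poly_Mapping.keys (f b))"
    by (auto simp: in_keys_iff)
qed

lemma keys_quasi_shuffle:
  "0 \<notin> set u \<Longrightarrow> 0 \<notin> set v \<Longrightarrow> w \<in> Poly_Mapping.keys (quasi_shuffle u v) \<Longrightarrow> 0 \<notin> set w"
proof (induction u v arbitrary: w rule: quasi_shuffle.induct)
  case (3 a u b v)
  have cons: "\<exists>w'\<in>Poly_Mapping.keys p. w = d # w'" if "w \<in> Poly_Mapping.keys (cons_word d p)" for d p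
    using subsetD[OF keys_lin_ext that[unfolded cons_word_def]] by simp
  have "w \<in> Poly_Mapping.keys (cons_word a (quasi_shuffle u (b # v)))
      \<or> w \<in> Poly_Mapping.keys (cons_word b (quasi_shuffle (a # u) v))
      \<or> w \<in> Poly_Mapping.keys (cons_word (a + b) (quasi_shuffle u v))"
    using 3(6) unfolding quasi_shuffle.simps by (auto dest!: subsetD[OF Poly_Mapping.keys_add])
  then show ?case
  proof (elim disjE)
    assume "w \<in> Poly_Mapping.keys (cons_word a (quasi_shuffle u (b # v)))"
    from cons[OF this] 3(1) 3(4,5) show ?case by auto
  next
    assume "w \<in> Poly_Mapping.keys (cons_word b (quasi_shuffle (a # u) v))"
    from cons[OF this] 3(2) 3(4,5) show ?case by auto
  next
    assume "w \<in> Poly_Mapping.keys (cons_word (a + b) (quasi_shuffle u v))"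
    from cons[OF this] 3(3) 3(4,5) show ?case by auto
  qed
qed (auto split: if_splits)

lemma keys_star:
  assumes "\<forall>u\<in>Poly_Mapping.keys p. 0 \<notin> set u" "\<forall>u\<in>Poly_Mapping.keys q. 0 \<notin> set u"
  shows "\<forall>u\<in>Poly_Mapping.keys (p \<star> q). 0 \<notin> set u"
proof
  fix w assume "w \<in> Poly_Mapping.keys (p \<star> q)"
  then obtain u where u: "u \<in> Poly_Mapping.keys p" "w \<in> Poly_Mapping.keys (lin_ext (quasi_shuffle u) q)"
    unfolding quasi_shuffle_ext_def using keys_lin_ext by fast
  then obtain v where "v \<in> Poly_Mapping.keys q" "w \<in> Poly_Mapping.keys (quasi_shuffle u v)"
    using keys_lin_ext by fast
  with u assms show "0 \<notin> set w"
    using keys_quasi_shuffle by blast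
qed

text \<open>Compositions are the lists of natural numbers without zero letter.\<close>
typedef qsym = "{p :: nat list \<Rightarrow>\<^sub>0 rat. \<forall>u\<in>Poly_Mapping.keys p. 0 \<notin> set u}"
  by (rule exI[of _ 0]) simp

setup_lifting type_definition_qsym

instantiation qsym :: rat_algebra_1
begin

lift_definition zero_qsym :: qsym is 0 by simp
lift_definition one_qsym :: qsym is "Poly_Mapping.single [] 1" by simp
lift_definition plus_qsym :: "qsym \<Rightarrow> qsym \<Rightarrow> qsym" is "(+)"
  by (auto dest!: subsetD[OF Poly_Mapping.keys_add])
lift_definition uminus_qsym :: "qsym \<Rightarrow> qsym" is uminus
  by simp
lift_definition minus_qsym :: "qsym \<Rightarrow> qsym \<Rightarrow> qsym" is "(-)"
  by (auto dest!: subsetD[OF Poly_Mapping.keys_diff])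
lift_definition scaleQ_qsym :: "rat \<Rightarrow> qsym \<Rightarrow> qsym" is "(*\<^sub>Q)"
  by (auto simp: in_keys_iff)
lift_definition times_qsym :: "qsym \<Rightarrow> qsym \<Rightarrow> qsym" is "(\<star>)"
  by (rule bspec[OF keys_star]) auto

instance
proof
  show "(0::qsym) \<noteq> 1"
    by transfer (metis keys_single keys_zero insert_not_empty one_neq_zero)
qed (transfer; simp add: scaleQ_add_right scaleQ_add_left scaleQ_scaleQ scaleQ_one star_simps
      star_assoc star_Nil_left star_Nil_right)+

end

lift_definition M_qsym :: "nat list \<Rightarrow> qsym"
  is "\<lambda>u. if 0 \<in> set u then 0 else Poly_Mapping.single u 1"
  by (auto split: if_splits)

definition qsym_ext :: "(nat list \<Rightarrow> 'c::rat_vector) \<Rightarrow> qsym \<Rightarrow> 'c"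
  where "qsym_ext f p = lin_ext f (Rep_qsym p)"

lemma linearQ_qsym_ext: "linearQ (qsym_ext f)"
  by (simp add: linearQ_iff qsym_ext_def plus_qsym.rep_eq scaleQ_qsym.rep_eq)

lemma qsym_ext_M: "0 \<notin> set u \<Longrightarrow> qsym_ext f (M_qsym u) = f u"
  by (simp add: qsym_ext_def M_qsym.rep_eq scaleQ_one)

definition qsym_grading :: "nat \<Rightarrow> qsym set"
  where "qsym_grading n = Q.span {M_qsym u | u. 0 \<notin> set u \<and> sum_list u = n}"

definition qsym_Delta :: "qsym \<Rightarrow> qsym \<otimes> qsym"
  where "qsym_Delta = qsym_ext (\<lambda>w. \<Sum>(u, v) | u @ v = w. M_qsym u \<otimes> M_qsym v)"

definition qsym_counit :: "qsym \<Rightarrow> rat"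
  where "qsym_counit = qsym_ext (\<lambda>u. if u = [] then 1 else 0)"

definition factorizations :: "nat list \<Rightarrow> nat list list set"
  where "factorizations w = {ws. concat ws = w \<and> [] \<notin> set ws}"

text \<open>For \<open>w = []\<close> the only factorization is the empty one, and the sum is \<open>1 \<otimes> 1\<close>.\<close>
definition qsym_delta :: "qsym \<Rightarrow> qsym \<otimes> qsym"
  where "qsym_delta = qsym_ext (\<lambda>w. \<Sum>ws\<in>factorizations w.
           M_qsym (map sum_list ws) \<otimes> prod_list (map M_qsym ws))"

definition qsym_counit' :: "qsym \<Rightarrow> rat"
  where "qsym_counit' = qsym_ext (\<lambda>u. if length u \<le> 1 then 1 else 0)"

lemma finite_deconcatenations: "finite {(u, v). u @ v = w}"
proof -
  have "{(u, v). u @ v = w} \<subseteq> (\<lambda>i. (take i w, drop i w)) ` {..length w}"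
    by clarify (rule_tac x = "length a" in image_eqI; simp)
  then show ?thesis by (rule finite_subset) simp
qed

lemma finite_factorizations: "finite (factorizations w)"
proof -
  have len: "length ws \<le> length (concat ws)" if "[] \<notin> set ws" for ws :: "nat list list"
    using that
  proof (induction ws)
    case (Cons v ws)
    then show ?case by (cases v) auto
  qed simp
  have "factorizations w \<subseteq> {ws. set ws \<subseteq> {v. set v \<subseteq> set w \<and> length v \<le> length w} \<and> length ws \<le> length w}"
    using len by (auto simp: factorizations_def length_concat member_le_sum_list)
  moreover have "finite {ws. set ws \<subseteq> {v. set v \<subseteq> set w \<and> length v \<le> length w} \<and> length ws \<le> length w}"
    by (intro finite_lists_length_le finite_set)
  ultimately show ?thesis by (rule finite_subset)
qed

text \<open>
  The realization of \<open>M\<^sub>u\<close> in the variables \<open>x\<^sub>m, \<dots>, x\<^bsub>N-1\<^esub>\<close>, and the compatibility of the product of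
  \<^typ>\<open>qsym\<close> with the product of power series.
\<close>
fun monomial_quasisym :: "(nat \<Rightarrow> 'b::{rat_algebra_1,comm_ring_1}) \<Rightarrow> nat \<Rightarrow> nat \<Rightarrow> nat list \<Rightarrow> 'b" where
  "monomial_quasisym x N m [] = 1"
| "monomial_quasisym x N m (a # u) = (\<Sum>i=m..<N. x i ^ a * monomial_quasisym x N (Suc i) u)"

lemma monomial_quasisym_Cons_if:
  "monomial_quasisym x N m (a # u) =
     (if m < N then x m ^ a * monomial_quasisym x N (Suc m) u + monomial_quasisym x N (Suc m) (a # u) else 0)"
  by (simp add: sum.atLeast_Suc_lessThan)

lemma lin_ext_monomial_cons_word:
  "lin_ext (monomial_quasisym x N m) (cons_word a p) =
     (if m < N then x m ^ a * lin_ext (monomial_quasisym x N (Suc m)) p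
        + lin_ext (monomial_quasisym x N (Suc m)) (cons_word a p) else 0)"
  by (rule linearQ_free_eq[where f = "\<lambda>p. lin_ext (monomial_quasisym x N m) (cons_word a p)"])
    (simp_all add: linearQ_iff scaleQ_one algebra_simps scaleQ_mult_right scaleQ_add_right
      monomial_quasisym_Cons_if[of x N m] del: monomial_quasisym.simps(2))

lemma lin_ext_monomial_quasi_shuffle:
  "lin_ext (monomial_quasisym x N m) (quasi_shuffle u v) =
     monomial_quasisym x N m u * monomial_quasisym x N m v"
proof (induction "N - m" arbitrary: m u v)
  case 0
  then show ?case
    by (cases u; cases v) (simp_all add: scaleQ_one lin_ext_monomial_cons_word)
next
  case (Suc k)
  then have m: "m < N" and IH: "lin_ext (monomial_quasisym x N (Suc m)) (quasi_shuffle u v)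
      = monomial_quasisym x N (Suc m) u * monomial_quasisym x N (Suc m) v" for u v
    by auto
  show ?case
  proof (cases "u = [] \<or> v = []")
    case True
    then show ?thesis by (auto simp: scaleQ_one)
  next
    case False
    then obtain a u' b v' where eq: "u = a # u'" "v = b # v'"
      by (meson neq_Nil_conv)
    show ?thesis
      using m IH[of u v]
      by (simp add: eq lin_ext_monomial_cons_word IH monomial_quasisym_Cons_if[of x N m]
          algebra_simps power_add del: monomial_quasisym.simps(2))
  qed
qed

lemma monomial_quasisym_mult:
  "qsym_ext (monomial_quasisym x N m) (p * q) =
     qsym_ext (monomial_quasisym x N m) p * qsym_ext (monomial_quasisym x N m) q"
  unfolding qsym_ext_def times_qsym.rep_eq
  by (rule star_bilinear_eqI[where F = "\<lambda>p q. lin_ext _ (p \<star> q)" and G = "\<lambda>p q. lin_ext _ p * lin_ext _ q"])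
    (simp_all add: linearQ_iff star_simps algebra_simps scaleQ_mult_left scaleQ_mult_right
      scaleQ_one lin_ext_monomial_quasi_shuffle)


section \<open>The double bialgebra of polynomials and the map from QSym to it\<close>

text \<open>Substitution; \<open>poly_subst b\<close> is the algebra morphism that maps \<open>X\<close> to \<open>b\<close>.\<close>
definition poly_subst :: "'b::rat_algebra_1 \<Rightarrow> rat poly \<Rightarrow> 'b"
  where "poly_subst b p = (\<Sum>i\<le>degree p. coeff p i *\<^sub>Q b ^ i)"

definition poly_Delta :: "rat poly \<Rightarrow> rat poly \<otimes> rat poly"
  where "poly_Delta = poly_subst ([:0, 1:] \<otimes> 1 + 1 \<otimes> [:0, 1:])"

definition poly_counit :: "rat poly \<Rightarrow> rat"
  where "poly_counit p = poly p 0"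

definition poly_delta :: "rat poly \<Rightarrow> rat poly \<otimes> rat poly"
  where "poly_delta = poly_subst ([:0, 1:] \<otimes> [:0, 1:])"

definition poly_counit' :: "rat poly \<Rightarrow> rat"
  where "poly_counit' p = poly p 1"

definition H_qsym :: "qsym \<Rightarrow> rat poly"
  where "H_qsym = qsym_ext (\<lambda>u. smult (1 / fact (length u)) (\<Prod>i<length u. [:- of_nat i, 1:]))"


section \<open>The morphism to QSym attached to a character\<close>

text \<open>
  \<open>\<Phi>\<^sub>\<alpha>\<close>, the unique homogeneous morphism of Hopf algebras with \<open>\<epsilon>'\<^bsub>QSym\<^esub> \<circ> \<Phi>\<^sub>\<alpha> = \<alpha>\<close>. It exists
  by the theorem of Aguiar, Bergeron and Sottile if the Hopf algebra is graded connected and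
  \<open>\<alpha>\<close> is a character.
\<close>
definition Phi ::
  "(nat \<Rightarrow> 'a::rat_algebra_1 set) \<Rightarrow> ('a \<Rightarrow> 'a \<otimes> 'a) \<Rightarrow> ('a \<Rightarrow> rat) \<Rightarrow> ('a \<Rightarrow> rat) \<Rightarrow> 'a \<Rightarrow> qsym" where
  "Phi A \<Delta> \<epsilon> \<alpha> = (THE \<Phi>. homogeneous A qsym_grading \<Phi> \<and>
     bialgebra_morphism \<Delta> \<epsilon> qsym_Delta qsym_counit \<Phi> \<and> qsym_counit' \<circ> \<Phi> = \<alpha>)"

definition linear_kernel :: "('a::rat_vector \<Rightarrow> 'b::rat_vector) \<Rightarrow> 'a set"
  where "linear_kernel f = {x. f x = 0}"

definition char_action ::
  "('a::rat_vector \<Rightarrow> 'a \<otimes> 'a) \<Rightarrow> ('a \<Rightarrow> 'b::rat_vector) \<Rightarrow> ('a \<Rightarrow> rat) \<Rightarrow> 'a \<Rightarrow> 'b"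
  where "char_action \<delta> f \<alpha> = unit_right \<circ> tensor_map f \<alpha> \<circ> \<delta>"

end

theory Submission
  imports Defs
begin

text \<open>
  For a linear map \<open>f\<close> from \<open>A\<close> to an algebra \<open>B\<close> and a word \<open>u = [u\<^sub>1, \<dots>, u\<^sub>k]\<close> let
  \<open>W f u\<close> be the convolution product, with respect to \<open>\<Delta>\<close>, of the maps \<open>f \<circ> \<pi>\<close>, where \<open>\<pi>\<close> runs
  through the projections onto the degrees \<open>u\<^sub>1, \<dots>, u\<^sub>k\<close>; for the empty word it is the convolution
  unit. The comparison of morphisms to QSym proceeds by recursion along the word \<open>u\<close>.

  \<^emph>\<open>The morphism of a character.\<close> The coefficient of \<open>M\<^sub>u\<close> in \<open>\<Phi>\<^sub>\<alpha>(a)\<close> is \<open>W \<alpha> u a\<close>. Deconcatenation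
  makes the coefficient functional of a word the convolution product of those of its letters, and on a
  homogeneous element of positive degree \<open>\<epsilon>'\<^bsub>QSym\<^esub>\<close> is the coefficient of a one-letter word; so
  every homogeneous coalgebra morphism over \<open>\<alpha>\<close> has these coefficients
  (\<open>coeff_homogeneous_morphism\<close>). Conversely they define a morphism
  (\<open>homogeneous_morphism_of_character\<close>). It is multiplicative because the product of QSym and
  \<open>W \<alpha> w (a * b)\<close> are governed by the same sum, over all ways to write \<open>w\<close> as a letterwise sum of
  two words of the same length in which zero letters may occur (\<open>coeff_qsym_mult\<close>, \<open>W_mult\<close>).

  \<^emph>\<open>Cointeraction.\<close> If \<open>f\<close> is an algebra morphism, cointeraction says that
  \<open>p \<mapsto> (p \<otimes> f) \<circ> \<delta>\<close> turns convolution products into convolution products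
  (\<open>conv_contraction\<close>). Hence, as soon as \<open>(\<epsilon>' \<circ> \<pi>\<^sub>c \<otimes> f) \<circ> \<delta> = f \<circ> \<pi>\<^sub>c\<close> for all \<open>c > 0\<close>, one has
  \<open>(W \<epsilon>' v \<otimes> f) \<circ> \<delta> = W f v\<close> for all compositions \<open>v\<close> (\<open>W_contraction\<close>). The conditions on
  \<open>\<delta>(A\<^sub>n)\<close> in the theorem provide this one-letter identity, for \<open>f = \<Phi>\<close> and for \<open>f = \<alpha>\<close>
  respectively (\<open>letter_contraction\<close>), where \<open>\<Phi>\<close> is the morphism of the character \<open>\<epsilon>'\<close>. For \<open>f = \<alpha>\<close> the
  result is the equality of all coefficients of \<open>\<Phi>\<^sub>\<alpha>\<close> and \<open>\<Phi> \<leftarrow> \<alpha>\<close>. For \<open>f = \<Phi>\<close> it computes the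
  coefficients, in the left factor, of \<open>(\<Phi> \<otimes> \<Phi>)(\<delta>(a))\<close>, and those of \<open>\<delta>\<^bsub>QSym\<^esub>(\<Phi>(a))\<close> satisfy
  the same recursion (\<open>coeff_left_delta_\<Phi>\<close>). Conversely \<open>\<delta>\<^bsub>QSym\<^esub>\<close> preserves the degree in the
  left factor, so that if \<open>\<Phi>\<close> is compatible with \<open>\<delta>\<close>, then for \<open>a\<close> of degree \<open>n\<close> the part of
  \<open>\<delta>(a)\<close> outside \<open>A\<^sub>n \<otimes> A\<close> is killed by \<open>\<Phi> \<otimes> \<Phi>\<close>; the kernel of a tensor product of linear
  maps is known (\<open>kernel_tensor_map\<close>).

  \<^emph>\<open>Polynomials.\<close> A coalgebra morphism \<open>\<phi>\<close> to \<open>\<rat>[X]\<close> is determined by the values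
  \<open>\<phi>(a)(1)\<close>, since the values at \<open>k + 1\<close> are obtained from those at \<open>1\<close> and \<open>k\<close>
  (\<open>poly_morphism_unique\<close>). The value of \<open>H(p)\<close> at \<open>k\<close> is the realization of \<open>p\<close> in \<open>k\<close> variables
  that are all equal to \<open>1\<close>, which makes \<open>H\<close> multiplicative; its compatibility with \<open>\<Delta>\<close> and
  \<open>\<delta>\<close> amounts to \<open>(1 + z)\<^sup>k (1 + z)\<^sup>l = (1 + z)\<^bsup>k+l\<^esup>\<close> and to
  \<open>((1 + z)\<^sup>l)\<^sup>k = (1 + z)\<^bsup>kl\<^esup>\<close>.
\<close>

section \<open>Linear maps on tensor products\<close>

lemma bilinearQI:
  assumes "\<And>x x' y. F (x + x') y = F x y + F x' y" "\<And>x y y'. F x (y + y') = F x y + F x y'"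
    and "\<And>c x y. F (c *\<^sub>Q x) y = c *\<^sub>Q F x y" "\<And>c x y. F x (c *\<^sub>Q y) = c *\<^sub>Q F x y"
  shows "bilinearQ F"
  using assms by (simp add: bilinearQ_def linearQ_iff)

lemma bilinearQ_simps:
  assumes "bilinearQ F"
  shows "F (x + x') y = F x y + F x' y" "F x (y + y') = F x y + F x y'"
    "F (c *\<^sub>Q x) y = c *\<^sub>Q F x y" "F x (c *\<^sub>Q y) = c *\<^sub>Q F x y"
    "F (x - x') y = F x y - F x' y" "F x (y - y') = F x y - F x y'"
    "F 0 y = 0" "F x 0 = 0"
  using assms linearQ_diff[of "\<lambda>x. F x y"] linearQ_diff[of "F x"]
    linearQ_zero[of "\<lambda>x. F x y"] linearQ_zero[of "F x"]
  by (auto simp: bilinearQ_def linearQ_iff)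

lemma bilinearQ_linear: "bilinearQ F \<Longrightarrow> linearQ (\<lambda>x. F x y)" "bilinearQ F \<Longrightarrow> linearQ (F x)"
  by (simp_all add: bilinearQ_def)

lemma linearQ_ident [intro]: "linearQ (\<lambda>x. x)" "linearQ id"
  by (simp_all add: linearQ_iff)

lemma linearQ_tensor_map: "linearQ (tensor_map f g)"
  unfolding tensor_map_def by (rule linearQ_tensor_lift)

lemma bilinearQ_mult: "linearQ f \<Longrightarrow> linearQ g \<Longrightarrow> bilinearQ (\<lambda>x y. f x * g y :: 'a::rat_algebra_1)"
  by (rule bilinearQI) (simp_all add: linearQ_iff algebra_simps scaleQ_mult_left scaleQ_mult_right)

lemma bilinearQ_scale: "linearQ f \<Longrightarrow> linearQ g \<Longrightarrow> bilinearQ (\<lambda>x y. f x *\<^sub>Q g y)"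
  by (rule bilinearQI) (simp_all add: linearQ_iff scaleQ_add_left scaleQ_add_right Q.scale_left_commute)

lemma bilinearQ_tens_linear: "linearQ f \<Longrightarrow> linearQ g \<Longrightarrow> bilinearQ (\<lambda>x y. f x \<otimes> g y)"
  by (rule bilinearQI)
    (simp_all add: linearQ_iff tens_add_left tens_add_right tens_scale_left tens_scale_right)

lemma bilinearQ_compose: "bilinearQ F \<Longrightarrow> linearQ f \<Longrightarrow> linearQ g \<Longrightarrow> bilinearQ (\<lambda>x y. F (f x) (g y))"
  by (rule bilinearQI) (simp_all add: linearQ_iff bilinearQ_simps)

lemma linearQ_bilinear: "linearQ h \<Longrightarrow> bilinearQ F \<Longrightarrow> bilinearQ (\<lambda>x y. h (F x y))"
  by (rule bilinearQI) (simp_all add: linearQ_iff bilinearQ_simps)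

lemma tensor_lift_map:
  assumes "bilinearQ F" "linearQ f" "linearQ g"
  shows "tensor_lift F (tensor_map f g t) = tensor_lift (\<lambda>x y. F (f x) (g y)) t"
  by (rule tensor_eqI[where t = t])
    (simp_all add: linearQ_compose linearQ_tensor_lift linearQ_tensor_map
      tensor_map_tens tensor_lift_tens bilinearQ_compose assms)

lemma linear_tensor_lift:
  assumes "linearQ h" "bilinearQ F"
  shows "h (tensor_lift F t) = tensor_lift (\<lambda>x y. h (F x y)) t"
  by (rule tensor_eqI[where t = t])
    (simp_all add: linearQ_compose linearQ_tensor_lift tensor_lift_tens linearQ_bilinear assms)

lemma tensor_map_map:
  assumes "linearQ f" "linearQ g" "linearQ f'" "linearQ g'"
  shows "tensor_map f' g' (tensor_map f g t) = tensor_map (\<lambda>x. f' (f x)) (\<lambda>y. g' (g y)) t"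
  unfolding tensor_map_def[of f' g'] tensor_map_def[of "\<lambda>x. f' (f x)"]
  by (rule tensor_lift_map) (simp_all add: bilinearQ_tens_linear assms)

text \<open>
  The form in which homogeneity of a coproduct is used: on tensors of bidegrees \<open>(i, n - i)\<close>, a
  bilinear map may be replaced by one that agrees with it on homogeneous vectors of these degrees.
\<close>
lemma tensor_lift_eq_on_span:
  assumes "bilinearQ F" "bilinearQ G" and eq: "\<And>i x y. i \<in> I \<Longrightarrow> x \<in> U i \<Longrightarrow> y \<in> V i \<Longrightarrow> F x y = G x y"
    and "t \<in> Q.span (\<Union>i\<in>I. tensor_set (U i) (V i))"
  shows "tensor_lift F t = tensor_lift G t"
proof -
  let ?S = "{t. tensor_lift F t = tensor_lift G t}"
  have sub: "Q.subspace ?S"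
    by (rule Q.subspaceI) (auto simp: tensor_lift_zero tensor_lift_add tensor_lift_scale)
  have "tensor_set (U i) (V i) \<subseteq> ?S" if "i \<in> I" for i
    unfolding tensor_set_def using eq that
    by (intro Q.span_minimal sub) (auto simp: tensor_lift_tens assms)
  then show ?thesis
    using Q.span_minimal[OF _ sub, of "\<Union>i\<in>I. tensor_set (U i) (V i)"] assms(4) by auto
qed

lemma tensor_lift_eq_on:
  assumes "bilinearQ F" "bilinearQ G" "\<And>x y. x \<in> U \<Longrightarrow> y \<in> V \<Longrightarrow> F x y = G x y" "t \<in> tensor_set U V"
  shows "tensor_lift F t = tensor_lift G t"
  by (rule tensor_lift_eq_on_span[where I = "{()}" and U = "\<lambda>_. U" and V = "\<lambda>_. V"])
    (use assms in \<open>auto simp: Q.span_base\<close>)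

lemma tensor_set_base: "x \<in> U \<Longrightarrow> y \<in> V \<Longrightarrow> x \<otimes> y \<in> tensor_set U V"
  unfolding tensor_set_def by (rule Q.span_base) blast

text \<open>
  A linear right inverse of \<open>f\<close> on its range; it exists because every subspace has a complement.
\<close>
lemma linear_generalized_inverse:
  assumes "linearQ (f :: 'a::rat_vector \<Rightarrow> 'b::rat_vector)"
  shows "\<exists>s. linearQ s \<and> (\<forall>x. f (s (f x)) = f x)"
proof -
  interpret P: vector_space_pair "scaleQ :: rat \<Rightarrow> 'a \<Rightarrow> 'a" "scaleQ :: rat \<Rightarrow> 'b \<Rightarrow> 'b"
    by unfold_locales
  show ?thesis
    using P.linear_exists_right_inverse_on[OF assms, of UNIV] by auto
qed

text \<open>
  With generalized inverses \<open>s\<close> of \<open>f\<close> and \<open>r\<close> of \<open>g\<close>, the map \<open>t - (s \<otimes> r) ((f \<otimes> g) t)\<close> is the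
  identity on the kernel of \<open>f \<otimes> g\<close>, and on a pure tensor it splits into one term with left
  factor \<open>x - s (f x)\<close> in the kernel of \<open>f\<close> and one with right factor \<open>y - r (g y)\<close> in the kernel
  of \<open>g\<close>.
\<close>
lemma kernel_tensor_map:
  assumes f: "linearQ f" and g: "linearQ g" and 0: "tensor_map f g t = 0"
  shows "t \<in> tensor_set (linear_kernel f) UNIV + tensor_set UNIV (linear_kernel g)"
proof -
  obtain s r where s: "linearQ s" "\<And>x. f (s (f x)) = f x" and r: "linearQ r" "\<And>x. g (r (g x)) = g x"
    using linear_generalized_inverse[OF f] linear_generalized_inverse[OF g] by metis
  let ?K = "tensor_set (linear_kernel f) UNIV + tensor_set UNIV (linear_kernel g)"
  have "t - tensor_map s r (tensor_map f g t) \<in> ?K" for t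
  proof (induction t)
    case (tens x y)
    have eq: "x \<otimes> y - s (f x) \<otimes> r (g y) = (x - s (f x)) \<otimes> y + s (f x) \<otimes> (y - r (g y))"
      by (simp add: bilinearQ_simps[OF bilinearQ_tens])
    show ?case
      unfolding tensor_map_tens[OF f g] tensor_map_tens[OF s(1) r(1)] eq
      by (intro set_plus_intro tensor_set_base) (simp_all add: linear_kernel_def linearQ_diff f g s r)
  next
    case (add t u)
    have "Q.subspace ?K"
      unfolding tensor_set_def
      by (rule back_subst[of Q.subspace, OF Q.subspace_sums[OF Q.subspace_span Q.subspace_span]])
        (auto simp: set_plus_def)
    from Q.subspace_add[OF this add] show ?case
      by (simp add: linearQ_add linearQ_tensor_map algebra_simps)
  qed
  from this[of t] show ?thesis by (simp add: 0 linearQ_zero linearQ_tensor_map)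
qed

text \<open>
  Both equalities of tensors over QSym and of tensors over polynomials are checked with functionals
  of the form \<open>f \<otimes> g\<close>. To see that separating families suffice, expand \<open>t\<close> along a basis of the
  left factor. Applying \<open>id \<otimes> g\<close> to \<open>t\<close> gives a vector killed by all \<open>f\<close>, hence zero; thus the
  coordinates of \<open>t\<close>, which are vectors of the right factor, are killed by all \<open>g\<close>.
\<close>
lemma tensor_separation:
  fixes t :: "'a::rat_vector \<otimes> 'b::rat_vector"
  assumes F: "\<And>f. f \<in> F \<Longrightarrow> linearQ f" "\<And>x. (\<And>f. f \<in> F \<Longrightarrow> f x = (0::rat)) \<Longrightarrow> x = 0"
    and G: "\<And>g. g \<in> G \<Longrightarrow> linearQ g" "\<And>y. (\<And>g. g \<in> G \<Longrightarrow> g y = (0::rat)) \<Longrightarrow> y = 0"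
    and 0: "\<And>f g. f \<in> F \<Longrightarrow> g \<in> G \<Longrightarrow> tensor_lift (\<lambda>x y. f x * g y) t = 0"
  shows "t = 0"
proof -
  (* any basis of the left factor; c b is the b-th coordinate, l b t the coefficient of b in t *)
  define B :: "'a set" where "B = Q.extend_basis {}"
  have B: "Q.independent B" "Q.span B = UNIV"
    unfolding B_def using Q.independent_extend_basis Q.span_extend_basis Q.independent_empty by auto
  define c where "c b x = Q.representation B x b" for b x
  have c: "linearQ (c b)" for b
    unfolding c_def by (rule linearQI) (simp_all add: Q.representation_add Q.representation_scale B)
  have fin: "finite {b. c b x \<noteq> 0}" and expand: "(\<Sum>b | c b x \<noteq> 0. c b x *\<^sub>Q b) = x" for x
    unfolding c_def using Q.finite_representation Q.sum_nonzero_representation_eq[OF B(1)] B(2) by auto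
  define l where "l b = tensor_lift (\<lambda>x y. c b x *\<^sub>Q (y :: 'b))" for b
  have l: "linearQ (l b)" and l_tens: "l b (x \<otimes> y) = c b x *\<^sub>Q y" for b x y
    unfolding l_def by (simp_all add: linearQ_tensor_lift tensor_lift_tens bilinearQ_scale c linearQ_ident)
  have sum: "\<exists>S. finite S \<and> t = (\<Sum>b\<in>S. b \<otimes> l b t) \<and> (\<forall>b. b \<notin> S \<longrightarrow> l b t = 0)" for t
  proof (induction t)
    case (tens x y)
    let ?S = "{b. c b x \<noteq> 0}"
    have "(\<Sum>b\<in>?S. b \<otimes> l b (x \<otimes> y)) = (\<Sum>b\<in>?S. c b x *\<^sub>Q b) \<otimes> y"
      by (subst linearQ_sum[of "\<lambda>x. x \<otimes> y"])
        (use bilinearQ_tens in \<open>auto simp: l_tens bilinearQ_def tens_scale_left tens_scale_right\<close>)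
    then show ?case
      using fin by (intro exI[of _ ?S]) (auto simp: expand l_tens)
  next
    case (add s t)
    then obtain S T where S: "finite S" "s = (\<Sum>b\<in>S. b \<otimes> l b s)" "\<And>b. b \<notin> S \<Longrightarrow> l b s = 0"
      and T: "finite T" "t = (\<Sum>b\<in>T. b \<otimes> l b t)" "\<And>b. b \<notin> T \<Longrightarrow> l b t = 0"
      by blast
    have "(\<Sum>b\<in>S. b \<otimes> l b s) = (\<Sum>b\<in>S \<union> T. b \<otimes> l b s)"
      by (rule sum.mono_neutral_left) (auto simp: S(1,3) T(1,3) bilinearQ_simps[OF bilinearQ_tens])
    moreover have "(\<Sum>b\<in>T. b \<otimes> l b t) = (\<Sum>b\<in>S \<union> T. b \<otimes> l b t)"
      by (rule sum.mono_neutral_left) (auto simp: S(1,3) T(1,3) bilinearQ_simps[OF bilinearQ_tens])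
    ultimately have "s + t = (\<Sum>b\<in>S \<union> T. b \<otimes> l b s) + (\<Sum>b\<in>S \<union> T. b \<otimes> l b t)"
      using S(2) T(2) by argo
    also have "\<dots> = (\<Sum>b\<in>S \<union> T. b \<otimes> l b (s + t))"
      by (simp add: linearQ_add[OF l] tens_add_right sum.distrib)
    finally have "s + t = (\<Sum>b\<in>S \<union> T. b \<otimes> l b (s + t))" .
    moreover have "\<forall>b. b \<notin> S \<union> T \<longrightarrow> l b (s + t) = 0"
      by (simp add: linearQ_add[OF l] S(3) T(3))
    ultimately show ?case
      using finite_UnI[OF S(1) T(1)] by blast
  qed
  have "l b t = 0" for b
  proof (rule G(2))
    fix g assume g: "g \<in> G"
    define r where "r = tensor_lift (\<lambda>(x :: 'a) y. g y *\<^sub>Q x) t"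
    have bil: "bilinearQ (\<lambda>(x :: 'a) y. g y *\<^sub>Q x)"
      using G(1)[OF g] by (intro bilinearQI) (simp_all add: linearQ_iff scaleQ_add_left scaleQ_add_right Q.scale_left_commute)
    have "r = 0"
    proof (rule F(2))
      fix f assume f: "f \<in> F"
      show "f r = 0"
        unfolding r_def linear_tensor_lift[OF F(1)[OF f] bil]
        using 0[OF f g] by (simp add: linearQ_scale[OF F(1)[OF f]] mult.commute)
    qed
    have "g (l b t) = tensor_lift (\<lambda>x y. c b x * g y) t"
      unfolding l_def by (subst linear_tensor_lift)
        (simp_all add: G(1)[OF g] bilinearQ_scale c linearQ_ident linearQ_scale[OF G(1)[OF g]])
    also have "\<dots> = c b r"
      unfolding r_def by (subst linear_tensor_lift[OF c bil]) (simp add: linearQ_scale[OF c] mult.commute)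
    finally show "g (l b t) = 0" by (simp add: \<open>r = 0\<close> linearQ_zero[OF c])
  qed
  then show "t = 0"
    using sum[of t] by (metis (no_types, lifting) bilinearQ_simps(8)[OF bilinearQ_tens] sum.neutral)
qed

section \<open>Convolution\<close>

definition conv :: "('a::rat_vector \<Rightarrow> 'a \<otimes> 'a) \<Rightarrow> ('a \<Rightarrow> 'b::rat_algebra_1) \<Rightarrow> ('a \<Rightarrow> 'b) \<Rightarrow> 'a \<Rightarrow> 'b"
  where "conv \<Delta> f g a = tensor_lift (\<lambda>x y. f x * g y) (\<Delta> a)"

lemma linearQ_conv: "linearQ \<Delta> \<Longrightarrow> linearQ (conv \<Delta> f g)"
  unfolding conv_def by (rule linearQ_compose[OF linearQ_tensor_lift])

lemma conv_assoc:
  assumes co: "coalgebra \<Delta> \<epsilon>" and f: "linearQ f" and g: "linearQ g" and h: "linearQ h"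
  shows "conv \<Delta> (conv \<Delta> f g) h a = conv \<Delta> f (conv \<Delta> g h) a"
proof -
  have \<Delta>: "linearQ \<Delta>" and assoc: "tensor_assoc (tensor_map \<Delta> id (\<Delta> a)) = tensor_map id \<Delta> (\<Delta> a)"
    using co unfolding coalgebra_def by (auto simp: fun_eq_iff)
  define G where "G = tensor_lift (\<lambda>y z. g y * h z)"
  define F where "F = tensor_lift (\<lambda>x y. f x * g y)"
  have lin: "linearQ G" "linearQ F"
    unfolding G_def F_def by (simp_all add: linearQ_tensor_lift)
  have tens: "G (y \<otimes> z) = g y * h z" "F (x \<otimes> y) = f x * g y" for x y z
    unfolding G_def F_def by (simp_all add: tensor_lift_tens bilinearQ_mult f g h)
  have bil: "bilinearQ (\<lambda>x s. f x * G s)" "bilinearQ (\<lambda>s z. F s * h z)"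
    by (simp_all add: bilinearQ_mult lin f h)
  have lin_assoc: "linearQ tensor_assoc"
    unfolding tensor_assoc_def by (rule linearQ_tensor_lift)
  have pure: "tensor_lift (\<lambda>x s. f x * G s) (tensor_assoc (s \<otimes> z)) = F s * h z" for s z
  proof (rule tensor_eqI[where t = s])
    show "linearQ (\<lambda>s. tensor_lift (\<lambda>x s. f x * G s) (tensor_assoc (s \<otimes> z)))"
      by (rule linearQ_compose[OF linearQ_tensor_lift linearQ_compose[OF lin_assoc
            bilinearQ_linear(1)[OF bilinearQ_tens]]])
    show "linearQ (\<lambda>s. F s * h z)"
      by (rule bilinearQ_linear(1)[OF bil(2)])
    show "tensor_lift (\<lambda>x s. f x * G s) (tensor_assoc ((x \<otimes> y) \<otimes> z)) = F (x \<otimes> y) * h z" for x y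
      by (simp only: tensor_assoc_tens tensor_lift_tens[OF bil(1)] tens mult.assoc)
  qed
  have "tensor_lift (\<lambda>x s. f x * G s) (tensor_assoc t) = tensor_lift (\<lambda>s z. F s * h z) t" for t
    by (rule tensor_eqI[where t = t])
      (simp_all add: linearQ_compose[OF linearQ_tensor_lift lin_assoc] linearQ_tensor_lift tensor_lift_tens bil pure)
  from this[of "tensor_map \<Delta> id (\<Delta> a)"] show ?thesis
    unfolding assoc tensor_lift_map[OF bil(1) linearQ_ident(2) \<Delta>] tensor_lift_map[OF bil(2) \<Delta> linearQ_ident(2)]
    by (simp add: conv_def F_def G_def)
qed

lemma conv_counit_left:
  assumes co: "coalgebra \<Delta> \<epsilon>" and g: "linearQ g"
  shows "conv \<Delta> (\<lambda>x. \<epsilon> x *\<^sub>Q 1) g a = g a"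
proof -
  have \<epsilon>: "linearQ \<epsilon>" and unit: "unit_left (tensor_map \<epsilon> id (\<Delta> a)) = a"
    using co unfolding coalgebra_def by (auto simp: fun_eq_iff)
  have bil: "bilinearQ (\<lambda>c x. c *\<^sub>Q x)"
    by (rule bilinearQ_scale) auto
  have "a = tensor_lift (\<lambda>x y. \<epsilon> x *\<^sub>Q y) (\<Delta> a)"
    using unit unfolding unit_left_def tensor_lift_map[OF bil \<epsilon> linearQ_ident(2)] by simp
  also have "g \<dots> = conv \<Delta> (\<lambda>x. \<epsilon> x *\<^sub>Q 1) g a"
    unfolding conv_def
    by (subst linear_tensor_lift[OF g bilinearQ_scale[OF \<epsilon> linearQ_ident(1)]])
      (simp add: linearQ_scale[OF g] scaleQ_mult_left)
  finally show ?thesis by simp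
qed

lemma conv_counit_right:
  assumes co: "coalgebra \<Delta> \<epsilon>" and g: "linearQ g"
  shows "conv \<Delta> g (\<lambda>x. \<epsilon> x *\<^sub>Q 1) a = g a"
proof -
  have \<epsilon>: "linearQ \<epsilon>" and unit: "unit_right (tensor_map id \<epsilon> (\<Delta> a)) = a"
    using co unfolding coalgebra_def by (auto simp: fun_eq_iff)
  have bil: "bilinearQ (\<lambda>x c. c *\<^sub>Q x)"
    by (rule bilinearQI) (simp_all add: scaleQ_add_left scaleQ_add_right scaleQ_scaleQ mult.commute)
  have bil': "bilinearQ (\<lambda>x y. \<epsilon> y *\<^sub>Q x)"
    using bilinearQ_compose[OF bil linearQ_ident(1) \<epsilon>] .
  have "a = tensor_lift (\<lambda>x y. \<epsilon> y *\<^sub>Q x) (\<Delta> a)"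
    using unit unfolding unit_right_def tensor_lift_map[OF bil linearQ_ident(2) \<epsilon>] by simp
  also have "g \<dots> = conv \<Delta> g (\<lambda>x. \<epsilon> x *\<^sub>Q 1) a"
    unfolding conv_def
    by (subst linear_tensor_lift[OF g bil']) (auto simp: linearQ_scale[OF g] scaleQ_mult_right)
  finally show ?thesis by simp
qed

section \<open>Homogeneous components of a direct sum\<close>

definition component :: "(nat \<Rightarrow> 'a::rat_vector set) \<Rightarrow> nat \<Rightarrow> 'a \<Rightarrow> 'a" where
  "component A n a =
     (THE f. (\<forall>n. f n \<in> A n) \<and> finite {n. f n \<noteq> 0} \<and> a = (\<Sum>n | f n \<noteq> 0. f n)) n"

text \<open>
  The set \<open>S\<close> may be larger than the support of \<open>f\<close>, so that the components of a sum can be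
  computed over the union of the supports of the summands.
\<close>
lemma component_unique:
  assumes A: "direct_sum_decomposition A" and f: "\<And>n. f n \<in> A n"
    and S: "finite S" "\<And>n. n \<notin> S \<Longrightarrow> f n = 0" and a: "a = (\<Sum>n\<in>S. f n)"
  shows "component A n a = f n"
proof -
  have "(\<Sum>n | f n \<noteq> 0. f n) = a"
    unfolding a by (rule sum.mono_neutral_left) (use S in auto)
  moreover have "finite {n. f n \<noteq> 0}"
    by (rule finite_subset[OF _ S(1)]) (use S in auto)
  ultimately have "(THE f. (\<forall>n. f n \<in> A n) \<and> finite {n. f n \<noteq> 0} \<and> a = (\<Sum>n | f n \<noteq> 0. f n)) = f"
    using A f unfolding direct_sum_decomposition_def by (intro the1_equality) auto
  then show ?thesis by (simp add: component_def)
qed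

lemma component_props:
  assumes A: "direct_sum_decomposition A"
  shows component_in: "component A n a \<in> A n"
    and finite_component: "finite {n. component A n a \<noteq> 0}"
    and sum_component: "(\<Sum>n | component A n a \<noteq> 0. component A n a) = a"
proof -
  let ?P = "\<lambda>f. (\<forall>n. f n \<in> A n) \<and> finite {n. f n \<noteq> 0} \<and> a = (\<Sum>n | f n \<noteq> 0. f n)"
  have "\<exists>!f. ?P f"
    using A unfolding direct_sum_decomposition_def by blast
  from theI'[OF this] have "?P (\<lambda>n. component A n a)"
    unfolding component_def by simp
  then show "component A n a \<in> A n" "finite {n. component A n a \<noteq> 0}"
    "(\<Sum>n | component A n a \<noteq> 0. component A n a) = a"
    by auto
qed

lemma subspace_degree: "direct_sum_decomposition A \<Longrightarrow> Q.subspace (A n)"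
  by (simp add: direct_sum_decomposition_def)

lemma component_homogeneous:
  assumes A: "direct_sum_decomposition A" and "a \<in> A m"
  shows "component A n a = (if n = m then a else 0)"
  by (rule component_unique[OF A, of _ "{m}"])
    (use assms Q.subspace_0[OF subspace_degree[OF A]] in auto)

lemma linearQ_component:
  assumes A: "direct_sum_decomposition A"
  shows "linearQ (component A n)"
proof (rule linearQI)
  fix x y :: 'a and c :: rat
  note sub = subspace_degree[OF A]
  let ?c = "component A"
  let ?S = "{n. ?c n x \<noteq> 0}" and ?T = "{n. ?c n y \<noteq> 0}"
  have fin: "finite ?S" "finite ?T" by (simp_all add: finite_component A)
  have "x = (\<Sum>n\<in>?S \<union> ?T. ?c n x)" "y = (\<Sum>n\<in>?S \<union> ?T. ?c n y)"
    by (subst sum_component[OF A, symmetric], rule sum.mono_neutral_left; use fin in auto)+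
  then have "x + y = (\<Sum>n\<in>?S \<union> ?T. ?c n x + ?c n y)"
    by (simp add: sum.distrib)
  then show "?c n (x + y) = ?c n x + ?c n y"
    by (intro component_unique[OF A, of _ "?S \<union> ?T"])
      (auto simp: fin Q.subspace_add[OF sub] component_in[OF A])
  have "c *\<^sub>Q x = (\<Sum>n\<in>?S. c *\<^sub>Q ?c n x)"
    by (simp add: sum_component[OF A] flip: Q.scale_sum_right)
  then show "?c n (c *\<^sub>Q x) = c *\<^sub>Q ?c n x"
    by (intro component_unique[OF A, of _ ?S])
      (auto simp: fin Q.subspace_scale[OF sub] component_in[OF A])
qed

lemma linear_eq_on_degrees:
  assumes A: "direct_sum_decomposition A" and "linearQ f" "linearQ g"
    and "\<And>n x. x \<in> A n \<Longrightarrow> f x = g x"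
  shows "f a = g a"
proof -
  have "f a = (\<Sum>n | component A n a \<noteq> 0. f (component A n a))"
    by (simp add: sum_component[OF A] flip: linearQ_sum[OF assms(2)])
  also have "\<dots> = (\<Sum>n | component A n a \<noteq> 0. g (component A n a))"
    by (rule sum.cong) (auto intro: assms(4) component_in[OF A])
  also have "\<dots> = g a"
    by (simp add: sum_component[OF A] flip: linearQ_sum[OF assms(3)])
  finally show ?thesis .
qed

section \<open>Coefficients of quasi-symmetric functions\<close>

definition coeff_qsym :: "nat list \<Rightarrow> qsym \<Rightarrow> rat"
  where "coeff_qsym u p = Poly_Mapping.lookup (Rep_qsym p) u"

lemma linearQ_coeff_qsym: "linearQ (coeff_qsym u)"
  by (simp add: linearQ_iff coeff_qsym_def plus_qsym.rep_eq scaleQ_qsym.rep_eq lookup_add)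

lemma coeff_qsym_zero_letter: "0 \<in> set u \<Longrightarrow> coeff_qsym u p = 0"
  using Rep_qsym[of p] by (auto simp: coeff_qsym_def in_keys_iff)

lemma qsym_eqI: "(\<And>u. 0 \<notin> set u \<Longrightarrow> coeff_qsym u p = coeff_qsym u q) \<Longrightarrow> p = q"
  by (metis Rep_qsym_inject coeff_qsym_def coeff_qsym_zero_letter poly_mapping_eqI)

lemma coeff_qsym_M: "0 \<notin> set w \<Longrightarrow> coeff_qsym u (M_qsym w) = (if u = w then 1 else 0)"
  by (auto simp: coeff_qsym_def M_qsym.rep_eq lookup_single when_def)

lemma finite_coeff_qsym: "finite {u. coeff_qsym u p \<noteq> 0}"
  by (simp add: coeff_qsym_def)

lemma qsym_expand:
  assumes "finite S" "\<And>u. u \<notin> S \<Longrightarrow> coeff_qsym u p = 0"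
  shows "p = (\<Sum>u\<in>S. coeff_qsym u p *\<^sub>Q M_qsym u)"
proof (rule qsym_eqI)
  fix v :: "nat list" assume v: "0 \<notin> set v"
  have "coeff_qsym v (\<Sum>u\<in>S. coeff_qsym u p *\<^sub>Q M_qsym u)
      = (\<Sum>u\<in>S. coeff_qsym u p * coeff_qsym v (M_qsym u))"
    by (simp add: linearQ_sum[OF linearQ_coeff_qsym] linearQ_scale[OF linearQ_coeff_qsym])
  also have "\<dots> = (\<Sum>u\<in>S. if u = v then coeff_qsym u p else 0)"
    by (rule sum.cong) (use v coeff_qsym_zero_letter in \<open>auto simp: coeff_qsym_M\<close>,
       metis coeff_qsym_M coeff_qsym_zero_letter)
  also have "\<dots> = coeff_qsym v p"
    using assms by simp
  finally show "coeff_qsym v p = coeff_qsym v (\<Sum>u\<in>S. coeff_qsym u p *\<^sub>Q M_qsym u)" by simp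
qed

lemma linear_qsym_eqI:
  assumes "linearQ f" "linearQ g" "\<And>u. 0 \<notin> set u \<Longrightarrow> f (M_qsym u) = g (M_qsym u)"
  shows "f p = g p"
proof -
  let ?S = "{u. coeff_qsym u p \<noteq> 0}"
  have p: "p = (\<Sum>u\<in>?S. coeff_qsym u p *\<^sub>Q M_qsym u)"
    by (rule qsym_expand) (auto simp: finite_coeff_qsym)
  have "h p = (\<Sum>u\<in>?S. coeff_qsym u p *\<^sub>Q h (M_qsym u))" if "linearQ h" for h :: "qsym \<Rightarrow> 'a"
    by (subst p) (simp add: linearQ_sum linearQ_scale that)
  moreover have "(\<Sum>u\<in>?S. coeff_qsym u p *\<^sub>Q f (M_qsym u)) = (\<Sum>u\<in>?S. coeff_qsym u p *\<^sub>Q g (M_qsym u))"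
    by (rule sum.cong) (use assms(3) coeff_qsym_zero_letter in \<open>auto intro!: arg_cong[of _ _ "scaleQ _"]\<close>)
  ultimately show ?thesis using assms(1,2) by simp
qed

lemma bilinear_qsym_eqI:
  assumes "bilinearQ F" "bilinearQ G"
    and "\<And>u v. 0 \<notin> set u \<Longrightarrow> 0 \<notin> set v \<Longrightarrow> F (M_qsym u) (M_qsym v) = G (M_qsym u) (M_qsym v)"
  shows "F p q = G p q"
proof -
  have "F (M_qsym u) q = G (M_qsym u) q" if "0 \<notin> set u" for u
    by (rule linear_qsym_eqI[of "F (M_qsym u)"]) (use assms that in \<open>auto simp: bilinearQ_def\<close>)
  then show ?thesis
    using linear_qsym_eqI[OF bilinearQ_linear(1)[OF assms(1)] bilinearQ_linear(1)[OF assms(2)]] by blast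
qed

lemma qsym_tensor_eqI:
  assumes "\<And>u v. 0 \<notin> set u \<Longrightarrow> 0 \<notin> set v \<Longrightarrow>
    tensor_lift (\<lambda>x y. coeff_qsym u x * coeff_qsym v y) s = tensor_lift (\<lambda>x y. coeff_qsym u x * coeff_qsym v y) t"
  shows "s = t"
proof -
  let ?F = "coeff_qsym ` {u. 0 \<notin> set u}"
  have sep: "x = 0" if "\<And>f. f \<in> ?F \<Longrightarrow> f x = 0" for x
    by (rule qsym_eqI) (use that in \<open>auto simp: linearQ_zero[OF linearQ_coeff_qsym]\<close>)
  have "s - t = 0"
    by (rule tensor_separation[of ?F ?F])
      (use assms sep in \<open>auto simp: linearQ_coeff_qsym linearQ_diff[OF linearQ_tensor_lift]\<close>)
  then show ?thesis by simp
qed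

lemma qsym_counit_eq_coeff: "qsym_counit = coeff_qsym []"
proof
  fix p show "qsym_counit p = coeff_qsym [] p"
    unfolding qsym_counit_def
    by (rule linear_qsym_eqI[OF linearQ_qsym_ext linearQ_coeff_qsym])
      (auto simp: qsym_ext_M coeff_qsym_M)
qed

text \<open>
  Deconcatenation is dual to concatenation of words. Read as \<open>coeff (c # u) = coeff [c] * coeff u\<close>
  (a convolution product), this is the recursion that identifies the coefficients of a morphism
  to QSym.
\<close>
lemma coeff_qsym_append:
  assumes "0 \<notin> set u" "0 \<notin> set v"
  shows "tensor_lift (\<lambda>x y. coeff_qsym u x * coeff_qsym v y) (qsym_Delta p) = coeff_qsym (u @ v) p"
proof (rule linear_qsym_eqI[OF linearQ_compose[OF linearQ_tensor_lift] linearQ_coeff_qsym])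
  show "linearQ qsym_Delta" unfolding qsym_Delta_def by (rule linearQ_qsym_ext)
  fix w :: "nat list" assume w: "0 \<notin> set w"
  have "tensor_lift (\<lambda>x y. coeff_qsym u x * coeff_qsym v y) (qsym_Delta (M_qsym w))
      = (\<Sum>(x, y) | x @ y = w. coeff_qsym u (M_qsym x) * coeff_qsym v (M_qsym y))"
    unfolding qsym_Delta_def qsym_ext_M[OF w] linearQ_sum[OF linearQ_tensor_lift]
    by (rule sum.cong) (auto simp: tensor_lift_tens bilinearQ_mult linearQ_coeff_qsym)
  also have "\<dots> = (\<Sum>s | fst s @ snd s = w. if s = (u, v) then 1 else 0)"
    using w by (intro sum.cong) (auto simp: coeff_qsym_M split: if_splits)
  also have "\<dots> = coeff_qsym (u @ v) (M_qsym w)"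
    using finite_deconcatenations[of w] w by (simp add: coeff_qsym_M case_prod_unfold)
  finally show "tensor_lift (\<lambda>x y. coeff_qsym u x * coeff_qsym v y) (qsym_Delta (M_qsym w)) = coeff_qsym (u @ v) (M_qsym w)" .
qed

lemma coeff_qsym_grading:
  assumes "p \<in> qsym_grading n" "sum_list u \<noteq> n"
  shows "coeff_qsym u p = 0"
proof -
  have "Q.subspace {p. coeff_qsym u p = 0}"
    by (rule Q.subspaceI)
      (auto simp: linearQ_zero[OF linearQ_coeff_qsym] linearQ_add[OF linearQ_coeff_qsym]
        linearQ_scale[OF linearQ_coeff_qsym])
  then have "qsym_grading n \<subseteq> {p. coeff_qsym u p = 0}"
    unfolding qsym_grading_def
    by (rule Q.span_minimal[rotated]) (use assms(2) in \<open>auto simp: coeff_qsym_M\<close>)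
  with assms(1) show ?thesis by auto
qed

lemma qsym_gradingI:
  assumes "\<And>u. 0 \<notin> set u \<Longrightarrow> sum_list u \<noteq> n \<Longrightarrow> coeff_qsym u p = 0"
  shows "p \<in> qsym_grading n"
proof -
  let ?S = "{u. coeff_qsym u p \<noteq> 0}"
  have "p = (\<Sum>u\<in>?S. coeff_qsym u p *\<^sub>Q M_qsym u)"
    by (rule qsym_expand) (auto simp: finite_coeff_qsym)
  also have "\<dots> \<in> qsym_grading n"
    unfolding qsym_grading_def
    by (intro Q.span_sum Q.span_scale Q.span_base) (use assms coeff_qsym_zero_letter in blast)
  finally show ?thesis .
qed

text \<open>
  \<open>\<epsilon>'\<close> is the sum of the coefficients of the words of length at most one, and in degree \<open>n > 0\<close>
  the only such word is \<open>[n]\<close>.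
\<close>
lemma qsym_counit'_grading:
  assumes p: "p \<in> qsym_grading n" and n: "n > 0"
  shows "qsym_counit' p = coeff_qsym [n] p"
proof -
  let ?S = "{p. qsym_counit' p = coeff_qsym [n] p}"
  have lin: "linearQ qsym_counit'"
    unfolding qsym_counit'_def by (rule linearQ_qsym_ext)
  have sub: "Q.subspace ?S"
    by (rule Q.subspaceI)
      (auto simp: linearQ_zero linearQ_add linearQ_scale lin linearQ_coeff_qsym)
  have "qsym_grading n \<subseteq> ?S"
    unfolding qsym_grading_def
  proof (rule Q.span_minimal[OF _ sub], clarify)
    fix u :: "nat list" assume u: "0 \<notin> set u" "n = sum_list u"
    have "length u \<le> 1 \<longleftrightarrow> [sum_list u] = u"
      using n u(2) by (cases u; cases "tl u") auto
    then show "qsym_counit' (M_qsym u) = coeff_qsym [sum_list u] (M_qsym u)"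
      using u(1) by (simp add: qsym_counit'_def qsym_ext_M coeff_qsym_M)
  qed
  with p show ?thesis by auto
qed

section \<open>Coefficients of a product of quasi-symmetric functions\<close>

text \<open>
  The sum of \<open>F u v\<close> over all pairs of words of the length of \<open>w\<close> whose letterwise sum is \<open>w\<close>.
  Zero letters occur in \<open>u\<close> and \<open>v\<close>: deleting them turns such a pair into a way in which the
  quasi-shuffles of two compositions produce \<open>w\<close>.
\<close>
fun split_sum :: "nat list \<Rightarrow> (nat list \<Rightarrow> nat list \<Rightarrow> 'b::rat_vector) \<Rightarrow> 'b" where
  "split_sum [] F = F [] []"
| "split_sum (c # w) F = (\<Sum>i\<le>c. split_sum w (\<lambda>u v. F (i # u) ((c - i) # v)))"

lemma split_sum_0 [simp]: "split_sum w (\<lambda>u v. 0) = 0"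
  by (induction w) simp_all

lemma split_sum_add: "split_sum w (\<lambda>u v. F u v + G u v) = split_sum w F + split_sum w G"
  by (induction w arbitrary: F G) (simp_all add: sum.distrib)

lemma split_sum_scale: "split_sum w (\<lambda>u v. c *\<^sub>Q F u v) = c *\<^sub>Q split_sum w F"
  by (induction w arbitrary: F) (simp_all add: Q.scale_sum_right)

lemma lookup_cons_word:
  "Poly_Mapping.lookup (cons_word a p) (c # w) = (if a = c then Poly_Mapping.lookup p w else 0)"
  "Poly_Mapping.lookup (cons_word a p) [] = 0"
proof -
  show "Poly_Mapping.lookup (cons_word a p) (c # w) = (if a = c then Poly_Mapping.lookup p w else 0)"
    by (rule linearQ_free_eq) (auto simp: linearQ_iff lookup_add lookup_single when_def)
  show "Poly_Mapping.lookup (cons_word a p) [] = 0"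
    by (rule linearQ_free_eq[of "\<lambda>p. Poly_Mapping.lookup (cons_word a p) []" "\<lambda>_. 0"])
      (auto simp: linearQ_iff lookup_add lookup_single when_def)
qed

lemma sum_split_ends:
  fixes G :: "nat \<Rightarrow> 'b::comm_monoid_add"
  assumes "c > 0"
  shows "(\<Sum>i\<le>c. G i) = G 0 + G c + (\<Sum>i\<in>{0<..<c}. G i)"
proof -
  have "{..c} = {0, c} \<union> {0<..<c}" using assms by auto
  then show ?thesis using assms by (simp add: add.assoc)
qed

text \<open>
  A word \<open>w\<close> arises from a quasi-shuffle of \<open>x\<close> and \<open>y\<close> by assigning to each letter of \<open>w\<close> its part
  from \<open>x\<close> and its part from \<open>y\<close>, one of which may be zero. The three summands in the recursion of
  the quasi-shuffle correspond to a first letter \<open>c\<close> that is split as \<open>c + 0\<close>, as \<open>0 + c\<close> and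
  into two positive parts.
\<close>
lemma lookup_quasi_shuffle:
  assumes "0 \<notin> set w" "0 \<notin> set x" "0 \<notin> set y"
  shows "Poly_Mapping.lookup (quasi_shuffle x y) w =
    split_sum w (\<lambda>u v. if removeAll 0 u = x \<and> removeAll 0 v = y then 1 else 0)"
  using assms
proof (induction w arbitrary: x y)
  case Nil
  then show ?case
    by (cases x; cases y) (auto simp: lookup_add lookup_cons_word lookup_single when_def)
next
  case (Cons c w)
  then have c: "c > 0" and w: "0 \<notin> set w" by auto
  define R :: "nat list \<Rightarrow> nat list \<Rightarrow> rat" where "R x y =
    split_sum w (\<lambda>u v. if removeAll 0 u = x \<and> removeAll 0 v = y then 1 else 0)" for x y
  have R: "Poly_Mapping.lookup (quasi_shuffle x y) w = R x y" if "0 \<notin> set x" "0 \<notin> set y" for x y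
    unfolding R_def by (rule Cons.IH) (use w that in auto)
  have RHS: "split_sum (c # w) (\<lambda>u v. if removeAll 0 u = x \<and> removeAll 0 v = y then 1 else 0) =
    (case y of [] \<Rightarrow> 0 | b # y' \<Rightarrow> if b = c then R x y' else 0)
    + (case x of [] \<Rightarrow> 0 | a # x' \<Rightarrow> if a = c then R x' y else 0)
    + (case (x, y) of (a # x', b # y') \<Rightarrow> if a + b = c then R x' y' else 0 | _ \<Rightarrow> 0)" (is "?L = _")
  proof -
    have "?L = split_sum w (\<lambda>u v. if removeAll 0 u = x \<and> c # removeAll 0 v = y then 1 else 0)
      + split_sum w (\<lambda>u v. if c # removeAll 0 u = x \<and> removeAll 0 v = y then 1 else 0)
      + (\<Sum>i\<in>{0<..<c}. split_sum w (\<lambda>u v. if i # removeAll 0 u = x \<and> (c - i) # removeAll 0 v = y then 1 else 0))"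
    proof -
      have "split_sum w (\<lambda>u v. if removeAll 0 (i # u) = x \<and> removeAll 0 ((c - i) # v) = y then 1 else 0)
        = split_sum w (\<lambda>u v. if i # removeAll 0 u = x \<and> (c - i) # removeAll 0 v = y then 1 else 0)"
        if "i \<in> {0<..<c}" for i
        using that by simp
      then show ?thesis
        unfolding split_sum.simps sum_split_ends[OF c] using c by simp
    qed
    also have "split_sum w (\<lambda>u v. if removeAll 0 u = x \<and> c # removeAll 0 v = y then 1 else 0)
      = (case y of [] \<Rightarrow> 0 | b # y' \<Rightarrow> if b = c then R x y' else 0)"
      by (cases y) (auto simp: R_def)
    also have "split_sum w (\<lambda>u v. if c # removeAll 0 u = x \<and> removeAll 0 v = y then 1 else 0)
      = (case x of [] \<Rightarrow> 0 | a # x' \<Rightarrow> if a = c then R x' y else 0)"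
      by (cases x) (auto simp: R_def)
    also have "(\<Sum>i\<in>{0<..<c}. split_sum w (\<lambda>u v. if i # removeAll 0 u = x \<and> (c - i) # removeAll 0 v = y then 1 else 0))
      = (case (x, y) of (a # x', b # y') \<Rightarrow> if a + b = c then R x' y' else 0 | _ \<Rightarrow> 0)"
    proof (cases "x = [] \<or> y = []")
      case True
      then show ?thesis by (auto split: list.split)
    next
      case False
      then obtain a x' b y' where eq: "x = a # x'" "y = b # y'" by (meson neq_Nil_conv)
      have "(\<Sum>i\<in>{0<..<c}. split_sum w (\<lambda>u v. if i # removeAll 0 u = x \<and> (c - i) # removeAll 0 v = y then 1 else 0))
        = (\<Sum>i\<in>{0<..<c}. if i = a then (if a + b = c then R x' y' else 0) else (0::rat))"
      proof (rule sum.cong)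
        fix i assume "i \<in> {0<..<c}"
        then have "c - i = b \<longleftrightarrow> i + b = c" by auto
        then show "split_sum w (\<lambda>u v. if i # removeAll 0 u = x \<and> (c - i) # removeAll 0 v = y then 1 else 0)
          = (if i = a then (if a + b = c then R x' y' else 0) else (0::rat))"
          by (auto simp: eq R_def)
      qed simp
      also have "\<dots> = (if a + b = c then R x' y' else 0)"
        using Cons.prems by (auto simp: eq)
      finally show ?thesis by (simp add: eq)
    qed
    finally show ?thesis .
  qed
  show ?case
    unfolding RHS using Cons.prems
    by (cases x; cases y)
      (auto simp: lookup_add lookup_cons_word lookup_single when_def simp flip: R)
qed

lemma coeff_qsym_mult:
  assumes w: "0 \<notin> set w"
  shows "coeff_qsym w (p * q) =
    split_sum w (\<lambda>u v. coeff_qsym (removeAll 0 u) p * coeff_qsym (removeAll 0 v) q)"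
proof (rule bilinear_qsym_eqI[where F = "\<lambda>p q. coeff_qsym w (p * q)"])
  show "bilinearQ (\<lambda>p q. coeff_qsym w (p * q))"
    by (rule linearQ_bilinear[OF linearQ_coeff_qsym bilinearQ_mult[OF linearQ_ident(1) linearQ_ident(1)]])
  show "bilinearQ (\<lambda>p q. split_sum w (\<lambda>u v. coeff_qsym (removeAll 0 u) p * coeff_qsym (removeAll 0 v) q))"
    by (rule bilinearQI)
      (simp_all add: linearQ_add[OF linearQ_coeff_qsym] linearQ_scale[OF linearQ_coeff_qsym]
        algebra_simps split_sum_add split_sum_scale[where F = "F :: _ \<Rightarrow> _ \<Rightarrow> rat" for F, unfolded rat_scaleQ_eq])
  fix x y :: "nat list" assume xy: "0 \<notin> set x" "0 \<notin> set y"
  have "coeff_qsym w (M_qsym x * M_qsym y) = Poly_Mapping.lookup (quasi_shuffle x y) w"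
    by (simp add: coeff_qsym_def times_qsym.rep_eq M_qsym.rep_eq xy)
  also have "\<dots> = split_sum w (\<lambda>u v. coeff_qsym (removeAll 0 u) (M_qsym x) * coeff_qsym (removeAll 0 v) (M_qsym y))"
    unfolding lookup_quasi_shuffle[OF w xy]
    by (rule arg_cong[of _ _ "split_sum w"]) (auto simp: fun_eq_iff coeff_qsym_M xy)
  finally show "coeff_qsym w (M_qsym x * M_qsym y) =
    split_sum w (\<lambda>u v. coeff_qsym (removeAll 0 u) (M_qsym x) * coeff_qsym (removeAll 0 v) (M_qsym y))" .
qed

section \<open>Convolution products of letters\<close>

text \<open>
  For a nonempty word of length \<open>k\<close> this is, up to the multiplication of the target, the map
  \<open>f\<^bsup>\<otimes>k\<^esup> \<circ> (\<pi> \<otimes> \<dots> \<otimes> \<pi>) \<circ> \<Delta>\<^bsup>(k-1)\<^esup>\<close> in the formula of Aguiar, Bergeron and Sottile. Values in an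
  arbitrary algebra are needed because the left coefficients of the second coproduct of QSym are
  themselves in QSym.
\<close>
primrec conv_word ::
  "('a::rat_vector \<Rightarrow> 'a \<otimes> 'a) \<Rightarrow> ('a \<Rightarrow> rat) \<Rightarrow> (nat \<Rightarrow> 'a set) \<Rightarrow> ('a \<Rightarrow> 'b::rat_algebra_1)
    \<Rightarrow> nat list \<Rightarrow> 'a \<Rightarrow> 'b" where
  "conv_word \<Delta> \<epsilon> A f [] = (\<lambda>a. \<epsilon> a *\<^sub>Q 1)"
| "conv_word \<Delta> \<epsilon> A f (c # u) = conv \<Delta> (\<lambda>a. f (component A c a)) (conv_word \<Delta> \<epsilon> A f u)"

lemma tensor_lift_zero_fun [simp]: "tensor_lift (\<lambda>x y. 0) t = 0"
  by (induction t) (simp_all add: tensor_lift_add tensor_lift_tens bilinearQI)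

lemma algebra_morphism_linear: "algebra_morphism f \<Longrightarrow> linearQ f"
  by (simp add: algebra_morphism_def)

locale graded_connected_bialgebra =
  fixes \<Delta> :: "'a::rat_algebra_1 \<Rightarrow> 'a \<otimes> 'a" and \<epsilon> :: "'a \<Rightarrow> rat" and A :: "nat \<Rightarrow> 'a set"
  assumes bialgebra: "bialgebra \<Delta> \<epsilon>" and graded: "graded_connected A \<Delta>"
begin

abbreviation \<pi> :: "nat \<Rightarrow> 'a \<Rightarrow> 'a" where "\<pi> \<equiv> component A"
abbreviation W :: "('a \<Rightarrow> 'b::rat_algebra_1) \<Rightarrow> nat list \<Rightarrow> 'a \<Rightarrow> 'b" where "W \<equiv> conv_word \<Delta> \<epsilon> A"

lemma coalgebra: "coalgebra \<Delta> \<epsilon>"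
  and linear_\<Delta>: "linearQ \<Delta>" and \<Delta>_mult: "\<Delta> (a * b) = \<Delta> a * \<Delta> b"
  and linear_\<epsilon>: "linearQ \<epsilon>" and \<epsilon>_1: "\<epsilon> 1 = 1" and \<epsilon>_mult: "\<epsilon> (a * b) = \<epsilon> a * \<epsilon> b"
  using bialgebra by (auto simp: bialgebra_def algebra_morphism_def)

lemma decomposition: "direct_sum_decomposition A"
  and degree_mult: "x \<in> A i \<Longrightarrow> y \<in> A j \<Longrightarrow> x * y \<in> A (i + j)"
  and degree_\<Delta>: "a \<in> A n \<Longrightarrow> \<Delta> a \<in> Q.span (\<Union>i\<le>n. tensor_set (A i) (A (n - i)))"
  and degree_0: "A 0 = range (\<lambda>c. c *\<^sub>Q 1)"
  using graded unfolding graded_connected_def by blast+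

lemmas linear_\<pi> = linearQ_component[OF decomposition]
  and \<pi>_in = component_in[OF decomposition]
  and \<pi>_homogeneous = component_homogeneous[OF decomposition]
  and eq_on_degrees = linear_eq_on_degrees[OF decomposition]

lemma linear_letter: "linearQ f \<Longrightarrow> linearQ (\<lambda>a. f (\<pi> c a))"
  by (rule linearQ_compose[OF _ linear_\<pi>])

lemma linear_W: "linearQ (W f u)"
proof (cases u)
  case Nil
  with linear_\<epsilon> show ?thesis by (simp add: linearQ_iff scaleQ_add_left scaleQ_scaleQ)
next
  case (Cons c v)
  then show ?thesis by (simp add: linearQ_conv[OF linear_\<Delta>])
qed

lemma conv_cong_degree:
  assumes "linearQ f" "linearQ g" "linearQ f'" "linearQ g'" and a: "a \<in> A n"
    and "\<And>i x y. i \<le> n \<Longrightarrow> x \<in> A i \<Longrightarrow> y \<in> A (n - i) \<Longrightarrow> f x * g y = f' x * g' y"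
  shows "conv \<Delta> f g a = conv \<Delta> f' g' a"
  unfolding conv_def
  by (rule tensor_lift_eq_on_span[OF _ _ _ degree_\<Delta>[OF a]]) (simp_all add: bilinearQ_mult assms)

lemma conv_zero_degree:
  assumes "linearQ f" "linearQ g" and a: "a \<in> A n"
    and "\<And>i x y. i \<le> n \<Longrightarrow> x \<in> A i \<Longrightarrow> y \<in> A (n - i) \<Longrightarrow> f x * g y = 0"
  shows "conv \<Delta> f g a = 0"
proof -
  have "conv \<Delta> f g a = conv \<Delta> (\<lambda>_. 0) (\<lambda>_. 0) a"
    by (rule conv_cong_degree[OF assms(1,2) _ _ a]) (simp_all add: assms(4) linearQ_iff)
  then show ?thesis by (simp add: conv_def)
qed

text \<open>
  The counit of a graded coalgebra is homogeneous. In degree \<open>n > 0\<close>, the part of bidegree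
  \<open>(n, 0)\<close> of \<open>\<Delta> a\<close> is the only one that contributes to the degree-zero component of
  \<open>(\<epsilon> \<otimes> id) (\<Delta> a) = a\<close>, which vanishes; applying \<open>\<epsilon>\<close> also to the right factor leaves \<open>\<epsilon> a\<close>.
\<close>
lemma \<epsilon>_degree:
  assumes a: "a \<in> A n" and n: "n > 0"
  shows "\<epsilon> a = 0"
proof -
  let ?e = "\<lambda>a. \<epsilon> a *\<^sub>Q (1 :: 'a)"
  have lin: "linearQ ?e"
    using linear_\<epsilon> by (simp add: linearQ_iff scaleQ_add_left scaleQ_scaleQ)
  have "conv \<Delta> ?e (\<pi> 0) a = \<pi> 0 a"
    by (rule conv_counit_left[OF coalgebra linear_\<pi>])
  then have 0: "conv \<Delta> ?e (\<pi> 0) a = 0"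
    using n by (simp add: \<pi>_homogeneous[OF a])
  have "conv \<Delta> (\<lambda>a. ?e (\<pi> n a)) ?e a = conv \<Delta> (\<lambda>a. ?e a) (\<lambda>a. ?e (\<pi> 0 a)) a"
    by (rule conv_cong_degree[OF linear_letter[OF lin] lin lin linear_letter[OF lin] a])
      (auto simp: \<pi>_homogeneous linearQ_zero[OF linear_\<epsilon>])
  also have "\<dots> = ?e (conv \<Delta> ?e (\<pi> 0) a)"
    unfolding conv_def
    by (subst linear_tensor_lift[OF lin bilinearQ_mult[OF lin linear_\<pi>]])
      (simp add: \<epsilon>_mult linearQ_scale[OF linear_\<epsilon>] \<epsilon>_1 scaleQ_mult_left scaleQ_scaleQ)
  also have "\<dots> = 0" by (simp add: 0 linearQ_zero[OF linear_\<epsilon>])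
  finally have "?e (\<pi> n a) = 0"
    using conv_counit_right[OF coalgebra linear_letter[OF lin], of n a] by simp
  then show ?thesis
    by (simp add: \<pi>_homogeneous[OF a])
qed

lemma W_degree:
  assumes f: "linearQ f" and a: "a \<in> A n" and u: "sum_list u \<noteq> n"
  shows "W f u a = 0"
  using a u
proof (induction u arbitrary: a n)
  case Nil
  then show ?case by (simp add: \<epsilon>_degree)
next
  case (Cons c u)
  show ?case
    unfolding conv_word.simps
  proof (rule conv_zero_degree[OF linear_letter[OF f] linear_W Cons.prems(1)])
    fix i x y assume "i \<le> n" and x: "x \<in> A i" and y: "y \<in> A (n - i)"
    then show "f (\<pi> c x) * W f u y = 0"
      using Cons.IH[OF y] Cons.prems(2) by (auto simp: \<pi>_homogeneous[OF x] linearQ_zero[OF f])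
  qed
qed

lemma W_append:
  assumes f: "linearQ f"
  shows "W f (u @ v) a = conv \<Delta> (W f u) (W f v) a"
proof (induction u arbitrary: a)
  case Nil
  show ?case by (simp add: conv_counit_left[OF coalgebra linear_W])
next
  case (Cons c u)
  then have "W f (u @ v) = conv \<Delta> (W f u) (W f v)" by (simp add: fun_eq_iff)
  then show ?case
    by (simp add: conv_assoc[OF coalgebra linear_letter[OF f] linear_W linear_W])
qed

text \<open>
  Connectedness: a zero letter contributes the convolution unit, so zero letters may be deleted.
\<close>
lemma letter_0:
  fixes f :: "'a \<Rightarrow> 'b::rat_algebra_1"
  assumes f: "linearQ f" "f 1 = 1"
  shows "(\<lambda>a. f (\<pi> 0 a)) = (\<lambda>a. \<epsilon> a *\<^sub>Q 1)"
proof
  fix a show "f (\<pi> 0 a) = \<epsilon> a *\<^sub>Q 1"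
  proof (rule eq_on_degrees)
    show "linearQ (\<lambda>a. f (\<pi> 0 a))" by (rule linear_letter[OF f(1)])
    show "linearQ (\<lambda>a. \<epsilon> a *\<^sub>Q (1::'b))" using linear_W[of f "[]"] by simp
    fix n x assume x: "x \<in> A n"
    show "f (\<pi> 0 x) = \<epsilon> x *\<^sub>Q 1"
    proof (cases "n = 0")
      case True
      then obtain c where c: "x = c *\<^sub>Q 1" using x degree_0 by auto
      have "f (\<pi> 0 x) = f x"
        using True by (simp add: \<pi>_homogeneous[OF x])
      then show ?thesis
        by (simp add: c linearQ_scale[OF f(1)] linearQ_scale[OF linear_\<epsilon>] \<epsilon>_1 f(2))
    next
      case False
      with x show ?thesis by (simp add: \<pi>_homogeneous[OF x] linearQ_zero[OF f(1)] \<epsilon>_degree)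
    qed
  qed
qed

lemma W_removeAll_0:
  assumes f: "linearQ f" "f 1 = 1"
  shows "W f (removeAll 0 u) = W f u"
  by (induction u)
    (auto simp: letter_0[OF f] conv_counit_left[OF coalgebra linear_W])

lemma W_singleton: "linearQ f \<Longrightarrow> W f [c] a = f (\<pi> c a)"
  by (simp add: conv_counit_right[OF coalgebra linear_letter])

lemma \<pi>_mult: "\<pi> c (x * y) = (\<Sum>i\<le>c. \<pi> i x * \<pi> (c - i) y)"
proof -
  let ?G = "\<lambda>x y. \<Sum>i\<le>c. \<pi> i x * \<pi> (c - i) y"
  note lin = linearQ_add[OF linear_\<pi>] linearQ_scale[OF linear_\<pi>]
  have F: "linearQ (\<lambda>x. \<pi> c (x * y))" "linearQ (\<lambda>y. \<pi> c (x * y))" for x y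
    by (rule linearQI; simp add: algebra_simps lin scaleQ_mult_left scaleQ_mult_right)+
  have G: "linearQ (\<lambda>x. ?G x y)" "linearQ (\<lambda>y. ?G x y)" for x y
    by (rule linearQI; simp add: algebra_simps lin sum.distrib scaleQ_mult_left scaleQ_mult_right Q.scale_sum_right)+
  have hom: "\<pi> c (x * y) = ?G x y" if x: "x \<in> A m" and y: "y \<in> A n" for x y m n
  proof (cases "m \<le> c")
    case True
    have "?G x y = (\<Sum>i\<le>c. if i = m then x * \<pi> (c - m) y else 0)"
      by (rule sum.cong) (auto simp: \<pi>_homogeneous[OF x])
    also have "\<dots> = x * \<pi> (c - m) y" using True by simp
    also have "\<dots> = \<pi> c (x * y)"
      using True by (auto simp: \<pi>_homogeneous[OF y] \<pi>_homogeneous[OF degree_mult[OF x y]])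
    finally show ?thesis by simp
  next
    case False
    then have "?G x y = 0" by (intro sum.neutral) (auto simp: \<pi>_homogeneous[OF x])
    with False show ?thesis by (simp add: \<pi>_homogeneous[OF degree_mult[OF x y]])
  qed
  have "\<pi> c (x * y) = ?G x y" if x: "x \<in> A m" for x y m
    by (rule eq_on_degrees[OF F(2) G(2) hom[OF x]])
  then show ?thesis
    by (rule eq_on_degrees[OF F(1) G(1)])
qed

text \<open>
  Induction on \<open>w\<close>, using that \<open>\<Delta>\<close> and \<open>\<alpha>\<close> are multiplicative and that a component of degree
  \<open>c\<close> of a product is the sum over \<open>i\<close> of the products of the components of degrees \<open>i\<close> and
  \<open>c - i\<close>. Zero degrees occur, hence the zero letters in the words on the right.
\<close>
lemma W_mult:
  assumes \<alpha>: "character \<alpha>"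
  shows "W \<alpha> w (a * b) = split_sum w (\<lambda>u v. W \<alpha> u a * W \<alpha> v b)"
proof (induction w arbitrary: a b)
  case Nil
  show ?case by (simp add: \<epsilon>_mult)
next
  case (Cons c w)
  have lin: "linearQ \<alpha>" and mult: "\<alpha> (x * y) = \<alpha> x * \<alpha> y" for x y
    using \<alpha> by (auto simp: algebra_morphism_def)
  define T where "T d u t = tensor_lift (\<lambda>x y. \<alpha> (\<pi> d x) * W \<alpha> u y) t" for d u t
  have linT: "linearQ (T d u)" for d u
    unfolding T_def by (rule linearQ_tensor_lift)
  have T: "T d u (x \<otimes> y) = \<alpha> (\<pi> d x) * W \<alpha> u y" for d u x y
    unfolding T_def by (rule tensor_lift_tens[OF bilinearQ_mult[OF linear_letter[OF lin] linear_W]])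
  have WT: "W \<alpha> (d # u) x = T d u (\<Delta> x)" for d u x
    by (simp add: conv_def T_def)
  let ?G = "\<lambda>s t. \<Sum>i\<le>c. split_sum w (\<lambda>u v. T i u s * T (c - i) v t)"
  note linG = linearQ_add[OF linT] linearQ_scale[OF linT] algebra_simps split_sum_add sum.distrib
      split_sum_scale[where F = "F :: _ \<Rightarrow> _ \<Rightarrow> rat" for F, unfolded rat_scaleQ_eq] sum_distrib_left
  have pure: "T c w ((x \<otimes> y) * (x' \<otimes> y')) = ?G (x \<otimes> y) (x' \<otimes> y')" for x y x' y'
  proof -
    have "T c w ((x \<otimes> y) * (x' \<otimes> y')) = (\<Sum>i\<le>c. \<alpha> (\<pi> i x) * \<alpha> (\<pi> (c - i) x')) * split_sum w (\<lambda>u v. W \<alpha> u y * W \<alpha> v y')"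
      by (simp add: tens_mult_tens T \<pi>_mult linearQ_sum[OF lin] mult Cons.IH)
    also have "\<dots> = ?G (x \<otimes> y) (x' \<otimes> y')"
      unfolding T sum_distrib_right
      by (simp add: split_sum_scale[where F = "F :: _ \<Rightarrow> _ \<Rightarrow> rat" for F, unfolded rat_scaleQ_eq, symmetric] mult_ac)
    finally show ?thesis .
  qed
  have pure': "T c w ((x \<otimes> y) * t) = ?G (x \<otimes> y) t" for x y t
    by (rule tensor_eqI[where t = t, OF linearQ_compose[OF linT tensor_mult_linear(2)] _ pure])
      (rule linearQI; simp add: linG)
  have "T c w (s * t) = ?G s t" for s t
    by (rule tensor_eqI[where t = s, OF linearQ_compose[OF linT tensor_mult_linear(1)] _ pure'])
      (rule linearQI; simp add: linG)
  then show ?case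
    unfolding WT \<Delta>_mult split_sum.simps by simp
qed

end

section \<open>The morphism of a character\<close>

lemma finite_compositions: "finite {u :: nat list. 0 \<notin> set u \<and> sum_list u = n}"
proof -
  have len: "length u \<le> sum_list u" if "0 \<notin> set u" for u :: "nat list"
    using that by (induction u) auto
  have "{u. 0 \<notin> set u \<and> sum_list u = n} \<subseteq> {u. set u \<subseteq> {..n} \<and> length u \<le> n}"
    using len member_le_sum_list by auto
  then show ?thesis
    by (rule finite_subset) (simp add: finite_lists_length_le)
qed

lemma qsym_with_coeffs:
  assumes "finite {u. 0 \<notin> set u \<and> f u \<noteq> 0}"
  shows "\<exists>p. \<forall>u. 0 \<notin> set u \<longrightarrow> coeff_qsym u p = f u"
proof -
  let ?S = "{u. 0 \<notin> set u \<and> f u \<noteq> 0}"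
  have "coeff_qsym v (\<Sum>u\<in>?S. f u *\<^sub>Q M_qsym u) = f v" if v: "0 \<notin> set v" for v
  proof -
    have "coeff_qsym v (\<Sum>u\<in>?S. f u *\<^sub>Q M_qsym u) = (\<Sum>u\<in>?S. if u = v then f u else 0)"
      unfolding linearQ_sum[OF linearQ_coeff_qsym]
      by (rule sum.cong) (auto simp: linearQ_scale[OF linearQ_coeff_qsym] coeff_qsym_M)
    also have "\<dots> = f v"
      using assms v by simp
    finally show ?thesis .
  qed
  then show ?thesis by blast
qed

lemma linear_qsym_counit': "linearQ qsym_counit'"
  unfolding qsym_counit'_def by (rule linearQ_qsym_ext)

context graded_connected_bialgebra
begin

lemma finite_W_support:
  assumes "linearQ f"
  shows "finite {u. 0 \<notin> set u \<and> W f u a \<noteq> 0}"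
proof -
  let ?S = "{n. \<pi> n a \<noteq> 0}"
  have "W f u a = (\<Sum>n\<in>?S. W f u (\<pi> n a))" for u
    by (simp add: sum_component[OF decomposition] flip: linearQ_sum[OF linear_W])
  moreover have "(\<Sum>n\<in>?S. W f u (\<pi> n a)) = 0" if "sum_list u \<notin> ?S" for u
  proof (rule sum.neutral, rule ballI)
    fix n assume "n \<in> ?S"
    with that have "sum_list u \<noteq> n" by blast
    then show "W f u (\<pi> n a) = 0" by (rule W_degree[OF assms \<pi>_in])
  qed
  ultimately have "{u. 0 \<notin> set u \<and> W f u a \<noteq> 0} \<subseteq> (\<Union>n\<in>?S. {u. 0 \<notin> set u \<and> sum_list u = n})"
    by force
  then show ?thesis
    by (rule finite_subset) (auto intro: finite_compositions finite_component[OF decomposition])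
qed

text \<open>
  Uniqueness in the theorem of Aguiar, Bergeron and Sottile: the coefficient of
  a one-letter word \<open>[c]\<close> is found by applying \<open>\<epsilon>'\<^bsub>QSym\<^esub>\<close> to the component of degree \<open>c\<close>, and the
  longer words follow from compatibility with the coproducts.
\<close>
lemma coeff_homogeneous_morphism:
  assumes hom: "homogeneous A qsym_grading \<Phi>"
    and co: "coalgebra_morphism \<Delta> \<epsilon> qsym_Delta qsym_counit \<Phi>"
    and \<alpha>: "qsym_counit' \<circ> \<Phi> = \<alpha>"
    and u: "0 \<notin> set u"
  shows "coeff_qsym u (\<Phi> a) = W \<alpha> u a"
  using u
proof (induction u arbitrary: a)
  case Nil
  show ?case
    using co by (auto simp: coalgebra_morphism_def qsym_counit_eq_coeff fun_eq_iff)
next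
  case (Cons c u)
  have lin: "linearQ \<Phi>" and \<Delta>: "qsym_Delta (\<Phi> a) = tensor_map \<Phi> \<Phi> (\<Delta> a)"
    using co by (auto simp: coalgebra_morphism_def fun_eq_iff)
  have lin\<alpha>: "linearQ \<alpha>"
    unfolding \<alpha>[symmetric] comp_def by (rule linearQ_compose[OF linear_qsym_counit' lin])
  have letter: "coeff_qsym [c] (\<Phi> x) = \<alpha> (\<pi> c x)" for x
  proof (rule eq_on_degrees[OF linearQ_compose[OF linearQ_coeff_qsym lin] linear_letter[OF lin\<alpha>]])
    fix n x assume x: "x \<in> A n"
    then have \<Phi>: "\<Phi> x \<in> qsym_grading n" using hom by (auto simp: homogeneous_def)
    show "coeff_qsym [c] (\<Phi> x) = \<alpha> (\<pi> c x)"
    proof (cases "c = n")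
      case True
      then show ?thesis
        using Cons.prems qsym_counit'_grading[OF \<Phi>] x \<alpha> by (auto simp: \<pi>_homogeneous[OF x])
    next
      case False
      then show ?thesis
        using coeff_qsym_grading[OF \<Phi>, of "[c]"] by (simp add: \<pi>_homogeneous[OF x] linearQ_zero[OF lin\<alpha>])
    qed
  qed
  have "coeff_qsym (c # u) (\<Phi> a)
      = tensor_lift (\<lambda>x y. coeff_qsym [c] x * coeff_qsym u y) (tensor_map \<Phi> \<Phi> (\<Delta> a))"
    using coeff_qsym_append[of "[c]" u "\<Phi> a"] Cons.prems by (simp add: \<Delta>)
  also have "\<dots> = tensor_lift (\<lambda>x y. coeff_qsym [c] (\<Phi> x) * coeff_qsym u (\<Phi> y)) (\<Delta> a)"
    by (rule tensor_lift_map[OF bilinearQ_mult[OF linearQ_coeff_qsym linearQ_coeff_qsym] lin lin])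
  also have "\<dots> = W \<alpha> (c # u) a"
    using Cons by (simp add: letter conv_def)
  finally show ?case .
qed

text \<open>
  Existence in the theorem of Aguiar, Bergeron and Sottile. The coefficients \<open>W \<alpha> u a\<close> define an
  element of QSym because a homogeneous element has nonzero coefficients only at compositions of
  its degree.
\<close>
lemma homogeneous_morphism_of_character:
  assumes \<alpha>: "character \<alpha>"
  obtains \<Phi> where "homogeneous A qsym_grading \<Phi>"
    "bialgebra_morphism \<Delta> \<epsilon> qsym_Delta qsym_counit \<Phi>" "qsym_counit' \<circ> \<Phi> = \<alpha>"
proof -
  have lin: "linearQ \<alpha>" and \<alpha>1: "\<alpha> 1 = 1"
    using \<alpha> by (auto simp: algebra_morphism_def)
  obtain \<Phi> where \<Phi>: "\<And>u a. 0 \<notin> set u \<Longrightarrow> coeff_qsym u (\<Phi> a) = W \<alpha> u a"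
    using qsym_with_coeffs[OF finite_W_support[OF lin]] by metis
  have lin\<Phi>: "linearQ \<Phi>"
    by (rule linearQI; rule qsym_eqI)
      (simp_all add: \<Phi> linearQ_add[OF linear_W] linearQ_scale[OF linear_W]
        linearQ_add[OF linearQ_coeff_qsym] linearQ_scale[OF linearQ_coeff_qsym])
  have hom: "homogeneous A qsym_grading \<Phi>"
    unfolding homogeneous_def by (auto intro!: qsym_gradingI simp: \<Phi> W_degree[OF lin])
  have mult: "\<Phi> (a * b) = \<Phi> a * \<Phi> b" for a b
  proof (rule qsym_eqI)
    fix w :: "nat list" assume w: "0 \<notin> set w"
    show "coeff_qsym w (\<Phi> (a * b)) = coeff_qsym w (\<Phi> a * \<Phi> b)"
      by (simp add: \<Phi> w coeff_qsym_mult W_mult[OF \<alpha>] W_removeAll_0[OF lin \<alpha>1])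
  qed
  have deg0: "1 \<in> A 0"
    using degree_0 by (metis rangeI scaleQ_one)
  have one: "\<Phi> 1 = 1"
  proof (rule qsym_eqI)
    fix w :: "nat list" assume w: "0 \<notin> set w"
    have M: "(1::qsym) = M_qsym []"
      by transfer simp
    show "coeff_qsym w (\<Phi> 1) = coeff_qsym w 1"
      using W_degree[OF lin deg0, of w] w
      by (cases w) (auto simp: \<Phi> M coeff_qsym_M \<epsilon>_1 simp del: conv_word.simps(2))
  qed
  have co: "qsym_Delta (\<Phi> a) = tensor_map \<Phi> \<Phi> (\<Delta> a)" for a
  proof (rule qsym_tensor_eqI)
    fix u v :: "nat list" assume u: "0 \<notin> set u" and v: "0 \<notin> set v"
    have "tensor_lift (\<lambda>x y. coeff_qsym u x * coeff_qsym v y) (qsym_Delta (\<Phi> a)) = W \<alpha> (u @ v) a"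
      by (simp add: coeff_qsym_append u v \<Phi>)
    also have "\<dots> = tensor_lift (\<lambda>x y. coeff_qsym u (\<Phi> x) * coeff_qsym v (\<Phi> y)) (\<Delta> a)"
      by (simp add: W_append[OF lin] conv_def \<Phi> u v)
    also have "\<dots> = tensor_lift (\<lambda>x y. coeff_qsym u x * coeff_qsym v y) (tensor_map \<Phi> \<Phi> (\<Delta> a))"
      by (rule tensor_lift_map[symmetric, OF bilinearQ_mult[OF linearQ_coeff_qsym linearQ_coeff_qsym] lin\<Phi> lin\<Phi>])
    finally show "tensor_lift (\<lambda>x y. coeff_qsym u x * coeff_qsym v y) (qsym_Delta (\<Phi> a))
      = tensor_lift (\<lambda>x y. coeff_qsym u x * coeff_qsym v y) (tensor_map \<Phi> \<Phi> (\<Delta> a))" .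
  qed
  have "qsym_counit' (\<Phi> a) = \<alpha> a" for a
  proof (rule eq_on_degrees[OF linearQ_compose[OF linear_qsym_counit' lin\<Phi>] lin])
    fix n x assume x: "x \<in> A n"
    then have \<Phi>x: "\<Phi> x \<in> qsym_grading n" using hom by (auto simp: homogeneous_def)
    show "qsym_counit' (\<Phi> x) = \<alpha> x"
    proof (cases "n = 0")
      case True
      then obtain c where c: "x = c *\<^sub>Q 1" using x degree_0 by auto
      have "qsym_counit' 1 = 1"
        by (simp add: qsym_counit'_def qsym_ext_def one_qsym.rep_eq)
      then show ?thesis
        by (simp add: c linearQ_scale[OF lin\<Phi>] linearQ_scale[OF lin] linearQ_scale[OF linear_qsym_counit'] one \<alpha>1)
    next
      case False
      then show ?thesis
        using qsym_counit'_grading[OF \<Phi>x] W_singleton[OF lin, of n x]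
        by (simp add: \<Phi> \<pi>_homogeneous[OF x] del: conv_word.simps)
    qed
  qed
  then have "qsym_counit' \<circ> \<Phi> = \<alpha>" by auto
  moreover have "bialgebra_morphism \<Delta> \<epsilon> qsym_Delta qsym_counit \<Phi>"
    unfolding bialgebra_morphism_def algebra_morphism_def coalgebra_morphism_def
    using lin\<Phi> mult one co by (auto simp: fun_eq_iff qsym_counit_eq_coeff \<Phi>)
  ultimately show ?thesis using hom that by blast
qed

lemma homogeneous_morphism_unique:
  assumes "homogeneous A qsym_grading \<Phi>" "coalgebra_morphism \<Delta> \<epsilon> qsym_Delta qsym_counit \<Phi>"
    and "homogeneous A qsym_grading \<Psi>" "coalgebra_morphism \<Delta> \<epsilon> qsym_Delta qsym_counit \<Psi>"
    and "qsym_counit' \<circ> \<Phi> = qsym_counit' \<circ> \<Psi>"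
  shows "\<Phi> = \<Psi>"
proof
  fix a show "\<Phi> a = \<Psi> a"
    by (rule qsym_eqI)
      (simp add: coeff_homogeneous_morphism[OF assms(1,2) assms(5)] coeff_homogeneous_morphism[OF assms(3,4) refl])
qed

lemma Phi_eqI:
  assumes \<Phi>: "homogeneous A qsym_grading \<Phi>" "bialgebra_morphism \<Delta> \<epsilon> qsym_Delta qsym_counit \<Phi>"
    "qsym_counit' \<circ> \<Phi> = \<alpha>"
  shows "Phi A \<Delta> \<epsilon> \<alpha> = \<Phi>"
  unfolding Phi_def
proof (rule the_equality)
  show "homogeneous A qsym_grading \<Phi> \<and> bialgebra_morphism \<Delta> \<epsilon> qsym_Delta qsym_counit \<Phi> \<and> qsym_counit' \<circ> \<Phi> = \<alpha>"
    using \<Phi> by blast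
  show "\<Psi> = \<Phi>" if "homogeneous A qsym_grading \<Psi> \<and> bialgebra_morphism \<Delta> \<epsilon> qsym_Delta qsym_counit \<Psi> \<and> qsym_counit' \<circ> \<Psi> = \<alpha>" for \<Psi>
    using that \<Phi> homogeneous_morphism_unique[of \<Psi> \<Phi>] unfolding bialgebra_morphism_def by metis
qed

lemma Phi_properties:
  assumes "character \<alpha>"
  shows Phi_homogeneous: "homogeneous A qsym_grading (Phi A \<Delta> \<epsilon> \<alpha>)"
    and Phi_bialgebra_morphism: "bialgebra_morphism \<Delta> \<epsilon> qsym_Delta qsym_counit (Phi A \<Delta> \<epsilon> \<alpha>)"
    and counit'_Phi: "qsym_counit' \<circ> Phi A \<Delta> \<epsilon> \<alpha> = \<alpha>"
proof -
  obtain \<Phi> where "homogeneous A qsym_grading \<Phi>"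
    "bialgebra_morphism \<Delta> \<epsilon> qsym_Delta qsym_counit \<Phi>" "qsym_counit' \<circ> \<Phi> = \<alpha>"
    using homogeneous_morphism_of_character[OF assms] .
  with Phi_eqI[OF this] show "homogeneous A qsym_grading (Phi A \<Delta> \<epsilon> \<alpha>)"
    "bialgebra_morphism \<Delta> \<epsilon> qsym_Delta qsym_counit (Phi A \<Delta> \<epsilon> \<alpha>)" "qsym_counit' \<circ> Phi A \<Delta> \<epsilon> \<alpha> = \<alpha>"
    by simp_all
qed

lemma coeff_Phi:
  assumes "character \<alpha>" "0 \<notin> set u"
  shows "coeff_qsym u (Phi A \<Delta> \<epsilon> \<alpha> a) = W \<alpha> u a"
  using Phi_properties[OF assms(1)] coeff_homogeneous_morphism[OF _ _ _ assms(2)]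
  unfolding bialgebra_morphism_def by blast

end

section \<open>Contraction of the second coproduct\<close>

locale cointeracting_bialgebras = graded_connected_bialgebra \<Delta> \<epsilon> A
  for \<Delta> :: "'a::rat_algebra_1 \<Rightarrow> 'a \<otimes> 'a" and \<epsilon> A +
  fixes \<delta> :: "'a \<Rightarrow> 'a \<otimes> 'a" and \<epsilon>' :: "'a \<Rightarrow> rat"
  assumes bialgebra': "bialgebra \<delta> \<epsilon>'" and cointeraction: "cointeraction \<Delta> \<epsilon> \<delta>"
begin

lemma character_\<epsilon>': "character \<epsilon>'" and coalgebra': "coalgebra \<delta> \<epsilon>'" and linear_\<delta>: "linearQ \<delta>"
  and linear_\<epsilon>': "linearQ \<epsilon>'"
  using bialgebra' by (auto simp: bialgebra_def algebra_morphism_def)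

lemma counit'_contraction:
  assumes f: "linearQ f"
  shows "tensor_lift (\<lambda>x y. \<epsilon>' x *\<^sub>Q f y) (\<delta> a) = f a"
proof -
  have bil: "bilinearQ (\<lambda>c x. c *\<^sub>Q x)"
    by (rule bilinearQ_scale) auto
  have "unit_left (tensor_map \<epsilon>' id (\<delta> a)) = a"
    using coalgebra' by (auto simp: coalgebra_def fun_eq_iff)
  then have "tensor_lift (\<lambda>x y. \<epsilon>' x *\<^sub>Q y) (\<delta> a) = a"
    unfolding unit_left_def tensor_lift_map[OF bil linear_\<epsilon>' linearQ_ident(2)] by simp
  then have "f a = f (tensor_lift (\<lambda>x y. \<epsilon>' x *\<^sub>Q y) (\<delta> a))" by simp
  also have "\<dots> = tensor_lift (\<lambda>x y. \<epsilon>' x *\<^sub>Q f y) (\<delta> a)"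
    by (simp add: linear_tensor_lift[OF f bilinearQ_scale[OF linear_\<epsilon>' linearQ_ident(1)]] linearQ_scale[OF f])
  finally show ?thesis by simp
qed

lemma counit_contraction:
  assumes f: "algebra_morphism f"
  shows "tensor_lift (\<lambda>x y. \<epsilon> x *\<^sub>Q f y) (\<delta> a) = \<epsilon> a *\<^sub>Q 1"
proof -
  have bil: "bilinearQ (\<lambda>c x. c *\<^sub>Q x)"
    by (rule bilinearQ_scale) auto
  have lin: "linearQ f" and f1: "f 1 = 1" using f by (auto simp: algebra_morphism_def)
  have "unit_left (tensor_map \<epsilon> id (\<delta> a)) = \<epsilon> a *\<^sub>Q 1"
    using cointeraction by (auto simp: cointeraction_def)
  then have "tensor_lift (\<lambda>x y. \<epsilon> x *\<^sub>Q y) (\<delta> a) = \<epsilon> a *\<^sub>Q 1"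
    unfolding unit_left_def tensor_lift_map[OF bil linear_\<epsilon> linearQ_ident(2)] by simp
  then have "f (\<epsilon> a *\<^sub>Q 1) = f (tensor_lift (\<lambda>x y. \<epsilon> x *\<^sub>Q y) (\<delta> a))" by simp
  also have "\<dots> = tensor_lift (\<lambda>x y. \<epsilon> x *\<^sub>Q f y) (\<delta> a)"
    by (simp add: linear_tensor_lift[OF lin bilinearQ_scale[OF linear_\<epsilon> linearQ_ident(1)]] linearQ_scale[OF lin])
  finally show ?thesis by (simp add: linearQ_scale[OF lin] f1)
qed

text \<open>
  Pairing the left factors of the cointeraction axiom with \<open>p \<otimes> q\<close> and the right one with \<open>f\<close>:
  the multiplication of the right factors becomes a multiplication in the target of \<open>f\<close>.
\<close>
lemma conv_contraction:
  assumes p: "linearQ p" and q: "linearQ q" and f: "algebra_morphism f"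
  shows "tensor_lift (\<lambda>x y. conv \<Delta> p q x *\<^sub>Q f y) (\<delta> a) =
    conv \<Delta> (\<lambda>b. tensor_lift (\<lambda>x y. p x *\<^sub>Q f y) (\<delta> b)) (\<lambda>b. tensor_lift (\<lambda>x y. q x *\<^sub>Q f y) (\<delta> b)) a"
proof -
  have lin: "linearQ f" and mult: "f (x * y) = f x * f y" for x y
    using f by (auto simp: algebra_morphism_def)
  (* K pairs the two left factors with p and q, and the right factor with f *)
  define E where "E = tensor_lift (\<lambda>x y. p x * q y)"
  define P where "P = tensor_lift (\<lambda>x y. p x *\<^sub>Q f y)"
  define Q where "Q = tensor_lift (\<lambda>x y. q x *\<^sub>Q f y)"
  define K where "K = tensor_lift (\<lambda>s z. E s *\<^sub>Q f z)"
  have lins: "linearQ E" "linearQ P" "linearQ Q" "linearQ K"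
    unfolding E_def P_def Q_def K_def by (rule linearQ_tensor_lift)+
  have bilK: "bilinearQ (\<lambda>s z. E s *\<^sub>Q f z)"
    by (rule bilinearQ_scale[OF lins(1) lin])
  have E: "E (x \<otimes> y) = p x * q y" and P: "P (x \<otimes> z) = p x *\<^sub>Q f z" and Q: "Q (x \<otimes> z) = q x *\<^sub>Q f z"
    and K: "K (s \<otimes> z) = E s *\<^sub>Q f z" for x y z s
    by (simp_all only: E_def P_def Q_def K_def tensor_lift_tens bilinearQ_mult bilinearQ_scale p q lin
        bilK[unfolded E_def])
  have lin_m: "linearQ (m_1_3_24 :: ('a \<otimes> 'a) \<otimes> ('a \<otimes> 'a) \<Rightarrow> _)"
    unfolding m_1_3_24_def by (rule linearQ_tensor_lift)
  note linK = linearQ_compose[OF lins(4) linearQ_compose[OF lin_m]]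
  have pure: "K (m_1_3_24 ((x \<otimes> y) \<otimes> (x' \<otimes> y'))) = P (x \<otimes> y) * Q (x' \<otimes> y')" for x y x' y'
    by (simp add: m_1_3_24_tens K E P Q mult scaleQ_mult_left scaleQ_mult_right scaleQ_scaleQ mult.commute)
  have pure': "K (m_1_3_24 ((x \<otimes> y) \<otimes> t)) = P (x \<otimes> y) * Q t" for x y t
    by (rule tensor_eqI[where t = t, OF linK[OF bilinearQ_linear(2)[OF bilinearQ_tens]]
          bilinearQ_linear(2)[OF bilinearQ_mult[OF lins(2,3)]] pure])
  have "K (m_1_3_24 (s \<otimes> t)) = P s * Q t" for s t
    by (rule tensor_eqI[where t = s, OF linK[OF bilinearQ_linear(1)[OF bilinearQ_tens]]
          bilinearQ_linear(1)[OF bilinearQ_mult[OF lins(2,3)]] pure'])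
  then have "K (m_1_3_24 (tensor_map \<delta> \<delta> t)) = tensor_lift (\<lambda>x y. P (\<delta> x) * Q (\<delta> y)) t" for t
    by (intro tensor_eqI[where t = t, OF linK[OF linearQ_tensor_map] linearQ_tensor_lift])
      (simp add: tensor_map_tens linear_\<delta>
        tensor_lift_tens[OF bilinearQ_mult[OF linearQ_compose[OF lins(2) linear_\<delta>] linearQ_compose[OF lins(3) linear_\<delta>]]])
  moreover have "m_1_3_24 (tensor_map \<delta> \<delta> (\<Delta> a)) = tensor_map \<Delta> id (\<delta> a)"
    using cointeraction by (auto simp: cointeraction_def fun_eq_iff)
  ultimately have "K (tensor_map \<Delta> id (\<delta> a)) = tensor_lift (\<lambda>x y. P (\<delta> x) * Q (\<delta> y)) (\<Delta> a)"
    by metis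
  then show ?thesis
    unfolding K_def tensor_lift_map[OF bilK linear_\<Delta> linearQ_ident(2)]
    by (simp add: conv_def E_def P_def Q_def)
qed

lemma W_contraction:
  assumes f: "algebra_morphism f"
    and letter: "\<And>c b. c > 0 \<Longrightarrow> tensor_lift (\<lambda>x y. \<epsilon>' (\<pi> c x) *\<^sub>Q f y) (\<delta> b) = f (\<pi> c b)"
    and v: "0 \<notin> set v"
  shows "tensor_lift (\<lambda>x y. W \<epsilon>' v x *\<^sub>Q f y) (\<delta> a) = W f v a"
  using v
proof (induction v arbitrary: a)
  case Nil
  show ?case by (simp add: counit_contraction[OF f])
next
  case (Cons c v)
  then show ?case
    by (simp add: conv_contraction[OF linear_letter[OF linear_\<epsilon>'] linear_W f] letter)
qed

abbreviation \<Phi> :: "'a \<Rightarrow> qsym" where "\<Phi> \<equiv> Phi A \<Delta> \<epsilon> \<epsilon>'"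

lemma \<Phi>_morphism: "algebra_morphism \<Phi>" and linear_\<Phi>: "linearQ \<Phi>"
  and \<Delta>_\<Phi>: "qsym_Delta (\<Phi> a) = tensor_map \<Phi> \<Phi> (\<Delta> a)"
  and counit_\<Phi>: "qsym_counit (\<Phi> a) = \<epsilon> a"
  and counit'_\<Phi>: "qsym_counit' (\<Phi> a) = \<epsilon>' a"
  using Phi_bialgebra_morphism[OF character_\<epsilon>'] counit'_Phi[OF character_\<epsilon>']
  by (auto simp: bialgebra_morphism_def coalgebra_morphism_def fun_eq_iff)

lemma \<epsilon>'_component: "c > 0 \<Longrightarrow> \<epsilon>' (\<pi> c a) = coeff_qsym [c] (\<Phi> a)"
  using coeff_Phi[OF character_\<epsilon>', of "[c]" a] W_singleton[OF linear_\<epsilon>', of c a] by simp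

text \<open>
  On \<open>A\<^sub>n \<otimes> A\<close> the functional \<open>\<epsilon>' \<circ> \<pi>\<^sub>c\<close> is \<open>\<epsilon>'\<close> or zero, according to whether \<open>c = n\<close>. Both
  \<open>\<epsilon>'\<close> and \<open>\<epsilon>' \<circ> \<pi>\<^sub>c\<close> factor through \<open>\<Phi>\<close>, so the summands with a factor in a kernel
  contribute nothing. For \<open>c = n\<close> what remains is the counit property of \<open>\<epsilon>'\<close>.
\<close>
lemma letter_contraction:
  assumes f: "linearQ f" and c: "c > 0"
    and \<delta>: "\<forall>n. \<delta> ` A n \<subseteq> tensor_set (A n) UNIV + tensor_set (linear_kernel \<Phi>) UNIV
      + tensor_set UNIV (linear_kernel f)"
  shows "tensor_lift (\<lambda>x y. \<epsilon>' (\<pi> c x) *\<^sub>Q f y) (\<delta> b) = f (\<pi> c b)"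
proof (rule eq_on_degrees[where f = "\<lambda>b. tensor_lift (\<lambda>x y. \<epsilon>' (\<pi> c x) *\<^sub>Q f y) (\<delta> b)"])
  show "linearQ (\<lambda>b. tensor_lift (\<lambda>x y. \<epsilon>' (\<pi> c x) *\<^sub>Q f y) (\<delta> b))"
    by (rule linearQ_compose[OF linearQ_tensor_lift linear_\<delta>])
  show "linearQ (\<lambda>b. f (\<pi> c b))" by (rule linear_letter[OF f])
  fix n x assume x: "x \<in> A n"
  (* on A n this is \<epsilon>' \<circ> \<pi> c; on the other two summands both give zero *)
  define g where "g = (\<lambda>x. if c = n then \<epsilon>' x else 0)"
  have g: "linearQ g"
    using linear_\<epsilon>' by (simp add: g_def linearQ_iff)
  obtain r s t where rst: "\<delta> x = r + s + t" and r: "r \<in> tensor_set (A n) UNIV"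
    and s: "s \<in> tensor_set (linear_kernel \<Phi>) UNIV" and t: "t \<in> tensor_set UNIV (linear_kernel f)"
    using \<delta> x by (fastforce elim!: set_plus_elim)
  let ?L = "tensor_lift (\<lambda>x y. \<epsilon>' (\<pi> c x) *\<^sub>Q f y)" and ?R = "tensor_lift (\<lambda>x y. g x *\<^sub>Q f y)"
  note bil = bilinearQ_scale[OF linear_letter[OF linear_\<epsilon>'] f] bilinearQ_scale[OF g f]
  have "?L r = ?R r"
    by (rule tensor_lift_eq_on[OF bil _ r])
      (auto simp: \<pi>_homogeneous g_def linearQ_zero[OF linear_\<epsilon>'])
  moreover have "?L s = ?R s"
  proof (rule tensor_lift_eq_on[OF bil _ s])
    fix x y assume "x \<in> linear_kernel \<Phi>"
    then have "\<epsilon>' (\<pi> c x) = 0" "\<epsilon>' x = 0"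
      using counit'_\<Phi>[of x] by (simp_all add: \<epsilon>'_component[OF c] linear_kernel_def
          linearQ_zero[OF linearQ_coeff_qsym] linearQ_zero[OF linear_qsym_counit'])
    then show "\<epsilon>' (\<pi> c x) *\<^sub>Q f y = g x *\<^sub>Q f y"
      by (simp add: g_def)
  qed
  moreover have "?L t = ?R t"
    by (rule tensor_lift_eq_on[OF bil _ t]) (simp add: linear_kernel_def)
  ultimately have "?L (\<delta> x) = ?R (\<delta> x)"
    by (simp add: rst tensor_lift_add)
  also have "\<dots> = f (\<pi> c x)"
    by (cases "c = n")
      (simp_all add: g_def counit'_contraction[OF f] \<pi>_homogeneous[OF x] linearQ_zero[OF f])
  finally show "?L (\<delta> x) = f (\<pi> c x)" .
qed

end

section \<open>The second coproduct of QSym\<close>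

definition qsym_component :: "nat \<Rightarrow> qsym \<Rightarrow> qsym"
  where "qsym_component n = qsym_ext (\<lambda>u. if sum_list u = n then M_qsym u else 0)"

lemma linear_qsym_component: "linearQ (qsym_component n)"
  unfolding qsym_component_def by (rule linearQ_qsym_ext)

lemma qsym_component_M: "0 \<notin> set u \<Longrightarrow> qsym_component n (M_qsym u) = (if sum_list u = n then M_qsym u else 0)"
  by (simp add: qsym_component_def qsym_ext_M)

lemma linear_eq_on_grading:
  assumes "linearQ f" "linearQ g" "p \<in> qsym_grading n"
    and "\<And>u. 0 \<notin> set u \<Longrightarrow> sum_list u = n \<Longrightarrow> f (M_qsym u) = g (M_qsym u)"
  shows "f p = g p"
proof -
  have "Q.subspace {p. f p = g p}"
    by (rule Q.subspaceI) (simp_all add: linearQ_zero linearQ_add linearQ_scale assms(1,2))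
  then have "qsym_grading n \<subseteq> {p. f p = g p}"
    unfolding qsym_grading_def by (rule Q.span_minimal[rotated]) (use assms(4) in auto)
  with assms(3) show ?thesis by auto
qed

lemma qsym_component_homogeneous:
  assumes "p \<in> qsym_grading m"
  shows "qsym_component n p = (if n = m then p else 0)"
proof -
  have "linearQ (\<lambda>p. if n = m then p else 0)" by (simp add: linearQ_iff)
  from linear_eq_on_grading[OF linear_qsym_component this assms, of n] show ?thesis
    by (auto simp: qsym_component_M)
qed

text \<open>
  Splitting off the first block; the summand for the empty word is the empty factorization.
\<close>
lemma sum_factorizations:
  "(\<Sum>ws\<in>factorizations w. G ws) =
    (if w = [] then G [] else 0) + (\<Sum>(x, y) | x @ y = w \<and> x \<noteq> []. \<Sum>ws\<in>factorizations y. G (x # ws))"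
    (is "_ = _ + ?R")
proof -
  let ?P = "{(x, y). x @ y = w \<and> x \<noteq> []}"
  have fin: "finite ?P"
    by (rule finite_subset[OF _ finite_deconcatenations[of w]]) auto
  have "?R = (\<Sum>((x, y), ws)\<in>(SIGMA (x, y):?P. factorizations y). G (x # ws))"
    using fin finite_factorizations by (subst sum.Sigma[symmetric]) (auto simp: case_prod_unfold)
  also have "\<dots> = (\<Sum>ws\<in>factorizations w - {[]}. G ws)"
    by (rule sum.reindex_bij_witness[where j = "\<lambda>((x, y), ws). x # ws"
          and i = "\<lambda>ws. ((hd ws, concat (tl ws)), tl ws)"])
      (auto simp: factorizations_def dest: neq_Nil_conv[THEN iffD1] intro: hd_Cons_tl)
  finally have R: "?R = (\<Sum>ws\<in>factorizations w - {[]}. G ws)" .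
  show ?thesis
  proof (cases "w = []")
    case True
    then have "[] \<in> factorizations w" by (simp add: factorizations_def)
    then show ?thesis
      using True R finite_factorizations[of w] by (simp add: sum.remove)
  next
    case False
    then have "[] \<notin> factorizations w" by (auto simp: factorizations_def)
    then show ?thesis using False R by simp
  qed
qed

text \<open>
  An element of the tensor square of QSym is an expansion along the \<open>M\<^sub>v\<close> in the left factor with
  coefficients in QSym.
\<close>
definition coeff_left :: "nat list \<Rightarrow> qsym \<otimes> qsym \<Rightarrow> qsym"
  where "coeff_left v = tensor_lift (\<lambda>x y. coeff_qsym v x *\<^sub>Q y)"

lemma linear_coeff_left: "linearQ (coeff_left v)"
  unfolding coeff_left_def by (rule linearQ_tensor_lift)

lemma bilinear_coeff_left: "bilinearQ (\<lambda>x y. coeff_qsym v x *\<^sub>Q (y :: qsym))"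
  by (rule bilinearQ_scale[OF linearQ_coeff_qsym linearQ_ident(1)])

lemma coeff_left_tens: "coeff_left v (x \<otimes> y) = coeff_qsym v x *\<^sub>Q y"
  unfolding coeff_left_def by (rule tensor_lift_tens[OF bilinear_coeff_left])

lemma coeff_left_eqI:
  assumes "\<And>v. 0 \<notin> set v \<Longrightarrow> coeff_left v s = coeff_left v t"
  shows "s = t"
proof (rule qsym_tensor_eqI)
  fix u v :: "nat list" assume u: "0 \<notin> set u"
  have "tensor_lift (\<lambda>x y. coeff_qsym u x * coeff_qsym v y) r = coeff_qsym v (coeff_left u r)" for r
    unfolding coeff_left_def
    by (simp add: linear_tensor_lift[OF linearQ_coeff_qsym bilinear_coeff_left] linearQ_scale[OF linearQ_coeff_qsym])
  then show "tensor_lift (\<lambda>x y. coeff_qsym u x * coeff_qsym v y) s = tensor_lift (\<lambda>x y. coeff_qsym u x * coeff_qsym v y) t"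
    using assms[OF u] by simp
qed

lemma linear_qsym_delta: "linearQ qsym_delta" and linear_qsym_Delta: "linearQ qsym_Delta"
  unfolding qsym_delta_def qsym_Delta_def by (rule linearQ_qsym_ext)+

lemma zero_notin_factorization:
  "0 \<notin> set w \<Longrightarrow> ws \<in> factorizations w \<Longrightarrow> x \<in> set ws \<Longrightarrow> 0 \<notin> set x \<and> x \<noteq> []"
  by (auto simp: factorizations_def)

lemma zero_notin_block_sums:
  assumes "0 \<notin> set w" "ws \<in> factorizations w"
  shows "0 \<notin> set (map sum_list ws)"
proof
  assume "0 \<in> set (map sum_list ws)"
  then obtain x where "x \<in> set ws" "sum_list x = 0" by auto
  with zero_notin_factorization[OF assms] show False
    by (metis list.set_intros(1) neq_Nil_conv sum_list_eq_0_iff)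
qed

lemma coeff_left_delta_M:
  assumes w: "0 \<notin> set w"
  shows "coeff_left v (qsym_delta (M_qsym w)) =
    (\<Sum>ws\<in>factorizations w. (if map sum_list ws = v then 1 else 0) *\<^sub>Q prod_list (map M_qsym ws))"
  unfolding qsym_delta_def qsym_ext_M[OF w] linearQ_sum[OF linear_coeff_left]
  by (rule sum.cong) (simp_all only: coeff_left_tens coeff_qsym_M[OF zero_notin_block_sums[OF w]]
        eq_commute[of v])

lemma M_qsym_Nil: "M_qsym [] = 1"
  by transfer simp

lemma coeff_left_delta_Nil: "coeff_left [] (qsym_delta p) = qsym_counit p *\<^sub>Q 1"
proof (rule linear_qsym_eqI[OF linearQ_compose[OF linear_coeff_left linear_qsym_delta]])
  show "linearQ (\<lambda>p. qsym_counit p *\<^sub>Q 1)"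
    using linearQ_coeff_qsym[of "[]"] by (simp add: qsym_counit_eq_coeff linearQ_iff scaleQ_add_left scaleQ_scaleQ)
  fix w :: "nat list" assume w: "0 \<notin> set w"
  show "coeff_left [] (qsym_delta (M_qsym w)) = qsym_counit (M_qsym w) *\<^sub>Q 1"
    by (subst coeff_left_delta_M[OF w], subst sum_factorizations)
      (simp add: qsym_counit_eq_coeff coeff_qsym_M w)
qed

text \<open>
  The left coefficients of the second coproduct satisfy the recursion of \<open>conv_word\<close> for the
  identity of QSym: splitting off the first block \<open>x\<close> of a factorization is a deconcatenation, and
  \<open>c > 0\<close> rules out the empty block.
\<close>
lemma coeff_left_delta_Cons:
  assumes c: "c > 0"
  shows "coeff_left (c # v) (qsym_delta p) =
    tensor_lift (\<lambda>x y. qsym_component c x * coeff_left v (qsym_delta y)) (qsym_Delta p)"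
proof (rule linear_qsym_eqI[OF linearQ_compose[OF linear_coeff_left linear_qsym_delta]
      linearQ_compose[OF linearQ_tensor_lift linear_qsym_Delta]])
  fix w :: "nat list" assume w: "0 \<notin> set w"
  let ?e = "\<lambda>v ws. if map sum_list ws = v then 1 else 0 :: rat"
  note lin = linearQ_compose[OF linear_coeff_left linear_qsym_delta]
  have "coeff_left (c # v) (qsym_delta (M_qsym w)) =
    (\<Sum>(x, y) | x @ y = w \<and> x \<noteq> []. \<Sum>ws\<in>factorizations y. ?e (c # v) (x # ws) *\<^sub>Q prod_list (map M_qsym (x # ws)))"
    by (subst coeff_left_delta_M[OF w], subst sum_factorizations) simp
  also have "\<dots> = (\<Sum>(x, y) | x @ y = w \<and> x \<noteq> []. qsym_component c (M_qsym x) * coeff_left v (qsym_delta (M_qsym y)))"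
  proof (rule sum.cong[OF refl], clarify)
    fix x y assume xy: "w = x @ y"
    then have 0: "0 \<notin> set x" "0 \<notin> set y" using w by auto
    have "(\<Sum>ws\<in>factorizations y. ?e (c # v) (x # ws) *\<^sub>Q prod_list (map M_qsym (x # ws)))
      = (\<Sum>ws\<in>factorizations y. qsym_component c (M_qsym x) * (?e v ws *\<^sub>Q prod_list (map M_qsym ws)))"
      by (rule sum.cong) (auto simp: qsym_component_M 0 scaleQ_one)
    then show "(\<Sum>ws\<in>factorizations y. ?e (c # v) (x # ws) *\<^sub>Q prod_list (map M_qsym (x # ws)))
      = qsym_component c (M_qsym x) * coeff_left v (qsym_delta (M_qsym y))"
      by (simp add: coeff_left_delta_M[OF 0(2)] sum_distrib_left)
  qed
  also have "\<dots> = (\<Sum>(x, y) | x @ y = w. qsym_component c (M_qsym x) * coeff_left v (qsym_delta (M_qsym y)))"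
    by (rule sum.mono_neutral_left[OF finite_deconcatenations]) (use c in \<open>auto simp: qsym_component_M\<close>)
  also have "\<dots> = tensor_lift (\<lambda>x y. qsym_component c x * coeff_left v (qsym_delta y)) (qsym_Delta (M_qsym w))"
    unfolding qsym_Delta_def qsym_ext_M[OF w] linearQ_sum[OF linearQ_tensor_lift]
    by (rule sum.cong[OF refl]) (auto simp: tensor_lift_tens[OF bilinearQ_mult[OF linear_qsym_component lin]])
  finally show "coeff_left (c # v) (qsym_delta (M_qsym w)) =
    tensor_lift (\<lambda>x y. qsym_component c x * coeff_left v (qsym_delta y)) (qsym_Delta (M_qsym w))" .
qed

lemma qsym_delta_degree:
  assumes "p \<in> qsym_grading n"
  shows "tensor_map (qsym_component n) id (qsym_delta p) = qsym_delta p"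
proof (rule linear_eq_on_grading[OF linearQ_compose[OF linearQ_tensor_map linear_qsym_delta] linear_qsym_delta assms])
  fix w :: "nat list" assume w: "0 \<notin> set w" and n: "sum_list w = n"
  have "sum_list (map sum_list ws) = n" if "ws \<in> factorizations w" for ws
  proof -
    have "sum_list (map sum_list ws) = sum_list (concat ws)" by (induction ws) auto
    with that n show ?thesis by (simp add: factorizations_def)
  qed
  then show "tensor_map (qsym_component n) id (qsym_delta (M_qsym w)) = qsym_delta (M_qsym w)"
    unfolding qsym_delta_def qsym_ext_M[OF w] linearQ_sum[OF linearQ_tensor_map]
    by (intro sum.cong[OF refl])
      (simp add: tensor_map_tens linear_qsym_component linearQ_ident
        qsym_component_M[OF zero_notin_block_sums[OF w]] del: set_map)
qed

section \<open>Compatibility with the second coproduct\<close>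

context cointeracting_bialgebras
begin

lemma component_\<Phi>: "qsym_component c (\<Phi> a) = \<Phi> (\<pi> c a)"
proof (rule eq_on_degrees[OF linearQ_compose[OF linear_qsym_component linear_\<Phi>] linear_letter[OF linear_\<Phi>]])
  fix n x assume x: "x \<in> A n"
  then have "\<Phi> x \<in> qsym_grading n"
    using Phi_homogeneous[OF character_\<epsilon>'] by (auto simp: homogeneous_def)
  then show "qsym_component c (\<Phi> x) = \<Phi> (\<pi> c x)"
    by (simp add: qsym_component_homogeneous \<pi>_homogeneous[OF x] linearQ_zero[OF linear_\<Phi>])
qed

text \<open>
  The recursion for the left coefficients, transported along the homogeneous coalgebra morphism
  \<open>\<Phi>\<close>.
\<close>
lemma coeff_left_delta_\<Phi>:
  "0 \<notin> set v \<Longrightarrow> coeff_left v (qsym_delta (\<Phi> a)) = W \<Phi> v a"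
proof (induction v arbitrary: a)
  case Nil
  show ?case by (simp add: coeff_left_delta_Nil counit_\<Phi>)
next
  case (Cons c v)
  have "coeff_left (c # v) (qsym_delta (\<Phi> a)) =
    tensor_lift (\<lambda>x y. qsym_component c x * coeff_left v (qsym_delta y)) (tensor_map \<Phi> \<Phi> (\<Delta> a))"
    using Cons.prems by (simp add: coeff_left_delta_Cons \<Delta>_\<Phi>)
  also have "\<dots> = tensor_lift (\<lambda>x y. qsym_component c (\<Phi> x) * coeff_left v (qsym_delta (\<Phi> y))) (\<Delta> a)"
    by (rule tensor_lift_map[OF bilinearQ_mult[OF linear_qsym_component
            linearQ_compose[OF linear_coeff_left linear_qsym_delta]] linear_\<Phi> linear_\<Phi>])
  finally show ?case
    using Cons by (simp add: conv_def component_\<Phi>)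
qed

lemma \<Phi>_delta_morphism:
  assumes "\<forall>n. \<delta> ` A n \<subseteq> tensor_set (A n) UNIV + tensor_set (linear_kernel \<Phi>) UNIV
      + tensor_set UNIV (linear_kernel \<Phi>)"
  shows "bialgebra_morphism \<delta> \<epsilon>' qsym_delta qsym_counit' \<Phi>"
proof -
  have "qsym_delta (\<Phi> a) = tensor_map \<Phi> \<Phi> (\<delta> a)" for a
  proof (rule coeff_left_eqI)
    fix v :: "nat list" assume v: "0 \<notin> set v"
    have "coeff_left v (tensor_map \<Phi> \<Phi> (\<delta> a)) = tensor_lift (\<lambda>x y. W \<epsilon>' v x *\<^sub>Q \<Phi> y) (\<delta> a)"
      unfolding coeff_left_def tensor_lift_map[OF bilinear_coeff_left linear_\<Phi> linear_\<Phi>]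
      by (simp add: coeff_Phi[OF character_\<epsilon>' v])
    also have "\<dots> = W \<Phi> v a"
      by (rule W_contraction[OF \<Phi>_morphism letter_contraction[OF linear_\<Phi> _ assms] v])
    finally show "coeff_left v (qsym_delta (\<Phi> a)) = coeff_left v (tensor_map \<Phi> \<Phi> (\<delta> a))"
      by (simp add: coeff_left_delta_\<Phi>[OF v])
  qed
  then show ?thesis
    using \<Phi>_morphism linear_\<Phi> counit'_\<Phi>
    by (auto simp: bialgebra_morphism_def coalgebra_morphism_def fun_eq_iff)
qed

text \<open>
  The component of \<open>\<delta> a\<close> in \<open>A\<^sub>n \<otimes> A\<close> has the same image under \<open>\<Phi> \<otimes> \<Phi>\<close> as \<open>\<delta> a\<close> itself, since
  this image is \<open>qsym_delta (\<Phi> a)\<close>, of left degree \<open>n\<close>. The difference is in the kernel of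
  \<open>\<Phi> \<otimes> \<Phi>\<close>.
\<close>
lemma delta_degree_of_morphism:
  assumes "bialgebra_morphism \<delta> \<epsilon>' qsym_delta qsym_counit' \<Phi>" and a: "a \<in> A n"
  shows "\<delta> a \<in> tensor_set (A n) UNIV + tensor_set (linear_kernel \<Phi>) UNIV
      + tensor_set UNIV (linear_kernel \<Phi>)"
proof -
  have \<delta>\<Phi>: "qsym_delta (\<Phi> a) = tensor_map \<Phi> \<Phi> (\<delta> a)"
    using assms(1) by (auto simp: bialgebra_morphism_def coalgebra_morphism_def fun_eq_iff)
  let ?r = "tensor_map (\<pi> n) id (\<delta> a)"
  have "tensor_map (\<pi> n) id t \<in> tensor_set (A n) UNIV" for t :: "'a \<otimes> 'a"
  proof (induction t)
    case (tens x y)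
    show ?case
      unfolding tensor_map_tens[OF linear_\<pi> linearQ_ident(2)]
      by (rule tensor_set_base[OF \<pi>_in UNIV_I])
  next
    case (add s t)
    then show ?case
      by (simp add: linearQ_add[OF linearQ_tensor_map] tensor_set_def Q.span_add)
  qed
  moreover have "tensor_map \<Phi> \<Phi> (\<delta> a - ?r) = 0"
  proof -
    have "\<Phi> a \<in> qsym_grading n"
      using Phi_homogeneous[OF character_\<epsilon>'] a by (auto simp: homogeneous_def)
    have "tensor_map \<Phi> \<Phi> ?r = tensor_map (\<lambda>x. \<Phi> (\<pi> n x)) \<Phi> (\<delta> a)"
      by (simp add: tensor_map_map linear_\<pi> linearQ_ident linear_\<Phi>)
    also have "\<dots> = tensor_map (qsym_component n) id (tensor_map \<Phi> \<Phi> (\<delta> a))"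
      by (simp add: tensor_map_map linear_qsym_component linearQ_ident linear_\<Phi> component_\<Phi>)
    also have "\<dots> = tensor_map \<Phi> \<Phi> (\<delta> a)"
      unfolding \<delta>\<Phi>[symmetric] by (rule qsym_delta_degree) fact
    finally show ?thesis by (simp add: linearQ_diff[OF linearQ_tensor_map])
  qed
  then have "\<delta> a - ?r \<in> tensor_set (linear_kernel \<Phi>) UNIV + tensor_set UNIV (linear_kernel \<Phi>)"
    by (rule kernel_tensor_map[OF linear_\<Phi> linear_\<Phi>])
  ultimately have "?r + (\<delta> a - ?r) \<in> tensor_set (A n) UNIV
      + (tensor_set (linear_kernel \<Phi>) UNIV + tensor_set UNIV (linear_kernel \<Phi>))"
    by (rule set_plus_intro)
  then show ?thesis by (simp add: add.assoc)
qed

lemma Phi_eq_char_action: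
  assumes \<delta>: "\<forall>n. \<delta> ` A n \<subseteq> tensor_set (A n) UNIV + tensor_set (linear_kernel \<Phi>) UNIV"
    and \<alpha>: "character \<alpha>"
  shows "Phi A \<Delta> \<epsilon> \<alpha> = char_action \<delta> \<Phi> \<alpha>"
proof
  fix a
  have lin: "linearQ \<alpha>" using \<alpha> by (rule algebra_morphism_linear)
  have bil: "bilinearQ (\<lambda>(x :: qsym) c. c *\<^sub>Q x)"
    by (rule bilinearQI) (simp_all add: scaleQ_add_left scaleQ_add_right scaleQ_scaleQ mult.commute)
  have \<delta>': "\<forall>n. \<delta> ` A n \<subseteq> tensor_set (A n) UNIV + tensor_set (linear_kernel \<Phi>) UNIV
      + tensor_set UNIV (linear_kernel \<alpha>)"
  proof (intro allI subsetI)
    fix n t assume "t \<in> \<delta> ` A n"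
    with \<delta> have "t \<in> tensor_set (A n) UNIV + tensor_set (linear_kernel \<Phi>) UNIV" by blast
    moreover have "0 \<in> tensor_set UNIV (linear_kernel \<alpha>)"
      by (simp add: tensor_set_def Q.span_zero)
    ultimately have "t + 0 \<in> tensor_set (A n) UNIV + tensor_set (linear_kernel \<Phi>) UNIV + tensor_set UNIV (linear_kernel \<alpha>)"
      by (rule set_plus_intro)
    then show "t \<in> tensor_set (A n) UNIV + tensor_set (linear_kernel \<Phi>) UNIV + tensor_set UNIV (linear_kernel \<alpha>)"
      by simp
  qed
  have action: "char_action \<delta> \<Phi> \<alpha> a = tensor_lift (\<lambda>x y. \<alpha> y *\<^sub>Q \<Phi> x) (\<delta> a)"
    unfolding char_action_def unit_right_def comp_def
    by (rule tensor_lift_map[OF bil linear_\<Phi> lin])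
  show "Phi A \<Delta> \<epsilon> \<alpha> a = char_action \<delta> \<Phi> \<alpha> a"
  proof (rule qsym_eqI)
    fix v :: "nat list" assume v: "0 \<notin> set v"
    have "coeff_qsym v (char_action \<delta> \<Phi> \<alpha> a) = tensor_lift (\<lambda>x y. W \<epsilon>' v x *\<^sub>Q \<alpha> y) (\<delta> a)"
      unfolding action linear_tensor_lift[OF linearQ_coeff_qsym bilinearQ_compose[OF bil linear_\<Phi> lin]]
      by (simp add: linearQ_scale[OF linearQ_coeff_qsym] coeff_Phi[OF character_\<epsilon>' v] mult.commute)
    also have "\<dots> = W \<alpha> v a"
      by (rule W_contraction[OF \<alpha> letter_contraction[OF lin _ \<delta>'] v])
    finally show "coeff_qsym v (Phi A \<Delta> \<epsilon> \<alpha> a) = coeff_qsym v (char_action \<delta> \<Phi> \<alpha> a)"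
      by (simp add: coeff_Phi[OF \<alpha> v])
  qed
qed

end

section \<open>Coalgebra morphisms to polynomials\<close>

lemma poly_eq_on_naturals:
  fixes p q :: "rat poly"
  assumes "\<And>k. poly p (of_nat k) = poly q (of_nat k)"
  shows "p = q"
proof (rule ccontr)
  assume "p \<noteq> q"
  then have "finite {x. poly (p - q) x = 0}" by (intro poly_roots_finite) simp
  moreover have "range of_nat \<subseteq> {x. poly (p - q) x = 0}" using assms by auto
  ultimately have "finite (range (of_nat :: nat \<Rightarrow> rat))" by (rule rev_finite_subset)
  then show False using finite_imageD[of "of_nat :: nat \<Rightarrow> rat" UNIV] by (auto simp: inj_on_def)
qed

lemma linearQ_poly_eval: "linearQ (\<lambda>p :: rat poly. poly p x)"
  by (simp add: linearQ_iff scaleQ_poly_def)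

definition eval_tensor :: "rat \<Rightarrow> rat \<Rightarrow> rat poly \<otimes> rat poly \<Rightarrow> rat"
  where "eval_tensor x y = tensor_lift (\<lambda>p q. poly p x * poly q y)"

lemma bilinear_eval: "bilinearQ (\<lambda>p q :: rat poly. poly p x * poly q y)"
  by (rule bilinearQ_mult[OF linearQ_poly_eval linearQ_poly_eval])

lemma linear_eval_tensor: "linearQ (eval_tensor x y)"
  unfolding eval_tensor_def by (rule linearQ_tensor_lift)

lemma eval_tensor_tens: "eval_tensor x y (p \<otimes> q) = poly p x * poly q y"
  unfolding eval_tensor_def by (rule tensor_lift_tens[OF bilinear_eval])

lemma eval_tensor_map:
  "linearQ f \<Longrightarrow> linearQ g \<Longrightarrow> eval_tensor x y (tensor_map f g t) = tensor_lift (\<lambda>a b. poly (f a) x * poly (g b) y) t"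
  unfolding eval_tensor_def by (rule tensor_lift_map[OF bilinear_eval])

lemma eval_tensor_eqI:
  assumes "\<And>k l. eval_tensor (of_nat k) (of_nat l) s = eval_tensor (of_nat k) (of_nat l) t"
  shows "s = t"
proof -
  let ?F = "range (\<lambda>k (p :: rat poly). poly p (of_nat k))"
  have sep: "p = 0" if "\<And>f. f \<in> ?F \<Longrightarrow> f p = 0" for p
    by (rule poly_eq_on_naturals) (use that in auto)
  have "s - t = 0"
    by (rule tensor_separation[of ?F ?F])
      (use assms sep linearQ_poly_eval in \<open>auto simp: eval_tensor_def linearQ_diff[OF linearQ_tensor_lift]\<close>)
  then show ?thesis by simp
qed

lemma eval_tensor_mult: "eval_tensor x y (s * t) = eval_tensor x y s * eval_tensor x y t"
proof -
  have 1: "eval_tensor x y ((p \<otimes> q) * t) = eval_tensor x y (p \<otimes> q) * eval_tensor x y t" for p q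
    by (induction t) (simp_all add: tens_mult_tens eval_tensor_tens algebra_simps linearQ_add[OF linear_eval_tensor])
  show ?thesis
    by (induction s) (simp_all add: 1 algebra_simps linearQ_add[OF linear_eval_tensor])
qed

lemma eval_tensor_subst: "eval_tensor x y (poly_subst b p) = poly p (eval_tensor x y b)"
proof -
  have "eval_tensor x y (b ^ i) = eval_tensor x y b ^ i" for i
    by (induction i) (simp_all add: eval_tensor_mult one_tensor_def eval_tensor_tens)
  then show ?thesis
    by (simp add: poly_subst_def poly_altdef linearQ_sum[OF linear_eval_tensor] linearQ_scale[OF linear_eval_tensor])
qed

lemma eval_poly_Delta: "eval_tensor x y (poly_Delta p) = poly p (x + y)"
  unfolding poly_Delta_def eval_tensor_subst
  by (simp add: linearQ_add[OF linear_eval_tensor] eval_tensor_tens)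

lemma eval_poly_delta: "eval_tensor x y (poly_delta p) = poly p (x * y)"
  unfolding poly_delta_def eval_tensor_subst by (simp add: eval_tensor_tens)

text \<open>
  Evaluating \<open>poly_Delta p\<close> at \<open>(x, y)\<close> gives the value of \<open>p\<close> at \<open>x + y\<close>. Hence the value of
  \<open>\<phi> a\<close> at \<open>k + 1\<close> is the convolution product of the values at \<open>1\<close> and at \<open>k\<close>, and a polynomial
  is determined by its values at the natural numbers.
\<close>
lemma poly_morphism_unique:
  assumes \<phi>: "coalgebra_morphism \<Delta> \<epsilon> poly_Delta poly_counit \<phi>"
    and \<psi>: "coalgebra_morphism \<Delta> \<epsilon> poly_Delta poly_counit \<psi>"
    and eq: "poly_counit' \<circ> \<phi> = poly_counit' \<circ> \<psi>"
  shows "\<phi> = \<psi>"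
proof
  fix a
  have rec: "poly (f a) (of_nat (Suc k)) = tensor_lift (\<lambda>x y. poly_counit' (f x) * poly (f y) (of_nat k)) (\<Delta> a)"
    and base: "poly (f a) (of_nat 0) = \<epsilon> a"
    if f: "coalgebra_morphism \<Delta> \<epsilon> poly_Delta poly_counit f" for f a k
  proof -
    have lin: "linearQ f" and \<Delta>: "poly_Delta (f a) = tensor_map f f (\<Delta> a)"
      and \<epsilon>: "poly (f a) 0 = \<epsilon> a"
      using f by (auto simp: coalgebra_morphism_def fun_eq_iff poly_counit_def)
    show "poly (f a) (of_nat 0) = \<epsilon> a" using \<epsilon> by simp
    show "poly (f a) (of_nat (Suc k)) = tensor_lift (\<lambda>x y. poly_counit' (f x) * poly (f y) (of_nat k)) (\<Delta> a)"
      using eval_poly_Delta[of 1 "of_nat k" "f a"] eval_tensor_map[OF lin lin]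
      by (simp add: \<Delta> poly_counit'_def)
  qed
  have "poly (\<phi> a) (of_nat k) = poly (\<psi> a) (of_nat k)" for k a
  proof (induction k arbitrary: a)
    case 0
    show ?case by (simp only: base[OF \<phi>] base[OF \<psi>])
  next
    case (Suc k)
    have "poly_counit' (\<phi> x) = poly_counit' (\<psi> x)" for x
      using eq by (simp add: fun_eq_iff)
    then show ?case by (simp only: rec[OF \<phi>] rec[OF \<psi>] Suc)
  qed
  then show "\<phi> a = \<psi> a" by (rule poly_eq_on_naturals)
qed

section \<open>The morphism from QSym to polynomials\<close>

lemma linear_H: "linearQ H_qsym"
  unfolding H_qsym_def by (rule linearQ_qsym_ext)

lemma poly_H_M:
  assumes "0 \<notin> set u"
  shows "poly (H_qsym (M_qsym u)) (of_nat k) = of_nat (k choose length u)"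
  by (simp add: H_qsym_def qsym_ext_M assms binomial_gbinomial gbinomial_prod_rev poly_prod
      lessThan_atLeast0)

text \<open>
  The number of terms in the realization of \<open>M\<^sub>u\<close> in \<open>N - m\<close> variables. Since realizations
  are multiplicative, so is evaluation of \<open>H\<close> at a natural number.
\<close>
lemma monomial_quasisym_ones:
  "monomial_quasisym (\<lambda>_. 1 :: rat) N m u = of_nat ((N - m) choose length u)"
proof (induction "N - m" arbitrary: m u)
  case 0
  then show ?case by (cases u) auto
next
  case (Suc k)
  show ?case
  proof (cases u)
    case (Cons a v)
    have m: "m < N" "k = N - Suc m" "N - m = Suc k" using Suc(2) by auto
    then show ?thesis
      using Suc(1)[of "Suc m" v] Suc(1)[of "Suc m" u]
      by (simp add: Cons monomial_quasisym_Cons_if[of _ N m] del: monomial_quasisym.simps(2))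
  qed simp
qed

lemma poly_H_eq_monomial:
  "poly (H_qsym p) (of_nat k) = qsym_ext (monomial_quasisym (\<lambda>_. 1) k 0) p"
  by (rule linear_qsym_eqI[OF linearQ_compose[OF linearQ_poly_eval linear_H] linearQ_qsym_ext])
    (simp add: poly_H_M qsym_ext_M monomial_quasisym_ones)

lemma H_algebra_morphism: "algebra_morphism H_qsym"
  unfolding algebra_morphism_def
proof (intro conjI allI linear_H)
  show "H_qsym 1 = 1"
    by (simp add: H_qsym_def qsym_ext_M flip: M_qsym_Nil)
  show "H_qsym (p * q) = H_qsym p * H_qsym q" for p q
    by (rule poly_eq_on_naturals) (simp add: poly_H_eq_monomial monomial_quasisym_mult)
qed

lemma sum_deconcatenations:
  "(\<Sum>(u, v) | u @ v = w. G u v) = (\<Sum>i\<le>length w. G (take i w) (drop i w))"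
  by (rule sum.reindex_bij_witness[where i = "\<lambda>i. (take i w, drop i w)" and j = "\<lambda>(u, v). length u"]) auto

lemma vandermonde_words:
  "(\<Sum>(u, v) | u @ v = w. (k choose length u) * (l choose length v)) = (k + l) choose length w"
  by (simp add: sum_deconcatenations vandermonde)

text \<open>
  Combinatorially, the coefficient of \<open>z\<^sup>n\<close>, \<open>n = length w\<close>, in \<open>(1 + ((1 + z)\<^sup>l - 1))\<^sup>k\<close>. The
  induction on \<open>k\<close> multiplies by one more factor \<open>(1 + z)\<^sup>l\<close>: Pascal's rule separates off the first
  block, which together with the possibility of an empty first block gives a Vandermonde sum.
\<close>
lemma binomial_factorizations:
  "(\<Sum>ws\<in>factorizations w. (k choose length ws) * prod_list (map (\<lambda>x. l choose length x) ws))
    = (k * l) choose length w"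
proof (induction k arbitrary: w)
  case 0
  show ?case
    by (subst sum_factorizations) (cases w; simp)
next
  case (Suc k)
  let ?P = "\<lambda>ws. prod_list (map (\<lambda>x. l choose length x) ws)"
  let ?E = "\<lambda>k w. \<Sum>ws\<in>factorizations w. (k choose length ws) * ?P ws"
  have fin: "finite {(x, y). x @ y = w \<and> x \<noteq> []}"
    by (rule finite_subset[OF _ finite_deconcatenations[of w]]) auto
  have "?E (Suc k) w = ?E k w + (\<Sum>(x, y) | x @ y = w \<and> x \<noteq> []. (l choose length x) * ?E k y)"
    by (subst (1 2) sum_factorizations)
      (simp add: case_prod_unfold sum.distrib algebra_simps sum_distrib_left)
  also have "?E k w = (\<Sum>(x, y) | x @ y = w \<and> x = []. (l choose length x) * ?E k y)"
  proof -
    have "{(x, y). x @ y = w \<and> x = []} = {([], w)}" by auto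
    then show ?thesis by simp
  qed
  also have "\<dots> + (\<Sum>(x, y) | x @ y = w \<and> x \<noteq> []. (l choose length x) * ?E k y)
    = (\<Sum>(x, y) | x @ y = w. (l choose length x) * ?E k y)"
  proof (rule sum.union_disjoint[symmetric, THEN trans])
    show "finite {(x, y). x @ y = w \<and> x = []}"
      by (rule finite_subset[OF _ finite_deconcatenations[of w]]) auto
  qed (use fin in \<open>auto intro!: sum.cong\<close>)
  also have "\<dots> = (l + k * l) choose length w"
    by (simp only: Suc vandermonde_words)
  finally show ?case by (simp add: add.commute)
qed

lemma H_morphism_Delta: "bialgebra_morphism qsym_Delta qsym_counit poly_Delta poly_counit H_qsym"
proof -
  have "poly_Delta (H_qsym p) = tensor_map H_qsym H_qsym (qsym_Delta p)" for p
  proof (rule eval_tensor_eqI)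
    fix k l
    show "eval_tensor (of_nat k) (of_nat l) (poly_Delta (H_qsym p)) =
      eval_tensor (of_nat k) (of_nat l) (tensor_map H_qsym H_qsym (qsym_Delta p))"
      unfolding eval_poly_Delta of_nat_add[symmetric]
    proof (rule linear_qsym_eqI[OF linearQ_compose[OF linearQ_poly_eval linear_H]
          linearQ_compose[OF linear_eval_tensor linearQ_compose[OF linearQ_tensor_map linear_qsym_Delta]]])
      fix w :: "nat list" assume w: "0 \<notin> set w"
      have "eval_tensor (of_nat k) (of_nat l) (tensor_map H_qsym H_qsym (qsym_Delta (M_qsym w)))
        = (\<Sum>(u, v) | u @ v = w. poly (H_qsym (M_qsym u)) (of_nat k) * poly (H_qsym (M_qsym v)) (of_nat l))"
        unfolding qsym_Delta_def qsym_ext_M[OF w] linearQ_sum[OF linearQ_tensor_map] linearQ_sum[OF linear_eval_tensor]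
        by (simp add: case_prod_unfold tensor_map_tens linear_H eval_tensor_tens)
      also have "\<dots> = (\<Sum>(u, v) | u @ v = w. of_nat ((k choose length u) * (l choose length v)))"
        by (rule sum.cong) (use w in \<open>auto simp: poly_H_M\<close>)
      also have "\<dots> = of_nat (k + l choose length w)"
        by (simp add: case_prod_unfold flip: vandermonde_words)
      finally show "poly (H_qsym (M_qsym w)) (of_nat (k + l)) =
        eval_tensor (of_nat k) (of_nat l) (tensor_map H_qsym H_qsym (qsym_Delta (M_qsym w)))"
        by (simp only: poly_H_M[OF w])
    qed
  qed
  moreover have "poly_counit (H_qsym p) = qsym_counit p" for p
    unfolding poly_counit_def
  proof (rule linear_qsym_eqI[OF linearQ_compose[OF linearQ_poly_eval linear_H]])
    show "linearQ qsym_counit" by (simp add: qsym_counit_eq_coeff linearQ_coeff_qsym)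
    show "poly (H_qsym (M_qsym u)) 0 = qsym_counit (M_qsym u)" if "0 \<notin> set u" for u
      using poly_H_M[OF that, of 0] that by (cases u) (auto simp: qsym_counit_def qsym_ext_M)
  qed
  ultimately show ?thesis
    using H_algebra_morphism linear_H
    by (auto simp: bialgebra_morphism_def coalgebra_morphism_def fun_eq_iff)
qed

lemma H_morphism_delta: "bialgebra_morphism qsym_delta qsym_counit' poly_delta poly_counit' H_qsym"
proof -
  have H1: "H_qsym 1 = 1" and Hmult: "H_qsym (p * q) = H_qsym p * H_qsym q" for p q
    using H_algebra_morphism by (auto simp: algebra_morphism_def)
  have "poly_delta (H_qsym p) = tensor_map H_qsym H_qsym (qsym_delta p)" for p
  proof (rule eval_tensor_eqI)
    fix k l
    show "eval_tensor (of_nat k) (of_nat l) (poly_delta (H_qsym p)) =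
      eval_tensor (of_nat k) (of_nat l) (tensor_map H_qsym H_qsym (qsym_delta p))"
      unfolding eval_poly_delta of_nat_mult[symmetric]
    proof (rule linear_qsym_eqI[OF linearQ_compose[OF linearQ_poly_eval linear_H]
          linearQ_compose[OF linear_eval_tensor linearQ_compose[OF linearQ_tensor_map linear_qsym_delta]]])
      fix w :: "nat list" assume w: "0 \<notin> set w"
      have H_prod: "poly (H_qsym (prod_list (map M_qsym ws))) (of_nat l)
          = of_nat (prod_list (map (\<lambda>x. l choose length x) ws))"
        if "\<And>x. x \<in> set ws \<Longrightarrow> 0 \<notin> set x" for ws
        using that by (induction ws) (simp_all add: H1 Hmult poly_H_M)
      have "eval_tensor (of_nat k) (of_nat l) (tensor_map H_qsym H_qsym (qsym_delta (M_qsym w)))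
        = (\<Sum>ws\<in>factorizations w. poly (H_qsym (M_qsym (map sum_list ws))) (of_nat k)
            * poly (H_qsym (prod_list (map M_qsym ws))) (of_nat l))"
        unfolding qsym_delta_def qsym_ext_M[OF w] linearQ_sum[OF linearQ_tensor_map] linearQ_sum[OF linear_eval_tensor]
        by (simp add: tensor_map_tens linear_H eval_tensor_tens)
      also have "\<dots> = (\<Sum>ws\<in>factorizations w. of_nat ((k choose length ws) * prod_list (map (\<lambda>x. l choose length x) ws)))"
      proof (rule sum.cong[OF refl])
        fix ws assume ws: "ws \<in> factorizations w"
        show "poly (H_qsym (M_qsym (map sum_list ws))) (of_nat k) * poly (H_qsym (prod_list (map M_qsym ws))) (of_nat l)
          = of_nat ((k choose length ws) * prod_list (map (\<lambda>x. l choose length x) ws))"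
          using poly_H_M[OF zero_notin_block_sums[OF w ws], of k] H_prod[of ws]
            zero_notin_factorization[OF w ws] by simp
      qed
      also have "\<dots> = of_nat (k * l choose length w)"
        by (simp only: binomial_factorizations of_nat_sum[symmetric])
      finally show "poly (H_qsym (M_qsym w)) (of_nat (k * l)) =
        eval_tensor (of_nat k) (of_nat l) (tensor_map H_qsym H_qsym (qsym_delta (M_qsym w)))"
        by (simp only: poly_H_M[OF w])
    qed
  qed
  moreover have "poly_counit' (H_qsym p) = qsym_counit' p" for p
    unfolding poly_counit'_def
  proof (rule linear_qsym_eqI[OF linearQ_compose[OF linearQ_poly_eval linear_H] linear_qsym_counit'])
    show "poly (H_qsym (M_qsym u)) 1 = qsym_counit' (M_qsym u)" if "0 \<notin> set u" for u
      using poly_H_M[OF that, of 1] that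
      by (cases u; cases "tl u") (auto simp: qsym_counit'_def qsym_ext_M)
  qed
  ultimately show ?thesis
    using H_algebra_morphism linear_H
    by (auto simp: bialgebra_morphism_def coalgebra_morphism_def fun_eq_iff)
qed

lemma bialgebra_morphism_comp:
  assumes f: "bialgebra_morphism \<Delta> \<epsilon> \<Delta>' \<epsilon>' f" and g: "bialgebra_morphism \<Delta>' \<epsilon>' \<Delta>'' \<epsilon>'' g"
  shows "bialgebra_morphism \<Delta> \<epsilon> \<Delta>'' \<epsilon>'' (g \<circ> f)"
proof -
  have lin: "linearQ f" "linearQ g"
    using f g by (auto simp: bialgebra_morphism_def coalgebra_morphism_def)
  have "\<Delta>'' (g (f a)) = tensor_map (g \<circ> f) (g \<circ> f) (\<Delta> a)" for a
    using f g tensor_map_map[OF lin(1) lin(1) lin(2) lin(2), of "\<Delta> a"]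
    by (simp add: bialgebra_morphism_def coalgebra_morphism_def fun_eq_iff comp_def)
  then show ?thesis
    using f g linearQ_compose[OF lin(2,1)]
    by (auto simp: bialgebra_morphism_def coalgebra_morphism_def algebra_morphism_def fun_eq_iff comp_def)
qed

section \<open>Morphisms of double bialgebras to QSym\<close>

theorem theorem3p4:
  fixes \<Delta> \<delta> :: "'a::rat_algebra_1 \<Rightarrow> 'a \<otimes> 'a"
    and \<epsilon> \<epsilon>' :: "'a \<Rightarrow> rat"
    and A :: "nat \<Rightarrow> 'a set"
  assumes "hopf_algebra \<Delta> \<epsilon>"
    and "graded_connected A \<Delta>"
    and "bialgebra \<delta> \<epsilon>'"
    and "cointeraction \<Delta> \<epsilon> \<delta>"
  shows
    "((\<exists>\<Phi>\<^sub>1. homogeneous A qsym_grading \<Phi>\<^sub>1 \<and>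
            bialgebra_morphism \<Delta> \<epsilon> qsym_Delta qsym_counit \<Phi>\<^sub>1 \<and>
            bialgebra_morphism \<delta> \<epsilon>' qsym_delta qsym_counit' \<Phi>\<^sub>1)
      \<longleftrightarrow>
      (\<forall>n. \<delta> ` A n \<subseteq> tensor_set (A n) UNIV
                   + tensor_set (linear_kernel (Phi A \<Delta> \<epsilon> \<epsilon>')) UNIV
                   + tensor_set UNIV (linear_kernel (Phi A \<Delta> \<epsilon> \<epsilon>'))))
     \<and>
     (\<forall>\<Phi>\<^sub>1. homogeneous A qsym_grading \<Phi>\<^sub>1 \<and>
            bialgebra_morphism \<Delta> \<epsilon> qsym_Delta qsym_counit \<Phi>\<^sub>1 \<and>
            bialgebra_morphism \<delta> \<epsilon>' qsym_delta qsym_counit' \<Phi>\<^sub>1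
        \<longrightarrow> \<Phi>\<^sub>1 = Phi A \<Delta> \<epsilon> \<epsilon>' \<and>
            (\<forall>\<phi>. bialgebra_morphism \<Delta> \<epsilon> poly_Delta poly_counit \<phi> \<and>
                 bialgebra_morphism \<delta> \<epsilon>' poly_delta poly_counit' \<phi>
               \<longleftrightarrow> \<phi> = H_qsym \<circ> \<Phi>\<^sub>1))
     \<and>
     ((\<forall>n. \<delta> ` A n \<subseteq> tensor_set (A n) UNIV + tensor_set (linear_kernel (Phi A \<Delta> \<epsilon> \<epsilon>')) UNIV)
        \<longrightarrow> (\<forall>\<alpha>. character \<alpha> \<longrightarrow>
              Phi A \<Delta> \<epsilon> \<alpha> = char_action \<delta> (Phi A \<Delta> \<epsilon> \<epsilon>') \<alpha>))"
proof -
  interpret cointeracting_bialgebras \<Delta> \<epsilon> A \<delta> \<epsilon>'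
    by unfold_locales (use assms in \<open>simp_all add: hopf_algebra_def\<close>)
  define both where "both \<Psi> \<longleftrightarrow> homogeneous A qsym_grading \<Psi> \<and>
    bialgebra_morphism \<Delta> \<epsilon> qsym_Delta qsym_counit \<Psi> \<and>
    bialgebra_morphism \<delta> \<epsilon>' qsym_delta qsym_counit' \<Psi>" for \<Psi>
  have unique: "\<Psi> = \<Phi>" if "both \<Psi>" for \<Psi>
    using that by (intro Phi_eqI[symmetric])
      (auto simp: both_def bialgebra_morphism_def coalgebra_morphism_def)
  have iff: "(\<exists>\<Psi>. both \<Psi>) \<longleftrightarrow> (\<forall>n. \<delta> ` A n \<subseteq> tensor_set (A n) UNIV
      + tensor_set (linear_kernel \<Phi>) UNIV + tensor_set UNIV (linear_kernel \<Phi>))" (is "_ \<longleftrightarrow> ?deg")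
  proof
    assume "\<exists>\<Psi>. both \<Psi>"
    then have "bialgebra_morphism \<delta> \<epsilon>' qsym_delta qsym_counit' \<Phi>"
      using unique by (auto simp: both_def)
    then show ?deg
      using delta_degree_of_morphism by blast
  next
    assume ?deg
    then have "both \<Phi>"
      using \<Phi>_delta_morphism Phi_homogeneous[OF character_\<epsilon>'] Phi_bialgebra_morphism[OF character_\<epsilon>']
      by (simp add: both_def)
    then show "\<exists>\<Psi>. both \<Psi>" by blast
  qed
  have poly: "bialgebra_morphism \<Delta> \<epsilon> poly_Delta poly_counit \<phi> \<and> bialgebra_morphism \<delta> \<epsilon>' poly_delta poly_counit' \<phi>
      \<longleftrightarrow> \<phi> = H_qsym \<circ> \<Psi>" if \<Psi>: "both \<Psi>" for \<Psi> \<phi>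
  proof -
    have H: "bialgebra_morphism \<Delta> \<epsilon> poly_Delta poly_counit (H_qsym \<circ> \<Psi>)"
      "bialgebra_morphism \<delta> \<epsilon>' poly_delta poly_counit' (H_qsym \<circ> \<Psi>)"
      using \<Psi> bialgebra_morphism_comp[OF _ H_morphism_Delta] bialgebra_morphism_comp[OF _ H_morphism_delta]
      by (auto simp: both_def)
    then show ?thesis
      using poly_morphism_unique[of \<Delta> \<epsilon> \<phi> "H_qsym \<circ> \<Psi>"]
      by (auto simp: bialgebra_morphism_def coalgebra_morphism_def)
  qed
  show ?thesis
    using iff unique poly Phi_eq_char_action by (simp only: both_def[symmetric]) simp
qed

end
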